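(* Let $d\ge2$, $r>0$, $a>0$. Let $(y(t))_{t\ge0}$ be the $[r/2,\infty)$-valued process solving the reflected stochastic differential equation $$\mathrm dy(t)=\tfrac1{\sqrt2}\,\mathrm dW(t)-2a\,y(t)\,\mathrm dt+\frac{d-1}{4y(t)}\,\mathrm dt+2y(t)\,\mathrm dL(t),$$ where $W$ is a standard one-dimensional Brownian motion and $L$ is a nondecreasing continuous process with $L(0)=0$ increasing only when $y(t)=r/2$ (this is the half distance $|X_1-X_2|/2$ between the centers of two Brownian hard balls of radius $r/2$ in $\mathbb R^d$ with quadratic attraction of strength $a$ and elastic collisions). Let $(P_t)_{t\ge0}$ be its transition probabilities and let $\nu_a(\mathrm d\rho)=Z_a^{-1}\rho^{d-1}e^{-4a\rho^2}\mathbf 1_{\{\rho>r/2\}}\,\mathrm d\rho$ be its reversible probability measure. Then for every $y>r/2$ there is a finite constant $C(y)$ such that $$\|P_t(y,\cdot)-\nu_a\|_{\mathrm{TV}}\le C(y)\,e^{-4at}\quad\text{for all } t\ge0.$$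
   Context: $\|\cdot\|_{\mathrm{TV}}$ is the total variation distance; $Z_a$ is the normalizing constant of $\nu_a$. *)

theory Defs
  imports "HOL-Probability.Probability"
begin

definition std_BM :: "'a measure \<Rightarrow> (real \<Rightarrow> 'a \<Rightarrow> real) \<Rightarrow> bool" where
  "std_BM M W \<longleftrightarrow> prob_space M
     \<and> (\<forall>t\<ge>0. W t \<in> borel_measurable M)
     \<and> (\<forall>\<omega>\<in>space M. W 0 \<omega> = 0 \<and> continuous_on {0..} (\<lambda>t. W t \<omega>))
     \<and> (\<forall>s t. 0 \<le> s \<and> s < t \<longrightarrow>
           distributed M lborel (\<lambda>\<omega>. W t \<omega> - W s \<omega>) (normal_density 0 (sqrt (t - s))))
     \<and> (\<forall>ts :: real list. sorted ts \<and> ts \<noteq> [] \<and> hd ts \<ge> 0 \<longrightarrow>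
           prob_space.indep_vars M (\<lambda>_. borel)
             (\<lambda>i \<omega>. W (ts ! Suc i) \<omega> - W (ts ! i) \<omega>) {..<length ts - 1})"

definition LS_measure :: "(real \<Rightarrow> real) \<Rightarrow> real measure" where
  "LS_measure l = interval_measure (\<lambda>s. l (max 0 s))"

text \<open>(y, L) solves, on the probability space M with Brownian motion W, the reflected SDE
  dy = (1/sqrt 2) dW - 2 a y dt + (d-1)/(4y) dt + 2 y dL,  y(0) = y0,
  y \<ge> r/2, L continuous nondecreasing, L(0)=0, L increasing only when y = r/2.
  Since the diffusion coefficient is constant, the equation is written pathwise.\<close>
definition refl_solution ::
  "nat \<Rightarrow> real \<Rightarrow> real \<Rightarrow> real \<Rightarrow> 'a measure \<Rightarrow> (real \<Rightarrow> 'a \<Rightarrow> real)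
     \<Rightarrow> (real \<Rightarrow> 'a \<Rightarrow> real) \<Rightarrow> (real \<Rightarrow> 'a \<Rightarrow> real) \<Rightarrow> bool" where
  "refl_solution d r a y0 M W y L \<longleftrightarrow> std_BM M W
     \<and> (\<forall>t\<ge>0. y t \<in> borel_measurable M)
     \<and> (AE \<omega> in M.
          y 0 \<omega> = y0
        \<and> continuous_on {0..} (\<lambda>t. y t \<omega>)
        \<and> (\<forall>t\<ge>0. y t \<omega> \<ge> r / 2)
        \<and> L 0 \<omega> = 0
        \<and> continuous_on {0..} (\<lambda>t. L t \<omega>)
        \<and> mono_on {0..} (\<lambda>t. L t \<omega>)
        \<and> emeasure (LS_measure (\<lambda>t. L t \<omega>)) {s \<in> {0..}. y s \<omega> \<noteq> r / 2} = 0
        \<and> (\<forall>t\<ge>0. y t \<omega> = y0 + W t \<omega> / sqrt 2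
               + integral {0..t} (\<lambda>s. - 2 * a * y s \<omega> + (real d - 1) / (4 * y s \<omega>))
               + (LINT s:{0..t}|LS_measure (\<lambda>t. L t \<omega>). 2 * y s \<omega>)))"

definition tv_dist :: "real measure \<Rightarrow> real measure \<Rightarrow> real" where
  "tv_dist P Q = (SUP A \<in> sets borel. \<bar>measure P A - measure Q A\<bar>)"

definition Z_a :: "nat \<Rightarrow> real \<Rightarrow> real \<Rightarrow> real" where
  "Z_a d r a = (LBINT \<rho>:{r/2<..}. \<rho> ^ (d - 1) * exp (- 4 * a * \<rho>\<^sup>2))"

definition nu_a :: "nat \<Rightarrow> real \<Rightarrow> real \<Rightarrow> real measure" where
  "nu_a d r a = density lborel
     (\<lambda>\<rho>. ennreal (\<rho> ^ (d - 1) * exp (- 4 * a * \<rho>\<^sup>2) * indicator {r/2<..} \<rho> / Z_a d r a))"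

end

theory Submission
  imports Defs "HOL-Real_Asymp.Real_Asymp"
begin

text \<open>
  Let \<open>l = r/2\<close> and \<open>\<rho>(x) = x\<^sup>d\<^sup>-\<^sup>1 exp (-4ax\<^sup>2)\<close>, so that the generator is \<open>Lg = (\<rho>g')'/(4\<rho>)\<close> with \<open>g'(l) = 0\<close>.
  The tail difference \<open>F\<^sub>t(x) = P(y(t) > x) - \<nu>(x,\<infinity>)\<close> lies in \<open>L\<^sup>2(dx/\<rho>)\<close> on \<open>(l,\<infinity>)\<close>, already at time \<open>0\<close>, and the
  Fokker-Planck equation reads \<open>d/dt T F\<^sub>t = -F\<^sub>t\<close> for the symmetric Green operator \<open>T\<close>. Hence \<open>\<langle>F\<^sub>s, F\<^sub>t\<rangle>\<close>
  depends only on \<open>s + t\<close>, and by Cauchy-Schwarz it is log-convex and decreasing in \<open>s + t\<close>. The Schur test with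
  weight \<open>x\<rho>(x)\<close> bounds \<open>T\<close> by \<open>1/(4a)\<close>, which gives the rate, and telescoping second differences of
  \<open>\<langle>F\<^sub>s, F\<^sub>t\<rangle>\<close> bound \<open>F\<^sub>t\<^sub>+\<^sub>h - F\<^sub>t\<close> by a multiple of \<open>h exp (-4at)\<close>. Testing with the solution
  \<open>Kf\<close> of the Poisson equation \<open>LKf = \<nu>(f) - f\<close> turns this into a bound on \<open>E f(y(t)) - \<nu>(f)\<close> that only
  involves the supremum norm of \<open>f\<close>.

  No stochastic integral is needed: the noise is additive, so Ito's formula in expectation follows from a pathwise
  Taylor expansion together with the independence of \<open>y(s)\<close> from later increments of \<open>W\<close>, the latter because
  \<open>y\<close> is a pathwise limit of projected Euler schemes.
\<close>

section \<open>Log-convexity and symmetric kernels\<close>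


text \<open>Working with tails instead of densities is forced by the starting point: a point mass
  has no density in L^2(\<nu>), but its distribution function lies in the weighted space from time 0
  on. For tails the reflection becomes a Dirichlet condition at \<open>l\<close>, which is why the
  kernel vanishes there. The obstacle is time regularity. The weak equation makes
  \<open>T (F t)\<close> differentiable, while \<open>F\<close> itself is only known to be
  continuous at almost every point, so no generator can be applied to it and its time derivative is
  replaced by difference quotients with a bound uniform in the step. All of this runs along the
  single trajectory of a given solution: scalar functions of s + t take the place of a semigroup and
  its spectral theorem. A squared norm at time t is such a function at 2t, so the bound 1 / (4a) on
  \<open>T\<close> gives the exponent 8a for squares and 4a for norms. Bounding the increments costs
  a fixed amount of time, visible as t - 1, and is absorbed by a factor exp (4a) in the
  constant.\<close>

text \<open>Log-convexity makes the ratios of consecutive values along an arithmetic progression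
  nondecreasing. A single increase would therefore start a geometric growth, which the quadratic
  bound excludes.\<close>

lemma log_convex_antimono:
  fixes f :: "real \<Rightarrow> real"
  assumes nn: "\<And>x. 0 \<le> x \<Longrightarrow> 0 \<le> f x"
    and lc: "\<And>x y. 0 \<le> x \<Longrightarrow> 0 \<le> y \<Longrightarrow> (f ((x + y) / 2))\<^sup>2 \<le> f x * f y"
    and gr: "\<And>x. 0 \<le> x \<Longrightarrow> f x \<le> A * (1 + x)\<^sup>2"
    and xy: "0 \<le> x" "x \<le> y"
  shows "f y \<le> f x"
proof (rule ccontr)
  assume "\<not> f y \<le> f x"
  then have lt: "f x < f y" by simp
  define \<delta> where "\<delta> = y - x"
  have d: "\<delta> > 0" using lt xy by (cases "x = y") (auto simp: \<delta>_def)
  define u where "u n = f (x + real n * \<delta>)" for n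
  have u0: "u 0 = f x" and u1: "u 1 = f y" by (auto simp: u_def \<delta>_def)
  have uu: "(u (Suc n))\<^sup>2 \<le> u n * u (Suc (Suc n))" for n
  proof -
    have "x + real (Suc n) * \<delta> = ((x + real n * \<delta>) + (x + real (Suc (Suc n)) * \<delta>)) / 2"
      by (simp add: field_simps)
    then show ?thesis unfolding u_def using lc[of "x + real n * \<delta>" "x + real (Suc (Suc n)) * \<delta>"] xy d
      by (metis add_nonneg_nonneg less_imp_le mult_nonneg_nonneg of_nat_0_le_iff)
  qed
  have fx: "f x > 0"
  proof (rule ccontr)
    assume "\<not> f x > 0"
    then have "u 0 = 0" using nn[of x] xy u0 by simp
    then have "(u 1)\<^sup>2 \<le> 0" using uu[of 0] by simp
    then show False using u1 lt nn[of x] xy by simp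
  qed
  define q where "q = f y / f x"
  have q1: "q > 1" using lt fx by (simp add: q_def)
  \<comment> \<open>Positivity has to travel with the induction, since the inequality for the next
    ratio is obtained by cancelling \<open>u n\<close>.\<close>
  have step: "u n > 0 \<and> u (Suc n) \<ge> q * u n" for n
  proof (induction n)
    case 0 then show ?case using u0 u1 fx by (simp add: q_def)
  next
    case (Suc n)
    then have p: "u n > 0" and le: "q * u n \<le> u (Suc n)" by auto
    have "q * u n > 0" using q1 p by simp
    then have p2: "u (Suc n) > 0" using le by linarith
    have "(q * u n) * u (Suc n) \<le> u (Suc n) * u (Suc n)" using le p2 by simp
    also have "\<dots> \<le> u n * u (Suc (Suc n))" using uu[of n] by (simp add: power2_eq_square)
    finally have "u n * (q * u (Suc n)) \<le> u n * u (Suc (Suc n))" by (simp add: mult_ac)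
    then show ?case using p p2 by simp
  qed
  have pw: "q ^ n * f x \<le> u n" for n
  proof (induction n)
    case 0 then show ?case using u0 by simp
  next
    case (Suc n)
    have "q ^ Suc n * f x = q * (q ^ n * f x)" by simp
    also have "\<dots> \<le> q * u n" using Suc q1 by simp
    also have "\<dots> \<le> u (Suc n)" using step by simp
    finally show ?case .
  qed
  have "u n \<le> A * (1 + x + real n * \<delta>)\<^sup>2" for n
    using gr[of "x + real n * \<delta>"] xy d by (simp add: u_def add.assoc)
  then have le: "f x \<le> A * ((1 + x + real n * \<delta>)\<^sup>2 / q ^ n)" for n
    using pw[of n] q1 by (simp add: field_simps) (smt (verit))
  have "(\<lambda>n. A * ((1 + x + real n * \<delta>)\<^sup>2 / q ^ n)) \<longlonglongrightarrow> A * 0"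
  proof (rule tendsto_mult_left)
    show "(\<lambda>n. (1 + x + real n * \<delta>)\<^sup>2 / q ^ n) \<longlonglongrightarrow> 0"
      using q1 d xy by real_asymp
  qed
  then have "f x \<le> A * 0" by (rule LIMSEQ_le_const) (use le in auto)
  then show False using fx by simp
qed

section \<open>Square-integrable functions\<close>

definition square_integrable :: "'a measure \<Rightarrow> ('a \<Rightarrow> real) \<Rightarrow> bool" where
  "square_integrable N f \<longleftrightarrow> f \<in> borel_measurable N \<and> integrable N (\<lambda>x. (f x)\<^sup>2)"

lemma square_integrable_mult:
  assumes "square_integrable N f" "square_integrable N g"
  shows "integrable N (\<lambda>x. f x * g x)"
proof (rule Bochner_Integration.integrable_bound)
  show "integrable N (\<lambda>x. (f x)\<^sup>2 + (g x)\<^sup>2)" using assms by (auto simp: square_integrable_def)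
  have [measurable]: "f \<in> borel_measurable N" "g \<in> borel_measurable N" using assms by (auto simp: square_integrable_def)
  show "(\<lambda>x. f x * g x) \<in> borel_measurable N" by measurable
  show "AE x in N. norm (f x * g x) \<le> norm ((f x)\<^sup>2 + (g x)\<^sup>2)"
  proof (rule AE_I2)
    fix x
    have "2 * \<bar>f x\<bar> * \<bar>g x\<bar> \<le> \<bar>f x\<bar>\<^sup>2 + \<bar>g x\<bar>\<^sup>2" by (rule sum_squares_bound)
    moreover have "0 \<le> \<bar>f x\<bar> * \<bar>g x\<bar>" by simp
    ultimately have "\<bar>f x\<bar> * \<bar>g x\<bar> \<le> \<bar>f x\<bar>\<^sup>2 + \<bar>g x\<bar>\<^sup>2" by linarith
    then show "norm (f x * g x) \<le> norm ((f x)\<^sup>2 + (g x)\<^sup>2)"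
      by (simp add: abs_mult)
  qed
qed

lemma square_integrable_diff:
  assumes "square_integrable N f" "square_integrable N g" shows "square_integrable N (\<lambda>x. f x - g x)"
proof -
  have [measurable]: "f \<in> borel_measurable N" "g \<in> borel_measurable N" using assms by (auto simp: square_integrable_def)
  have "integrable N (\<lambda>x. (f x)\<^sup>2 - 2 * (f x * g x) + (g x)\<^sup>2)"
    using assms square_integrable_mult[OF assms] by (auto simp: square_integrable_def)
  then show ?thesis by (auto simp: square_integrable_def power2_diff algebra_simps)
qed

lemma square_integrable_cmult:
  "square_integrable N f \<Longrightarrow> square_integrable N (\<lambda>x. c * f x)"
  by (auto simp: square_integrable_def power_mult_distrib)

lemma square_integrable_add:
  assumes "square_integrable N f" "square_integrable N g"
  shows "square_integrable N (\<lambda>x. f x + g x)"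
  using square_integrable_diff[OF assms(1) square_integrable_cmult[OF assms(2), of "-1"]] by simp

lemma square_integrable_sum:
  "(\<And>i. i \<in> I \<Longrightarrow> square_integrable N (f i)) \<Longrightarrow> square_integrable N (\<lambda>x. \<Sum>i\<in>I. f i x)"
proof (induction I rule: infinite_finite_induct)
  case (insert i I)
  then show ?case using square_integrable_add[of N "f i" "\<lambda>x. \<Sum>i\<in>I. f i x"] by simp
qed (auto simp: square_integrable_def)

lemma square_integrable_bound:
  assumes "square_integrable N f" "g \<in> borel_measurable N" "AE x in N. \<bar>g x\<bar> \<le> f x"
  shows "square_integrable N g"
proof -
  have [measurable]: "f \<in> borel_measurable N" "g \<in> borel_measurable N" using assms by (auto simp: square_integrable_def)
  have "integrable N (\<lambda>x. (g x)\<^sup>2)"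
  proof (rule Bochner_Integration.integrable_bound)
    show "integrable N (\<lambda>x. (f x)\<^sup>2)" using assms by (simp add: square_integrable_def)
    show "AE x in N. norm ((g x)\<^sup>2) \<le> norm ((f x)\<^sup>2)"
      using assms(3) by eventually_elim (simp add: abs_le_square_iff[symmetric])
  qed measurable
  then show ?thesis by (simp add: square_integrable_def)
qed

lemma (in prob_space) square_integrable_imp_integrable:
  assumes "square_integrable M f" shows "integrable M f"
  using square_integrable_mult[OF assms, of "\<lambda>_. 1"] by (auto simp: square_integrable_def)

section \<open>Symmetric nonnegative kernels and the Schur test\<close>

text \<open>The assumption \<open>schur\<close> says that the positive function \<open>h\<close>
  satisfies T h \<le> h / lam. Such a supersolution is a certificate for the operator norm bound 1 /
  lam.\<close>

locale sym_kernel = sigma_finite_measure N for N :: "'b measure" +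
  fixes k :: "'b \<Rightarrow> 'b \<Rightarrow> real" and h :: "'b \<Rightarrow> real" and lam :: real
  assumes k_meas [measurable]: "case_prod k \<in> borel_measurable (N \<Otimes>\<^sub>M N)"
    and k_nonneg: "\<And>x z. 0 \<le> k x z"
    and k_sym: "\<And>x z. k x z = k z x"
    and h_meas [measurable]: "h \<in> borel_measurable N"
    and h_pos: "\<And>x. 0 < h x"
    and lam_pos: "0 < lam"
    and schur: "\<And>z. (\<integral>\<^sup>+x. ennreal (k x z * h x) \<partial>N) \<le> ennreal (h z / lam)"
begin

abbreviation "sq \<equiv> square_integrable N"

definition ip :: "('b \<Rightarrow> real) \<Rightarrow> ('b \<Rightarrow> real) \<Rightarrow> real" where
  "ip f g = (\<integral>x. f x * g x \<partial>N)"

definition T :: "('b \<Rightarrow> real) \<Rightarrow> 'b \<Rightarrow> real" where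
  "T f z = (\<integral>x. k x z * f x \<partial>N)"

lemma ip_commute: "ip f g = ip g f" by (simp add: ip_def mult.commute)

lemma ip_nonneg: "0 \<le> ip f f" by (simp add: ip_def)

lemma ip_diff_right: "sq f \<Longrightarrow> sq g \<Longrightarrow> sq g' \<Longrightarrow> ip f (\<lambda>x. g x - g' x) = ip f g - ip f g'"
  using square_integrable_mult[of N f g] square_integrable_mult[of N f g'] by (simp add: ip_def right_diff_distrib)

lemma ip_diff_left: "sq f \<Longrightarrow> sq g \<Longrightarrow> sq g' \<Longrightarrow> ip (\<lambda>x. g x - g' x) f = ip g f - ip g' f"
  using ip_diff_right[of f g g'] by (simp add: ip_commute)

lemma ip_cauchy_schwarz:
  assumes "sq f" "sq g"
  shows "(ip f g)\<^sup>2 \<le> ip f f * ip g g"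
proof -
  have *: "0 \<le> ip f f - 2 * c * ip f g + c\<^sup>2 * ip g g" for c
  proof -
    have "0 \<le> (\<integral>x. (f x - c * g x)\<^sup>2 \<partial>N)" by simp
    also have "\<dots> = (\<integral>x. f x * f x - 2 * c * (f x * g x) + c\<^sup>2 * (g x * g x) \<partial>N)"
      by (rule Bochner_Integration.integral_cong) (auto simp: power2_eq_square algebra_simps)
    also have "\<dots> = ip f f - 2 * c * ip f g + c\<^sup>2 * ip g g"
      using square_integrable_mult[OF assms] square_integrable_mult[OF assms(1) assms(1)] square_integrable_mult[OF assms(2) assms(2)]
      by (simp add: ip_def)
    finally show ?thesis .
  qed
  show ?thesis
  proof (cases "ip g g = 0")
    case True
    have "ip f g = 0"
    proof (rule ccontr)
      assume "ip f g \<noteq> 0"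
      \<comment> \<open>For vanishing \<open>ip g g\<close> the quadratic in \<open>c\<close>
        becomes affine, and this \<open>c\<close> gives it the value -1.\<close>
      then show False using *[of "(ip f f + 1) / (2 * ip f g)"] True by simp
    qed
    then show ?thesis using True by simp
  next
    case False
    then have p: "ip g g > 0" using ip_nonneg[of g] by simp
    have "0 \<le> ip g g * (ip f f - 2 * (ip f g / ip g g) * ip f g + (ip f g / ip g g)\<^sup>2 * ip g g)"
      using *[of "ip f g / ip g g"] p by simp
    also have "\<dots> = ip f f * ip g g - (ip f g)\<^sup>2"
      using p by (simp add: field_simps power2_eq_square)
    finally show ?thesis by simp
  qed
qed

text \<open>The weight h z / h x is made so that the integral over z is exactly the Schur condition
  at x, which leaves (f x)^2 / lam.\<close>

lemma schur_nn:
  assumes f: "sq f"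
  shows "(\<integral>\<^sup>+x. \<integral>\<^sup>+z. ennreal (k x z * (f x)\<^sup>2 * (h z / h x)) \<partial>N \<partial>N) \<le> ennreal (ip f f / lam)"
proof -
  have [measurable]: "f \<in> borel_measurable N" using assms by (auto simp: square_integrable_def)
  have "(\<integral>\<^sup>+x. \<integral>\<^sup>+z. ennreal (k x z * (f x)\<^sup>2 * (h z / h x)) \<partial>N \<partial>N)
     = (\<integral>\<^sup>+x. ennreal ((f x)\<^sup>2 / h x) * (\<integral>\<^sup>+z. ennreal (k z x * h z) \<partial>N) \<partial>N)"
  proof (rule nn_integral_cong)
    fix x assume [measurable]: "x \<in> space N"
    have "(\<integral>\<^sup>+z. ennreal (k x z * (f x)\<^sup>2 * (h z / h x)) \<partial>N)
        = (\<integral>\<^sup>+z. ennreal ((f x)\<^sup>2 / h x) * ennreal (k z x * h z) \<partial>N)"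
      by (rule nn_integral_cong, subst ennreal_mult[symmetric])
         (use k_nonneg h_pos in \<open>auto simp: k_sym[of x] less_imp_le field_simps\<close>)
    also have "\<dots> = ennreal ((f x)\<^sup>2 / h x) * (\<integral>\<^sup>+z. ennreal (k z x * h z) \<partial>N)"
      by (rule nn_integral_cmult) measurable
    finally show "(\<integral>\<^sup>+z. ennreal (k x z * (f x)\<^sup>2 * (h z / h x)) \<partial>N)
        = ennreal ((f x)\<^sup>2 / h x) * (\<integral>\<^sup>+z. ennreal (k z x * h z) \<partial>N)" .
  qed
  also have "\<dots> \<le> (\<integral>\<^sup>+x. ennreal ((f x)\<^sup>2 / h x) * ennreal (h x / lam) \<partial>N)"
    by (intro nn_integral_mono mult_left_mono schur) auto
  also have "\<dots> = (\<integral>\<^sup>+x. ennreal ((f x)\<^sup>2 / lam) \<partial>N)"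
  proof (rule nn_integral_cong)
    fix x show "ennreal ((f x)\<^sup>2 / h x) * ennreal (h x / lam) = ennreal ((f x)\<^sup>2 / lam)"
      using h_pos[of x] lam_pos by (subst ennreal_mult[symmetric]) (auto simp: less_imp_le)
  qed
  also have "\<dots> = ennreal (\<integral>x. (f x)\<^sup>2 / lam \<partial>N)"
    using f lam_pos by (intro nn_integral_eq_integral) (auto simp: square_integrable_def)
  also have "(\<integral>x. (f x)\<^sup>2 / lam \<partial>N) = ip f f / lam"
    by (simp add: ip_def power2_eq_square)
  finally show ?thesis .
qed

text \<open>Young's inequality splits k f g into two terms with the weights h z / h x and h x / h z;
  by symmetry of the kernel \<open>schur_nn\<close> controls both. The integrability on the product
  space licenses the later uses of Fubini, and f = g gives the norm bound for
  \<open>T\<close>.\<close>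

lemma schur_product:
  assumes f: "sq f" and g: "sq g"
  shows "integrable (N \<Otimes>\<^sub>M N) (\<lambda>(x, z). k x z * f x * g z)"
    and "\<bar>\<integral>p. (case p of (x, z) \<Rightarrow> k x z * f x * g z) \<partial>(N \<Otimes>\<^sub>M N)\<bar> \<le> (ip f f + ip g g) / (2 * lam)"
proof -
  interpret NN: pair_sigma_finite N N by standard
  have [measurable]: "f \<in> borel_measurable N" "g \<in> borel_measurable N" using assms by (auto simp: square_integrable_def)
  have b1: "(\<integral>\<^sup>+p. ennreal (case p of (x, z) \<Rightarrow> k x z * (f x)\<^sup>2 * (h z / h x)) \<partial>(N \<Otimes>\<^sub>M N)) \<le> ennreal (ip f f / lam)"
    by (subst nn_integral_fst[symmetric]) (use schur_nn[OF f] in auto)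
  have b2: "(\<integral>\<^sup>+p. ennreal (case p of (x, z) \<Rightarrow> k x z * (g z)\<^sup>2 * (h x / h z)) \<partial>(N \<Otimes>\<^sub>M N)) \<le> ennreal (ip g g / lam)"
    by (subst NN.nn_integral_snd[symmetric]) (use schur_nn[OF g] in \<open>auto simp: k_sym\<close>)
  have pw: "2 * \<bar>k x z * f x * g z\<bar> \<le> k x z * (f x)\<^sup>2 * (h z / h x) + k x z * (g z)\<^sup>2 * (h x / h z)" for x z
  proof -
    have hx: "h x > 0" "h z > 0" using h_pos by auto
    \<comment> \<open>Scaling the two factors by s and 1 / s makes Young's inequality produce
      precisely the two Schur weights.\<close>
    define s where "s = sqrt (h z / h x)"
    have s: "s > 0" "s\<^sup>2 = h z / h x" "(1/s)\<^sup>2 = h x / h z" using hx by (auto simp: s_def power_divide)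
    have "2 * (\<bar>f x\<bar> * s) * (\<bar>g z\<bar> * (1/s)) \<le> (\<bar>f x\<bar> * s)\<^sup>2 + (\<bar>g z\<bar> * (1/s))\<^sup>2"
      by (rule sum_squares_bound)
    then have "2 * (\<bar>f x\<bar> * \<bar>g z\<bar>) \<le> (f x)\<^sup>2 * (h z / h x) + (g z)\<^sup>2 * (h x / h z)"
      using s unfolding power_mult_distrib s(2) s(3) by simp
    from mult_left_mono[OF this k_nonneg[of x z]] show ?thesis
      using k_nonneg[of x z] by (simp add: abs_mult algebra_simps)
  qed
  have "(\<integral>\<^sup>+p. ennreal (2 * \<bar>case p of (x, z) \<Rightarrow> k x z * f x * g z\<bar>) \<partial>(N \<Otimes>\<^sub>M N))
     \<le> (\<integral>\<^sup>+p. ennreal (case p of (x, z) \<Rightarrow> k x z * (f x)\<^sup>2 * (h z / h x)) + ennreal (case p of (x, z) \<Rightarrow> k x z * (g z)\<^sup>2 * (h x / h z)) \<partial>(N \<Otimes>\<^sub>M N))"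
  proof (rule nn_integral_mono)
    fix p :: "'b \<times> 'b"
    obtain x z where p: "p = (x, z)" by (cases p)
    have "h x > 0" "h z > 0" "k x z \<ge> 0" using h_pos k_nonneg by auto
    then show "ennreal (2 * \<bar>case p of (x, z) \<Rightarrow> k x z * f x * g z\<bar>) \<le> ennreal (case p of (x, z) \<Rightarrow> k x z * (f x)\<^sup>2 * (h z / h x)) + ennreal (case p of (x, z) \<Rightarrow> k x z * (g z)\<^sup>2 * (h x / h z))"
      unfolding p prod.case using pw[of x z] by (simp add: ennreal_plus[symmetric] ennreal_leI del: ennreal_plus times_divide_eq_right)
  qed
  also have "\<dots> = (\<integral>\<^sup>+p. ennreal (case p of (x, z) \<Rightarrow> k x z * (f x)\<^sup>2 * (h z / h x)) \<partial>(N \<Otimes>\<^sub>M N)) + (\<integral>\<^sup>+p. ennreal (case p of (x, z) \<Rightarrow> k x z * (g z)\<^sup>2 * (h x / h z)) \<partial>(N \<Otimes>\<^sub>M N))"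
    by (rule nn_integral_add) measurable
  also have "\<dots> \<le> ennreal (ip f f / lam) + ennreal (ip g g / lam)"
    by (intro add_mono b1 b2)
  also have "\<dots> = ennreal (ip f f / lam + ip g g / lam)"
    using ip_nonneg lam_pos by (subst ennreal_plus) auto
  finally have tot: "(\<integral>\<^sup>+p. ennreal (2 * \<bar>case p of (x, z) \<Rightarrow> k x z * f x * g z\<bar>) \<partial>(N \<Otimes>\<^sub>M N)) \<le> ennreal (ip f f / lam + ip g g / lam)" .
  have int2: "integrable (N \<Otimes>\<^sub>M N) (\<lambda>p. 2 * \<bar>case p of (x, z) \<Rightarrow> k x z * f x * g z\<bar>)"
    by (rule integrableI_bounded) (use le_less_trans[OF tot] in auto)
  then have int3: "integrable (N \<Otimes>\<^sub>M N) (\<lambda>p. \<bar>case p of (x, z) \<Rightarrow> k x z * f x * g z\<bar>)" by simp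
  then show int: "integrable (N \<Otimes>\<^sub>M N) (\<lambda>(x, z). k x z * f x * g z)"
    by (subst (asm) integrable_abs_iff) auto
  have "ennreal (\<integral>p. 2 * \<bar>case p of (x, z) \<Rightarrow> k x z * f x * g z\<bar> \<partial>(N \<Otimes>\<^sub>M N)) \<le> ennreal (ip f f / lam + ip g g / lam)"
    using tot nn_integral_eq_integral[OF int2] by simp
  then have e1: "(\<integral>p. 2 * \<bar>case p of (x, z) \<Rightarrow> k x z * f x * g z\<bar> \<partial>(N \<Otimes>\<^sub>M N)) \<le> ip f f / lam + ip g g / lam"
    using ip_nonneg lam_pos by (subst (asm) ennreal_le_iff) auto
  have e2: "\<bar>\<integral>p. (case p of (x, z) \<Rightarrow> k x z * f x * g z) \<partial>(N \<Otimes>\<^sub>M N)\<bar> \<le> (\<integral>p. \<bar>case p of (x, z) \<Rightarrow> k x z * f x * g z\<bar> \<partial>(N \<Otimes>\<^sub>M N))"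
    by (rule integral_abs_bound)
  have e3: "(ip f f + ip g g) / (2 * lam) = (ip f f / lam + ip g g / lam) / 2"
    by (simp add: add_divide_distrib)
  have aux: "Y \<le> S / 2" if "2 * X \<le> S" "Y \<le> X" for X Y S :: real using that by simp
  show "\<bar>\<integral>p. (case p of (x, z) \<Rightarrow> k x z * f x * g z) \<partial>(N \<Otimes>\<^sub>M N)\<bar> \<le> (ip f f + ip g g) / (2 * lam)"
    unfolding e3 by (rule aux[OF e1[unfolded integral_mult_right_zero] e2])
qed

lemma T_measurable [measurable]:
  assumes [measurable]: "f \<in> borel_measurable N"
  shows "T f \<in> borel_measurable N"
  unfolding T_def by measurable

lemma T_ip:
  assumes f: "sq f" and g: "sq g"
  shows "integrable N (\<lambda>z. g z * T f z)"
    and "ip g (T f) = (\<integral>p. (case p of (x, z) \<Rightarrow> k x z * f x * g z) \<partial>(N \<Otimes>\<^sub>M N))"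
proof -
  interpret NN: pair_sigma_finite N N by standard
  have eq: "(\<integral>x. k x z * f x * g z \<partial>N) = g z * T f z" for z
    by (simp add: T_def mult.commute[of "g z"])
  show "integrable N (\<lambda>z. g z * T f z)"
    using NN.integrable_snd[OF schur_product(1)[OF f g]] unfolding prod.case eq .
  show "ip g (T f) = (\<integral>p. (case p of (x, z) \<Rightarrow> k x z * f x * g z) \<partial>(N \<Otimes>\<^sub>M N))"
    using NN.integral_snd[OF schur_product(1)[OF f g]] unfolding eq by (simp add: ip_def)
qed

lemma T_symmetric:
  assumes f: "sq f" and g: "sq g"
  shows "ip g (T f) = ip f (T g)"
proof -
  interpret NN: pair_sigma_finite N N by standard
  have "ip g (T f) = (\<integral>p. (case p of (x, z) \<Rightarrow> k x z * f x * g z) \<partial>(N \<Otimes>\<^sub>M N))"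
    by (rule T_ip(2)[OF f g])
  also have "\<dots> = (\<integral>x. (\<integral>z. k x z * f x * g z \<partial>N) \<partial>N)"
    using NN.integral_fst[OF schur_product(1)[OF f g]] by simp
  also have "\<dots> = (\<integral>x. f x * T g x \<partial>N)"
    by (rule Bochner_Integration.integral_cong) (auto simp: T_def k_sym mult_ac simp flip: integral_mult_right_zero)
  finally show ?thesis by (simp add: ip_def)
qed

lemma T_bound:
  assumes f: "sq f"
  shows "\<bar>ip f (T f)\<bar> \<le> ip f f / lam"
  using schur_product(2)[OF f f] T_ip(2)[OF f f] by simp


end

section \<open>The abstract evolution d/dt T F = -F\<close>

text \<open>\<open>H \<tau>\<close> is a square-integrable envelope for all times up to \<tau>. The
  equation is imposed only after applying \<open>T\<close>, almost everywhere and separately for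
  each time; with the Lipschitz bound this is the form in which dominated convergence can use it.
  The quadratic \<open>growth\<close> supplies the bound that \<open>log_convex_antimono\<close>
  asks for.\<close>

locale evolution = sym_kernel N k h lam for N :: "'b measure" and k h lam +
  fixes F :: "real \<Rightarrow> 'b \<Rightarrow> real" and H :: "real \<Rightarrow> 'b \<Rightarrow> real" and A :: real
  assumes F_meas [measurable]: "\<And>t. 0 \<le> t \<Longrightarrow> F t \<in> borel_measurable N"
    and H_sq: "\<And>\<tau>. 0 \<le> \<tau> \<Longrightarrow> sq (H \<tau>)"
    and F_le: "\<And>t \<tau>. 0 \<le> t \<Longrightarrow> t \<le> \<tau> \<Longrightarrow> AE x in N. \<bar>F t x\<bar> \<le> H \<tau> x"
    and F_cont: "\<And>t. 0 \<le> t \<Longrightarrow> AE x in N. continuous (at t within {0..}) (\<lambda>s. F s x)"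
    and U_lip: "\<And>s t \<tau>. 0 \<le> s \<Longrightarrow> s \<le> \<tau> \<Longrightarrow> 0 \<le> t \<Longrightarrow> t \<le> \<tau> \<Longrightarrow>
        AE z in N. \<bar>T (F t) z - T (F s) z\<bar> \<le> \<bar>t - s\<bar> * H \<tau> z"
    and U_deriv: "\<And>t. 0 \<le> t \<Longrightarrow>
        AE z in N. ((\<lambda>s. T (F s) z) has_real_derivative - F t z) (at t within {0..})"
    and growth: "\<And>\<tau>. 0 \<le> \<tau> \<Longrightarrow> ip (H \<tau>) (H \<tau>) \<le> A * (1 + \<tau>)\<^sup>2"
begin

lemma F_sq: "0 \<le> t \<Longrightarrow> sq (F t)"
  by (rule square_integrable_bound[OF H_sq F_meas F_le]) auto

lemma F_growth: assumes t: "0 \<le> t" shows "ip (F t) (F t) \<le> A * (1 + t)\<^sup>2"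
proof -
  have "ip (F t) (F t) \<le> ip (H t) (H t)"
    unfolding ip_def
  proof (rule integral_mono_AE)
    show "AE x in N. F t x * F t x \<le> H t x * H t x"
      using F_le[OF t order.refl]
      by eventually_elim (simp add: power2_eq_square[symmetric] abs_le_square_iff[symmetric])
  qed (use square_integrable_mult[OF H_sq[OF t] H_sq[OF t]] square_integrable_mult[OF F_sq[OF t] F_sq[OF t]] in auto)
  then show ?thesis using growth[OF t] by simp
qed

lemma A_nonneg: "0 \<le> A" using F_growth[of 0] ip_nonneg[of "F 0"] by simp

text \<open>The point is that the left slot may move as well. A product rule is out of reach because
  \<open>F\<close> is merely continuous, but the quotient in the right slot still converges while
  the left slot varies. Sequences suit dominated convergence, whose exceptional null sets may depend
  on the index.\<close>

lemma quotient_limit: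
  assumes a: "\<And>n. 0 \<le> a n" "a \<longlonglongrightarrow> a0" and b: "\<And>n. 0 \<le> b n" "b \<longlonglongrightarrow> b0" and ne: "\<And>n. b n \<noteq> b0"
    and pos: "0 \<le> a0" "0 \<le> b0"
  shows "(\<lambda>n. (ip (F (a n)) (T (F (b n))) - ip (F (a n)) (T (F b0))) / (b n - b0)) \<longlonglongrightarrow> - ip (F a0) (F b0)"
proof -
  obtain Ka where Ka: "\<And>n. a n \<le> Ka"
    using convergent_imp_bounded[OF a(2)] unfolding bounded_iff by (metis UNIV_I abs_le_D1 image_eqI real_norm_def)
  obtain Kb where Kb: "\<And>n. b n \<le> Kb"
    using convergent_imp_bounded[OF b(2)] unfolding bounded_iff by (metis UNIV_I abs_le_D1 image_eqI real_norm_def)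
  define \<tau> where "\<tau> = max (max Ka Kb) (max a0 b0)"
  have le: "a n \<le> \<tau>" "b n \<le> \<tau>" "a0 \<le> \<tau>" "b0 \<le> \<tau>" for n
    using Ka[of n] Kb[of n] by (auto simp: \<tau>_def)
  have \<tau>: "0 \<le> \<tau>" using le pos by auto
  have [measurable]: "F (a n) \<in> borel_measurable N" "F (b n) \<in> borel_measurable N" "F a0 \<in> borel_measurable N" "F b0 \<in> borel_measurable N"
    for n using a b pos by auto
  let ?Q = "\<lambda>n x. F (a n) x * ((T (F (b n)) x - T (F b0) x) / (b n - b0))"
  have "(\<lambda>n. \<integral>x. ?Q n x \<partial>N) \<longlonglongrightarrow> (\<integral>x. F a0 x * (- F b0 x) \<partial>N)"
  proof (rule integral_dominated_convergence[where w = "\<lambda>x. H \<tau> x * H \<tau> x"])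
    show "integrable N (\<lambda>x. H \<tau> x * H \<tau> x)" using square_integrable_mult H_sq \<tau> by blast
    show "AE x in N. norm (?Q n x) \<le> H \<tau> x * H \<tau> x" for n
      using F_le[OF a(1) le(1), of n] U_lip[OF pos(2) le(4) b(1) le(2), of n]
    proof eventually_elim
      case (elim x)
      have p: "\<bar>b n - b0\<bar> > 0" using ne[of n] by simp
      have "\<bar>(T (F (b n)) x - T (F b0) x) / (b n - b0)\<bar> \<le> H \<tau> x"
        using elim(2) p by (simp add: abs_divide field_simps)
      then have "\<bar>F (a n) x\<bar> * \<bar>(T (F (b n)) x - T (F b0) x) / (b n - b0)\<bar> \<le> H \<tau> x * H \<tau> x"
        using elim(1) by (intro mult_mono) auto
      then show ?case by (simp only: real_norm_def abs_mult)
    qed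
    show "AE x in N. (\<lambda>n. ?Q n x) \<longlonglongrightarrow> F a0 x * (- F b0 x)"
      using F_cont[OF pos(1)] U_deriv[OF pos(2)]
    proof eventually_elim
      case (elim x)
      have 1: "(\<lambda>n. F (a n) x) \<longlonglongrightarrow> F a0 x"
        using elim(1) a pos by (auto simp: continuous_within_sequentially o_def)
      have "((\<lambda>s. (T (F s) x - T (F b0) x) / (s - b0)) \<longlongrightarrow> - F b0 x) (at b0 within {0..})"
        using elim(2) by (simp add: has_field_derivative_iff)
      then have 2: "(\<lambda>n. (T (F (b n)) x - T (F b0) x) / (b n - b0)) \<longlonglongrightarrow> - F b0 x"
        unfolding tendsto_at_iff_sequentially o_def using b ne by auto
      show ?case by (rule tendsto_mult[OF 1 2])
    qed
  qed measurable
  moreover have Q: "(\<integral>x. ?Q n x \<partial>N) = (ip (F (a n)) (T (F (b n))) - ip (F (a n)) (T (F b0))) / (b n - b0)" for n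
  proof -
    have "(\<integral>x. ?Q n x \<partial>N) = (\<integral>x. (F (a n) x * T (F (b n)) x - F (a n) x * T (F b0) x) / (b n - b0) \<partial>N)"
      by (rule Bochner_Integration.integral_cong) (auto simp: right_diff_distrib)
    also have "\<dots> = (ip (F (a n)) (T (F (b n))) - ip (F (a n)) (T (F b0))) / (b n - b0)"
      using T_ip(1)[OF F_sq F_sq] a b pos by (simp add: ip_def)
    finally show ?thesis .
  qed
  moreover have "(\<integral>x. F a0 x * (- F b0 x) \<partial>N) = - ip (F a0) (F b0)" by (simp add: ip_def)
  ultimately show ?thesis by (simp only: Q)
qed

lemma ip_T_deriv:
  assumes "0 \<le> s" "0 \<le> t"
  shows "((\<lambda>t. ip (F s) (T (F t))) has_real_derivative - ip (F s) (F t)) (at t within {0..})"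
  unfolding has_field_derivative_iff tendsto_at_iff_sequentially o_def
  using quotient_limit[of "\<lambda>_. s" s _ t] assms by auto

text \<open>Along s + t = \<tau> the derivative vanishes: moving the right slot contributes the
  inner product of \<open>F r\<close> and \<open>F (\<tau> - r)\<close>, and moving the left slot
  contributes its negative once \<open>T\<close> has been passed across by symmetry.\<close>

lemma ip_T_shift:
  assumes "0 \<le> s" "0 \<le> t"
  shows "ip (F s) (T (F t)) = ip (F 0) (T (F (s + t)))"
proof -
  define \<tau> where "\<tau> = s + t"
  have \<tau>: "0 \<le> \<tau>" using assms by (simp add: \<tau>_def)
  define q where "q r = ip (F r) (T (F (\<tau> - r)))" for r
  have der: "(q has_real_derivative 0) (at r within {0..\<tau>})" if r: "r \<in> {0..\<tau>}" for r
    unfolding has_field_derivative_iff tendsto_at_iff_sequentially o_def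
  proof safe
    fix X assume X: "\<forall>i. X i \<in> {0..\<tau>} - {r}" and lim: "X \<longlonglongrightarrow> r"
    have Xp: "0 \<le> X n" "X n \<le> \<tau>" "X n \<noteq> r" for n using X by auto
    have 1: "(\<lambda>n. (ip (F (X n)) (T (F (\<tau> - X n))) - ip (F (X n)) (T (F (\<tau> - r)))) / ((\<tau> - X n) - (\<tau> - r))) \<longlonglongrightarrow> - ip (F r) (F (\<tau> - r))"
      by (rule quotient_limit) (use Xp lim r in \<open>auto intro!: tendsto_intros\<close>)
    have 2: "(\<lambda>n. (ip (F (\<tau> - r)) (T (F (X n))) - ip (F (\<tau> - r)) (T (F r))) / (X n - r)) \<longlonglongrightarrow> - ip (F (\<tau> - r)) (F r)"
      by (rule quotient_limit) (use Xp lim r in \<open>auto intro!: tendsto_intros\<close>)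
    \<comment> \<open>Only a slot under \<open>T\<close> is ever differentiated: the change of the
      left slot is rewritten, by symmetry, as a change under \<open>T\<close>.\<close>
    have eq: "(q (X n) - q r) / (X n - r) =
       - ((ip (F (X n)) (T (F (\<tau> - X n))) - ip (F (X n)) (T (F (\<tau> - r)))) / ((\<tau> - X n) - (\<tau> - r)))
       + (ip (F (\<tau> - r)) (T (F (X n))) - ip (F (\<tau> - r)) (T (F r))) / (X n - r)" for n
    proof -
      have s1: "ip (F (\<tau> - r)) (T (F (X n))) = ip (F (X n)) (T (F (\<tau> - r)))"
        using T_symmetric[OF F_sq F_sq] Xp[of n] r by auto
      have s2: "ip (F (\<tau> - r)) (T (F r)) = ip (F r) (T (F (\<tau> - r)))"
        using T_symmetric[OF F_sq F_sq] r by auto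
      have dd: "(\<tau> - X n) - (\<tau> - r) = - (X n - r)" by simp
      show ?thesis unfolding q_def s1 s2 dd by (simp only: divide_minus_right minus_minus) (simp add: diff_divide_distrib)
    qed
    show "(\<lambda>n. (q (X n) - q r) / (X n - r)) \<longlonglongrightarrow> 0"
      using tendsto_add[OF tendsto_minus[OF 1] 2] unfolding eq by (simp add: ip_commute)
  qed
  have "q s = q 0"
  proof -
    have "\<exists>c. \<forall>r\<in>{0..\<tau>}. q r = c"
      by (rule has_field_derivative_zero_constant) (use der in auto)
    then show ?thesis using assms \<tau> by (auto simp: \<tau>_def)
  qed
  then show ?thesis by (simp add: q_def \<tau>_def)
qed

text \<open>At 2t the function \<open>\<Phi>\<close> is the squared norm of \<open>F t\<close>, and
  \<open>\<Phi>\<^sub>1\<close> is the quadratic form of \<open>T\<close> at \<open>F t\<close>. The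
  latter is an antiderivative of minus the former.\<close>

definition \<Phi>\<^sub>1 :: "real \<Rightarrow> real" where "\<Phi>\<^sub>1 \<tau> = ip (F 0) (T (F \<tau>))"
definition \<Phi> :: "real \<Rightarrow> real" where "\<Phi> \<tau> = ip (F 0) (F \<tau>)"

lemma \<Phi>\<^sub>1_deriv: "0 \<le> t \<Longrightarrow> (\<Phi>\<^sub>1 has_real_derivative - \<Phi> t) (at t within {0..})"
  unfolding \<Phi>\<^sub>1_def \<Phi>_def by (rule ip_T_deriv) auto

text \<open>The shift law for \<open>\<Phi>\<^sub>1\<close> is differentiated in \<open>t\<close> in
  two ways, and derivatives within \<open>{0..}\<close> are unique.\<close>

lemma ip_shift:
  assumes s: "0 \<le> s" and t: "0 \<le> t"
  shows "ip (F s) (F t) = \<Phi> (s + t)"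
proof -
  have "((\<lambda>u. \<Phi>\<^sub>1 (s + u)) has_real_derivative - \<Phi> (s + t)) (at t within {0..})"
  proof -
    have "(\<Phi>\<^sub>1 has_real_derivative - \<Phi> (s + t)) (at (s + t) within (+) s ` {0..})"
      by (rule DERIV_subset[OF \<Phi>\<^sub>1_deriv]) (use s t in auto)
    then have "(\<Phi>\<^sub>1 \<circ> (+) s has_real_derivative - \<Phi> (s + t) * 1) (at t within {0..})"
      by (rule DERIV_image_chain) (auto intro!: derivative_eq_intros)
    then show ?thesis by (simp add: o_def)
  qed
  moreover have "((\<lambda>u. \<Phi>\<^sub>1 (s + u)) has_real_derivative - ip (F s) (F t)) (at t within {0..})"
  proof (rule has_field_derivative_transform_within[OF ip_T_deriv[OF s t] zero_less_one])
    show "ip (F s) (T (F x)) = \<Phi>\<^sub>1 (s + x)" if "x \<in> {0..}" for x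
      using ip_T_shift[OF s] that by (simp add: \<Phi>\<^sub>1_def)
  qed (use t in auto)
  moreover have "at t within {0..} \<noteq> bot"
    using at_le[of "{t..t + 1}" "{0..}" t] t at_within_Icc_at_right[of t "t + 1"] trivial_limit_at_right_real[of t]
    by (auto simp: bot_unique)
  ultimately show ?thesis
    using has_field_derivative_unique by fastforce
qed

lemma \<Phi>_nonneg: "0 \<le> t \<Longrightarrow> 0 \<le> \<Phi> t"
  using ip_shift[of "t/2" "t/2"] ip_nonneg[of "F (t/2)"] by simp

lemma \<Phi>_growth: "0 \<le> t \<Longrightarrow> \<Phi> t \<le> A * (1 + t)\<^sup>2"
proof -
  assume t: "0 \<le> t"
  have "\<Phi> t \<le> A * (1 + t/2)\<^sup>2" using ip_shift[of "t/2" "t/2"] F_growth[of "t/2"] t by simp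
  also have "\<dots> \<le> A * (1 + t)\<^sup>2" using A_nonneg t by (intro mult_left_mono power_mono) auto
  finally show ?thesis .
qed

text \<open>Cauchy-Schwarz at the half times is exactly midpoint log-convexity.\<close>

lemma \<Phi>_antimono: "0 \<le> x \<Longrightarrow> x \<le> y \<Longrightarrow> \<Phi> y \<le> \<Phi> x"
proof (rule log_convex_antimono[where f = \<Phi> and A = A])
  fix x y :: real assume xy: "0 \<le> x" "0 \<le> y"
  have "(ip (F (x/2)) (F (y/2)))\<^sup>2 \<le> ip (F (x/2)) (F (x/2)) * ip (F (y/2)) (F (y/2))"
    by (rule ip_cauchy_schwarz) (use xy F_sq in auto)
  then show "(\<Phi> ((x + y) / 2))\<^sup>2 \<le> \<Phi> x * \<Phi> y"
    using xy ip_shift[of "x/2" "y/2"] ip_shift[of "x/2" "x/2"] ip_shift[of "y/2" "y/2"]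
    by (simp add: add_divide_distrib)
qed (use \<Phi>_nonneg \<Phi>_growth in auto)

text \<open>At 2t this second difference is the squared norm of the increment of \<open>F\<close>
  from t to t + \<delta>. It is therefore nonnegative and log-convex for the same reason as
  \<open>\<Phi>\<close>.\<close>

definition \<Psi> :: "real \<Rightarrow> real \<Rightarrow> real" where
  "\<Psi> \<delta> \<tau> = \<Phi> (\<tau> + 2 * \<delta>) - 2 * \<Phi> (\<tau> + \<delta>) + \<Phi> \<tau>"

lemma ip_increment:
  assumes "0 \<le> \<delta>" "0 \<le> s" "0 \<le> t"
  shows "ip (\<lambda>x. F (s + \<delta>) x - F s x) (\<lambda>x. F (t + \<delta>) x - F t x) = \<Psi> \<delta> (s + t)"
proof -
  have sq: "sq (F (s + \<delta>))" "sq (F s)" "sq (F (t + \<delta>))" "sq (F t)" using F_sq assms by auto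
  show ?thesis
    unfolding ip_diff_left[OF square_integrable_diff[OF sq(3,4)] sq(1,2)] ip_diff_right[OF sq(1) sq(3,4)]
      ip_diff_right[OF sq(2) sq(3,4)] using assms by (simp add: ip_shift \<Psi>_def) (simp add: algebra_simps)
qed

lemma \<Psi>_nonneg: "0 \<le> \<delta> \<Longrightarrow> 0 \<le> t \<Longrightarrow> 0 \<le> \<Psi> \<delta> t"
  using ip_increment[of \<delta> "t/2" "t/2"] ip_nonneg[of "\<lambda>x. F (t/2 + \<delta>) x - F (t/2) x"] by simp

lemma \<Psi>_antimono: "0 \<le> \<delta> \<Longrightarrow> 0 \<le> x \<Longrightarrow> x \<le> y \<Longrightarrow> \<Psi> \<delta> y \<le> \<Psi> \<delta> x"
proof (rule log_convex_antimono[where f = "\<Psi> \<delta>" and A = "A * 2 * (1 + 2 * \<delta>)\<^sup>2"])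
  fix x y :: real assume xy: "0 \<le> x" "0 \<le> y" and d: "0 \<le> \<delta>"
  let ?G = "\<lambda>t x. F (t + \<delta>) x - F t x"
  have "(ip (?G (x/2)) (?G (y/2)))\<^sup>2 \<le> ip (?G (x/2)) (?G (x/2)) * ip (?G (y/2)) (?G (y/2))"
    by (rule ip_cauchy_schwarz) (use xy d F_sq in \<open>auto intro!: square_integrable_diff\<close>)
  then show "(\<Psi> \<delta> ((x + y) / 2))\<^sup>2 \<le> \<Psi> \<delta> x * \<Psi> \<delta> y"
    using xy d ip_increment[of \<delta> "x/2" "y/2"] ip_increment[of \<delta> "x/2" "x/2"] ip_increment[of \<delta> "y/2" "y/2"]
    by (simp add: add_divide_distrib)
next
  fix x :: real assume x: "0 \<le> x" and d: "0 \<le> \<delta>"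
  have "\<Psi> \<delta> x \<le> \<Phi> (x + 2 * \<delta>) + \<Phi> x"
    using \<Phi>_nonneg[of "x + \<delta>"] x d by (simp add: \<Psi>_def)
  also have "\<dots> \<le> 2 * \<Phi> x" using \<Phi>_antimono[of x "x + 2 * \<delta>"] x d by simp
  also have "\<dots> \<le> 2 * (A * (1 + x)\<^sup>2)" using \<Phi>_growth[OF x] by simp
  also have "\<dots> = (A * 2 * (1 + x)\<^sup>2) * 1" by simp
  also have "\<dots> \<le> (A * 2 * (1 + x)\<^sup>2) * (1 + 2 * \<delta>)\<^sup>2"
    by (rule mult_left_mono) (use A_nonneg d in \<open>auto intro: one_le_power\<close>)
  finally show "\<Psi> \<delta> x \<le> A * 2 * (1 + 2 * \<delta>)\<^sup>2 * (1 + x)\<^sup>2" by (simp add: mult_ac)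
qed (use \<Psi>_nonneg in auto)

text \<open>Discrete version of bounding a second derivative by the function at an earlier time. For
  a nonnegative nonincreasing sequence, m times a term is at most the sum of the m terms before it.
  This is used for \<Psi>, whose sums telescope to first differences of \<Phi>, and again for those
  first differences, whose sums telescope to \<Phi>.\<close>

lemma \<Psi>_bound:
  assumes d: "0 \<le> \<delta>" and \<tau>: "0 \<le> \<tau>"
  shows "(real n)\<^sup>2 * \<Psi> \<delta> (\<tau> + 2 * real n * \<delta>) \<le> \<Phi> \<tau>"
proof -
  define \<Delta> where "\<Delta> x = \<Phi> x - \<Phi> (x + \<delta>)" for x
  have \<Delta>0: "0 \<le> \<Delta> x" if "0 \<le> x" for x using \<Phi>_antimono[of x "x + \<delta>"] that d by (simp add: \<Delta>_def)
  have \<Psi>\<Delta>: "\<Psi> \<delta> x = \<Delta> x - \<Delta> (x + \<delta>)" for x by (simp add: \<Psi>_def \<Delta>_def algebra_simps)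
  have tel1: "(\<Sum>j<m. \<Psi> \<delta> (x + real j * \<delta>)) = \<Delta> x - \<Delta> (x + real m * \<delta>)" for m x
    by (induction m) (auto simp: \<Psi>\<Delta> algebra_simps)
  have tel2: "(\<Sum>j<m. \<Delta> (x + real j * \<delta>)) = \<Phi> x - \<Phi> (x + real m * \<delta>)" for m x
    by (induction m) (auto simp: \<Delta>_def algebra_simps)
  have b1: "real m * \<Psi> \<delta> (x + real m * \<delta>) \<le> \<Delta> x" if x: "0 \<le> x" for x m
  proof -
    have "real m * \<Psi> \<delta> (x + real m * \<delta>) = (\<Sum>j<m. \<Psi> \<delta> (x + real m * \<delta>))" by simp
    also have "\<dots> \<le> (\<Sum>j<m. \<Psi> \<delta> (x + real j * \<delta>))"
      by (intro sum_mono \<Psi>_antimono) (use x d in \<open>auto intro!: mult_right_mono\<close>)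
    also have "\<dots> \<le> \<Delta> x" using \<Delta>0[of "x + real m * \<delta>"] x d by (simp add: tel1)
    finally show ?thesis .
  qed
  have \<Delta>_anti: "\<Delta> y \<le> \<Delta> x" if "0 \<le> x" "y = x + real j * \<delta>" for x y j
  proof -
    have "0 \<le> (\<Sum>i<j. \<Psi> \<delta> (x + real i * \<delta>))" by (intro sum_nonneg \<Psi>_nonneg) (use that d in auto)
    then show ?thesis using that by (simp add: tel1)
  qed
  have b2: "real m * \<Delta> (x + real m * \<delta>) \<le> \<Phi> x" if x: "0 \<le> x" for x m
  proof -
    have "real m * \<Delta> (x + real m * \<delta>) = (\<Sum>j<m. \<Delta> (x + real m * \<delta>))" by simp
    also have "\<dots> \<le> (\<Sum>j<m. \<Delta> (x + real j * \<delta>))"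
    proof (rule sum_mono)
      fix j assume j: "j \<in> {..<m}"
      show "\<Delta> (x + real m * \<delta>) \<le> \<Delta> (x + real j * \<delta>)"
        by (rule \<Delta>_anti[where j = "m - j"]) (use j x d in \<open>auto simp: of_nat_diff algebra_simps\<close>)
    qed
    also have "\<dots> \<le> \<Phi> x" using \<Phi>_nonneg[of "x + real m * \<delta>"] x d by (simp add: tel2)
    finally show ?thesis .
  qed
  have "(real n)\<^sup>2 * \<Psi> \<delta> (\<tau> + 2 * real n * \<delta>) = real n * (real n * \<Psi> \<delta> ((\<tau> + real n * \<delta>) + real n * \<delta>))"
    by (simp add: power2_eq_square algebra_simps)
  also have "\<dots> \<le> real n * \<Delta> (\<tau> + real n * \<delta>)"
    by (intro mult_left_mono b1) (use \<tau> d in auto)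
  also have "\<dots> \<le> \<Phi> \<tau>" by (rule b2[OF \<tau>])
  finally show ?thesis .
qed

lemma \<Phi>\<^sub>1_abs_le: "0 \<le> t \<Longrightarrow> \<bar>\<Phi>\<^sub>1 t\<bar> \<le> \<Phi> t / lam"
  using T_bound[OF F_sq[of "t/2"]] ip_T_shift[of "t/2" "t/2"] ip_shift[of "t/2" "t/2"]
  by (simp add: \<Phi>\<^sub>1_def)

lemma \<Phi>\<^sub>1_diff:
  assumes "0 \<le> s" "s \<le> t"
  shows "(t - s) * \<Phi> t \<le> \<Phi>\<^sub>1 s - \<Phi>\<^sub>1 t"
proof (cases "s = t")
  case False
  then have lt: "s < t" using assms by simp
  have "\<exists>x. s < x \<and> x < t \<and> \<Phi>\<^sub>1 t - \<Phi>\<^sub>1 s = (t - s) * (- \<Phi> x)"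
  proof -
    have "\<exists>x\<in>{s<..<t}. \<Phi>\<^sub>1 t - \<Phi>\<^sub>1 s = (\<lambda>y. y * (- \<Phi> x)) (t - s)"
    proof (rule mvt_simple[OF lt])
      fix x assume "s \<le> x" "x \<le> t"
      then have "(\<Phi>\<^sub>1 has_real_derivative - \<Phi> x) (at x within {s..t})"
        by (intro DERIV_subset[OF \<Phi>\<^sub>1_deriv]) (use assms in auto)
      then show "(\<Phi>\<^sub>1 has_derivative (\<lambda>y. y * (- \<Phi> x))) (at x within {s..t})"
        by (simp only: has_field_derivative_def mult_commute_abs)
    qed
    then show ?thesis by auto
  qed
  then obtain x where x: "s < x" "x < t" "\<Phi>\<^sub>1 t - \<Phi>\<^sub>1 s = (t - s) * (- \<Phi> x)" by blast
  have "(t - s) * \<Phi> t \<le> (t - s) * \<Phi> x"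
    using \<Phi>_antimono[of x t] x assms by (intro mult_left_mono) auto
  then show ?thesis using x(3) by simp
qed simp

text \<open>A kernel with nonnegative values need not define a positive operator, so the sign comes
  from the dynamics. Once negative, \<open>\<Phi>\<^sub>1\<close> stays below -c; the Schur bound
  then keeps \<open>\<Phi>\<close> above lam * c, so \<open>\<Phi>\<^sub>1\<close> falls at least
  linearly, although its modulus is bounded by \<open>\<Phi> t / lam\<close>.\<close>

lemma \<Phi>\<^sub>1_nonneg: assumes t: "0 \<le> t" shows "0 \<le> \<Phi>\<^sub>1 t"
proof (rule ccontr)
  assume "\<not> 0 \<le> \<Phi>\<^sub>1 t"
  then have neg: "\<Phi>\<^sub>1 t < 0" by simp
  define c where "c = - \<Phi>\<^sub>1 t"
  have c: "c > 0" using neg by (simp add: c_def)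
  have dec: "\<Phi>\<^sub>1 s \<le> - c" if "t \<le> s" for s
  proof -
    have "0 \<le> (s - t) * \<Phi> s" using \<Phi>_nonneg[of s] t that by (intro mult_nonneg_nonneg) auto
    then show ?thesis using \<Phi>\<^sub>1_diff[OF t that] unfolding c_def by linarith
  qed
  have ph: "lam * c \<le> \<Phi> s" if "t \<le> s" for s
  proof -
    have "c \<le> \<Phi> s / lam" using dec[OF that] \<Phi>\<^sub>1_abs_le[of s] t that by linarith
    then show ?thesis using lam_pos by (simp add: field_simps)
  qed
  \<comment> \<open>After this waiting time the linear drop exceeds the admissible
    \<open>\<Phi> t / lam\<close> by one.\<close>
  define s where "s = t + (\<Phi> t / lam + 1) / (lam * c)"
  have ts: "t \<le> s" using \<Phi>_nonneg[OF t] lam_pos c by (simp add: s_def)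
  have "(s - t) * (lam * c) \<le> (s - t) * \<Phi> s" using ph[OF ts] ts by (intro mult_left_mono) auto
  also have "\<dots> \<le> \<Phi>\<^sub>1 t - \<Phi>\<^sub>1 s" by (rule \<Phi>\<^sub>1_diff[OF t ts])
  also have "\<dots> \<le> \<Phi> s / lam" using \<Phi>\<^sub>1_abs_le[of s] neg t ts by linarith
  also have "\<dots> \<le> \<Phi> t / lam" using \<Phi>_antimono[OF t ts] lam_pos by (simp add: divide_right_mono)
  finally have "(s - t) * (lam * c) \<le> \<Phi> t / lam" .
  moreover have "(s - t) * (lam * c) = \<Phi> t / lam + 1" using lam_pos c by (simp add: s_def)
  ultimately show False by simp
qed

text \<open>Gronwall: the derivative is minus \<open>\<Phi>\<close>, and the Schur bound gives lam *
  \<open>\<Phi>\<^sub>1\<close> \<le> \<open>\<Phi>\<close>. This is the only place where the rate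
  is produced.\<close>

lemma \<Phi>\<^sub>1_decay:
  assumes t: "0 \<le> t" shows "\<Phi>\<^sub>1 t \<le> \<Phi>\<^sub>1 0 * exp (- lam * t)"
proof -
  define q where "q s = exp (lam * s) * \<Phi>\<^sub>1 s" for s
  have "q t \<le> q 0"
  proof (rule DERIV_nonpos_imp_decreasing_open[OF t])
    fix x assume x: "0 < x" "x < t"
    have at: "(\<Phi>\<^sub>1 has_real_derivative - \<Phi> x) (at x)"
    proof -
      have "(\<Phi>\<^sub>1 has_real_derivative - \<Phi> x) (at x within {0<..})"
        by (rule DERIV_subset[OF \<Phi>\<^sub>1_deriv]) (use x in auto)
      then show ?thesis using x by (simp add: at_within_open[of x "{0<..}"])
    qed
    have "(q has_real_derivative exp (lam * x) * (lam * \<Phi>\<^sub>1 x - \<Phi> x)) (at x)"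
      unfolding q_def by (rule derivative_eq_intros at refl | simp add: algebra_simps)+
    moreover have "lam * \<Phi>\<^sub>1 x - \<Phi> x \<le> 0"
      using \<Phi>\<^sub>1_abs_le[of x] x lam_pos by (simp add: field_simps abs_le_iff)
    ultimately show "\<exists>y. (q has_real_derivative y) (at x) \<and> y \<le> 0"
      by (meson exp_ge_zero mult_nonneg_nonpos)
  next
    have "continuous_on {0..t} \<Phi>\<^sub>1"
      by (rule DERIV_continuous_on[where D = "\<lambda>x. - \<Phi> x"]) (rule DERIV_subset[OF \<Phi>\<^sub>1_deriv], auto)
    then show "continuous_on {0..t} q" unfolding q_def by (intro continuous_intros) auto
  qed
  then show ?thesis by (simp add: q_def exp_minus field_simps)
qed

text \<open>The squared norm of the increment is \<Psi> at 2t. One unit of time pays for the two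
  telescoping sums, since 2 * n * \<delta> = 1; a second unit pays for bounding \<Phi> by its
  integral, that is by a difference of \<open>\<Phi>\<^sub>1\<close>. Decay is then available at 2t
  - 2, hence the hypothesis 1 \<le> t and the factor exp (-2 lam (t - 1)).\<close>

theorem increment_decay:
  assumes t: "1 \<le> t" and n: "0 < n"
  defines "\<delta> \<equiv> 1 / (2 * real n)"
  shows "ip (\<lambda>x. F (t + \<delta>) x - F t x) (\<lambda>x. F (t + \<delta>) x - F t x)
     \<le> 4 * \<delta>\<^sup>2 * (ip (F 0) (F 0) / lam) * exp (- 2 * lam * (t - 1))"
proof -
  have d: "\<delta> > 0" and nd: "2 * real n * \<delta> = 1" using n by (auto simp: \<delta>_def)
  have "ip (\<lambda>x. F (t + \<delta>) x - F t x) (\<lambda>x. F (t + \<delta>) x - F t x) = \<Psi> \<delta> (2 * t)"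
    using ip_increment[of \<delta> t t] t d by simp
  also have "\<dots> = 4 * \<delta>\<^sup>2 * ((real n)\<^sup>2 * \<Psi> \<delta> ((2 * t - 1) + 2 * real n * \<delta>))"
  proof -
    have "4 * \<delta>\<^sup>2 * (real n)\<^sup>2 = (2 * real n * \<delta>)\<^sup>2" by (simp add: power_mult_distrib)
    then have "4 * \<delta>\<^sup>2 * (real n)\<^sup>2 = 1" by (simp only: nd power_one)
    then show ?thesis by (simp add: nd mult.assoc[symmetric])
  qed
  also have "\<dots> \<le> 4 * \<delta>\<^sup>2 * \<Phi> (2 * t - 1)"
    by (intro mult_left_mono \<Psi>_bound) (use t d in auto)
  also have "\<dots> \<le> 4 * \<delta>\<^sup>2 * (\<Phi>\<^sub>1 0 * exp (- lam * (2 * t - 2)))"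
  proof (intro mult_left_mono)
    have "\<Phi> (2 * t - 1) \<le> \<Phi>\<^sub>1 (2 * t - 2)"
      using \<Phi>\<^sub>1_diff[of "2 * t - 2" "2 * t - 1"] \<Phi>\<^sub>1_nonneg[of "2 * t - 1"] t by simp
    also have "\<dots> \<le> \<Phi>\<^sub>1 0 * exp (- lam * (2 * t - 2))" by (rule \<Phi>\<^sub>1_decay) (use t in auto)
    finally show "\<Phi> (2 * t - 1) \<le> \<Phi>\<^sub>1 0 * exp (- lam * (2 * t - 2))" .
  qed simp
  also have "\<dots> \<le> 4 * \<delta>\<^sup>2 * (ip (F 0) (F 0) / lam * exp (- lam * (2 * t - 2)))"
    using \<Phi>\<^sub>1_abs_le[of 0] by (intro mult_left_mono mult_right_mono) (auto simp: \<Phi>_def)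
  finally show ?thesis by (simp add: algebra_simps)
qed

end

section \<open>Pathwise analysis of the reflected equation\<close>


text \<open>The second derivative is only continuous, so its oscillation \<kappa> on the segment
  takes the place of a third derivative. Derivatives within \<open>{l..}\<close> are one-sided at
  the reflecting barrier.\<close>

lemma taylor2_within:
  fixes g g' g'' :: "real \<Rightarrow> real"
  assumes g: "\<And>x. l \<le> x \<Longrightarrow> (g has_real_derivative g' x) (at x within {l..})"
    and g': "\<And>x. l \<le> x \<Longrightarrow> (g' has_real_derivative g'' x) (at x within {l..})"
    and y: "l \<le> y" "l \<le> z"
    and \<kappa>: "\<And>u. u \<in> closed_segment y z \<Longrightarrow> \<bar>g'' u - g'' y\<bar> \<le> \<kappa>"
  shows "\<bar>g z - g y - g' y * (z - y) - g'' y * (z - y)\<^sup>2 / 2\<bar> \<le> \<kappa> * (z - y)\<^sup>2"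
proof -
  let ?S = "closed_segment y z"
  have S: "?S \<subseteq> {l..}" using y by (auto simp: closed_segment_eq_real_ivl split: if_splits)
  have k0: "0 \<le> \<kappa>" using \<kappa>[of y] by simp
  have d1: "((\<lambda>u. g' u - g' y - g'' y * (u - y)) has_real_derivative (g'' u - g'' y)) (at u within ?S)" if "u \<in> ?S" for u
    by (rule derivative_eq_intros DERIV_subset[OF g' S] refl | use that S in force)+
  have b1: "\<bar>g' u - g' y - g'' y * (u - y)\<bar> \<le> \<kappa> * \<bar>z - y\<bar>" if u: "u \<in> ?S" for u
  proof -
    have "norm ((g' u - g' y - g'' y * (u - y)) - (g' y - g' y - g'' y * (y - y))) \<le> \<kappa> * norm (u - y)"
      by (rule field_differentiable_bound[OF convex_closed_segment d1]) (use \<kappa> u in auto)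
    also have "\<dots> \<le> \<kappa> * \<bar>z - y\<bar>"
      using u k0 by (intro mult_left_mono) (auto simp: closed_segment_eq_real_ivl split: if_splits)
    finally show ?thesis by simp
  qed
  have d2: "((\<lambda>u. g u - g' y * (u - y) - g'' y * (u - y)\<^sup>2 / 2) has_real_derivative (g' u - g' y - g'' y * (u - y))) (at u within ?S)" if "u \<in> ?S" for u
    by (rule derivative_eq_intros DERIV_subset[OF g S] refl | use that S in force)+
  have "norm ((g z - g' y * (z - y) - g'' y * (z - y)\<^sup>2 / 2) - (g y - g' y * (y - y) - g'' y * (y - y)\<^sup>2 / 2)) \<le> (\<kappa> * \<bar>z - y\<bar>) * norm (z - y)"
    by (rule field_differentiable_bound[OF convex_closed_segment d2]) (use b1 in auto)
  then show ?thesis by (simp add: power2_eq_square mult.assoc algebra_simps)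
qed

section \<open>The deterministic Skorokhod problem and its projected Euler scheme\<close>

fun euler :: "(real \<Rightarrow> real) \<Rightarrow> real \<Rightarrow> real \<Rightarrow> real \<Rightarrow> (nat \<Rightarrow> real) \<Rightarrow> nat \<Rightarrow> real" where
  "euler b l h y0 p 0 = y0"
| "euler b l h y0 p (Suc j) = max l (euler b l h y0 p j + p j + h * b (euler b l h y0 p j))"

text \<open>A Skorokhod problem for one path: \<open>K\<close> is the pushing term, and
  \<open>K_const\<close> states without any measure that it moves only while the path is at the
  barrier.\<close>

locale reflected_path =
  fixes l y0 B :: real and b w y K :: "real \<Rightarrow> real"
  assumes y_ge: "\<And>t. 0 \<le> t \<Longrightarrow> l \<le> y t"
    and y_cont: "continuous_on {0..} y"
    and w_cont: "continuous_on {0..} w" and w0: "w 0 = 0"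
    and K_mono: "\<And>s t. 0 \<le> s \<Longrightarrow> s \<le> t \<Longrightarrow> K s \<le> K t" and K0: "K 0 = 0"
    and K_const: "\<And>s t. 0 \<le> s \<Longrightarrow> s \<le> t \<Longrightarrow> (\<And>u. s < u \<Longrightarrow> u \<le> t \<Longrightarrow> y u \<noteq> l) \<Longrightarrow> K s = K t"
    and y_eq: "\<And>t. 0 \<le> t \<Longrightarrow> y t = y0 + w t + integral {0..t} (\<lambda>s. b (y s)) + K t"
    and B: "0 \<le> B" and b_lip: "\<And>u v. l \<le> u \<Longrightarrow> l \<le> v \<Longrightarrow> \<bar>b u - b v\<bar> \<le> B * \<bar>u - v\<bar>"
begin

definition x :: "real \<Rightarrow> real" where "x t = y0 + w t + integral {0..t} (\<lambda>s. b (y s))"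

lemma b_cont: "continuous_on {l..} b"
proof (rule continuous_onI)
  fix u e :: real assume u: "u \<in> {l..}" and e: "e > 0"
  show "\<exists>d>0. \<forall>v\<in>{l..}. dist v u < d \<longrightarrow> dist (b v) (b u) \<le> e"
  proof (intro exI[of _ "e / (B + 1)"] conjI ballI impI)
    show "0 < e / (B + 1)" using e B by simp
    fix v assume v: "v \<in> {l..}" "dist v u < e / (B + 1)"
    have "\<bar>b v - b u\<bar> \<le> B * \<bar>v - u\<bar>" using b_lip u v by auto
    also have "\<dots> \<le> (B + 1) * \<bar>v - u\<bar>" by (intro mult_right_mono) auto
    also have "\<dots> \<le> e" using v B by (simp add: dist_real_def field_simps)
    finally show "dist (b v) (b u) \<le> e" by (simp add: dist_real_def)
  qed
qed

lemma by_cont: "continuous_on {0..} (\<lambda>s. b (y s))"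
  by (rule continuous_on_compose2[OF b_cont y_cont]) (use y_ge in auto)

lemma by_int: "0 \<le> s \<Longrightarrow> (\<lambda>s. b (y s)) integrable_on {s..t}"
  by (rule integrable_continuous_real[OF continuous_on_subset[OF by_cont]]) auto

lemma by_combine: "0 \<le> s \<Longrightarrow> s \<le> t \<Longrightarrow>
  integral {0..t} (\<lambda>s. b (y s)) = integral {0..s} (\<lambda>s. b (y s)) + integral {s..t} (\<lambda>s. b (y s))"
  by (rule Henstock_Kurzweil_Integration.integral_combine[symmetric]) (auto intro: by_int)

lemma x_cont: "continuous_on {0..t} x"
  unfolding x_def
  by (intro continuous_intros continuous_on_subset[OF w_cont] indefinite_integral_continuous_1 by_int) auto

lemma y_x: "0 \<le> t \<Longrightarrow> y t = x t + K t" by (simp add: x_def y_eq)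

text \<open>Together with \<open>rep_upper\<close> this is Skorokhod's formula: \<open>y t\<close>
  is the maximum of \<open>x t\<close> and of all \<open>x t - x u + l\<close> with u \<le> t. It is
  explicit in the free path \<open>x\<close>, so errors in \<open>x\<close> transfer to
  \<open>y\<close> although the pushing term is unknown.\<close>

lemma rep_lower: assumes "0 \<le> u" "u \<le> t" shows "x t - x u + l \<le> y t" "x t \<le> y t"
  using y_x[of t] y_x[of u] K_mono[of u t] K_mono[of 0 t] K0 y_ge[of u] assms by auto

lemma rep_upper: assumes t: "0 \<le> t" shows "y t = x t \<or> (\<exists>u\<in>{0..t}. y t = x t - x u + l)"
proof (cases "\<exists>u\<in>{0..t}. y u = l")
  case False
  then have "K 0 = K t" by (intro K_const) (use t in auto)
  then show ?thesis using y_x[OF t] K0 by simp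
next
  case True
  let ?S = "{u \<in> {0..t}. y u = l}"
  have "closed ?S"
    by (rule continuous_closed_preimage_constant[OF continuous_on_subset[OF y_cont]]) auto
  moreover have "bounded ?S" by (rule bounded_subset[of "{0..t}"]) auto
  ultimately have "compact ?S" by (simp only: compact_eq_bounded_closed)
  \<comment> \<open>The last visit to the barrier; the pushing term is frozen afterwards.\<close>
  then obtain u where u: "u \<in> ?S" "\<And>s. s \<in> ?S \<Longrightarrow> s \<le> u"
    using compact_attains_sup[of ?S] True by blast
  have ul: "u \<in> {0..t}" "y u = l" using u(1) by auto
  have "K u = K t"
  proof (rule K_const)
    fix v assume v: "u < v" "v \<le> t"
    show "y v \<noteq> l" using u(2)[of v] v ul by force
  qed (use ul in auto)
  then have "y t = x t - x u + l" using y_x[OF t] y_x[of u] u by auto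
  then show ?thesis using u by auto
qed

context
  fixes h :: real and p :: "nat \<Rightarrow> real"
  assumes h: "0 < h" and p: "\<And>j. p j = w (real (Suc j) * h) - w (real j * h)"
    and y0l: "l \<le> y0"
begin

abbreviation "Y \<equiv> euler b l h y0 p"

definition X :: "nat \<Rightarrow> real" where "X k = y0 + w (real k * h) + h * (\<Sum>i<k. b (Y i))"

lemma euler_ge: "l \<le> Y k" by (cases k) (auto simp: y0l)

lemma X_Suc: "X (Suc k) - X k = p k + h * b (Y k)" by (simp add: X_def p algebra_simps)

lemma X_0: "X 0 = y0" by (simp add: X_def w0)

text \<open>The discrete Skorokhod formula, of the same shape as the one for \<open>y\<close>.
  Comparing two maxima avoids any estimate of the boundary terms themselves.\<close>

lemma euler_rep: "X k \<le> Y k \<and> (\<forall>j\<le>k. X k - X j + l \<le> Y k) \<and> (Y k = X k \<or> (\<exists>j\<le>k. Y k = X k - X j + l))"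
proof (induction k)
  case 0 then show ?case using y0l by (simp add: X_0)
next
  case (Suc k)
  have Y: "Y (Suc k) = max l (Y k + (X (Suc k) - X k))" by (simp add: X_Suc)
  have 1: "X (Suc k) \<le> Y (Suc k)" using Suc Y by auto
  have 2: "X (Suc k) - X j + l \<le> Y (Suc k)" if "j \<le> Suc k" for j
  proof (cases "j = Suc k")
    case False
    then have "X k - X j + l \<le> Y k" using Suc that by auto
    then show ?thesis unfolding Y by auto
  qed (simp add: Y)
  have 3: "Y (Suc k) = X (Suc k) \<or> (\<exists>j\<le>Suc k. Y (Suc k) = X (Suc k) - X j + l)"
  proof (cases "l \<ge> Y k + (X (Suc k) - X k)")
    case True
    then have "Y (Suc k) = X (Suc k) - X (Suc k) + l" unfolding Y by simp
    then show ?thesis by blast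
  next
    case False
    then have e: "Y (Suc k) = Y k + (X (Suc k) - X k)" unfolding Y by simp
    from Suc consider "Y k = X k" | j where "j \<le> k" "Y k = X k - X j + l" by blast
    then show ?thesis
    proof cases
      case 1 then show ?thesis using e by simp
    next
      case 2
      then have "Y (Suc k) = X (Suc k) - X j + l" "j \<le> Suc k" using e by auto
      then show ?thesis by blast
    qed
  qed
  show ?case using 1 2 3 by blast
qed

text \<open>Scheme and solution are the same maximum functional of their free paths, and this
  functional is Lipschitz with constant 2 in the supremum norm. The free paths differ only through
  the drift, whose error is at most B times the past error plus the oscillation \<kappa>; a discrete
  Gronwall argument closes the estimate.\<close>

lemma euler_error:
  assumes T: "0 \<le> T" and \<kappa>: "0 \<le> \<kappa>"
    and osc: "\<And>s t. s \<in> {0..T} \<Longrightarrow> t \<in> {0..T} \<Longrightarrow> \<bar>s - t\<bar> \<le> h \<Longrightarrow> \<bar>x s - x t\<bar> \<le> \<kappa> \<and> \<bar>y s - y t\<bar> \<le> \<kappa>"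
    and k: "real k * h \<le> T"
  shows "\<bar>Y k - y (real k * h)\<bar> \<le> (2 * T * B + 1) * \<kappa> * exp (2 * B * T)"
proof -
  define e where "e i = \<bar>Y i - y (real i * h)\<bar>" for i
  define E where "E i = h * B * (\<Sum>j<i. e j + \<kappa>)" for i
  have e0: "0 \<le> e i" for i by (simp add: e_def)
  have Emono: "E i \<le> E j" if "i \<le> j" for i j
    unfolding E_def using that h B e0 \<kappa>
    by (intro mult_left_mono sum_mono2) auto
  have Xx: "real i * h \<le> T \<Longrightarrow> \<bar>X i - x (real i * h)\<bar> \<le> E i" for i
  proof (induction i)
    case 0 then show ?case by (simp add: X_0 x_def w0 E_def)
  next
    case (Suc i)
    let ?s = "real i * h" and ?t = "real (Suc i) * h"
    have st: "0 \<le> ?s" "?s \<le> ?t" "?t - ?s = h" "?s \<le> T" using h Suc.prems by (auto simp: algebra_simps)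
    have "X (Suc i) - X i - (x ?t - x ?s) = h * b (Y i) - integral {?s..?t} (\<lambda>s. b (y s))"
      using by_combine[OF st(1,2)] unfolding X_Suc by (simp add: x_def p del: of_nat_Suc)
    also have "\<dots> = integral {?s..?t} (\<lambda>s. b (Y i) - b (y s))"
      by (subst Henstock_Kurzweil_Integration.integral_diff) (use by_int[OF st(1)] st(2,3) in auto)
    also have "\<bar>\<dots>\<bar> \<le> (B * (e i + \<kappa>)) * (?t - ?s)"
    proof -
      have "norm (integral {?s..?t} (\<lambda>s. b (Y i) - b (y s))) \<le> (B * (e i + \<kappa>)) * (?t - ?s)"
      proof (rule integral_bound[OF st(2)])
        show "continuous_on {?s..?t} (\<lambda>s. b (Y i) - b (y s))"
          by (intro continuous_intros continuous_on_subset[OF by_cont]) (use st in auto)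
        fix s assume s: "s \<in> {?s..?t}"
        have "\<bar>b (Y i) - b (y s)\<bar> \<le> B * \<bar>Y i - y s\<bar>" by (rule b_lip[OF euler_ge y_ge]) (meson s st(1) atLeastAtMost_iff order_trans)
        also have "\<bar>Y i - y s\<bar> \<le> e i + \<kappa>"
        proof -
          have "0 \<le> s" using s st(1) by (meson atLeastAtMost_iff order_trans)
          moreover have "s \<le> T" "\<bar>?s - s\<bar> \<le> h" using s st Suc.prems by auto
          ultimately show ?thesis using osc[of ?s s] st by (auto simp: e_def)
        qed
        finally show "norm (b (Y i) - b (y s)) \<le> B * (e i + \<kappa>)" using B by (simp add: mult_left_mono)
      qed
      then show ?thesis by simp
    qed
    finally have "\<bar>X (Suc i) - X i - (x ?t - x ?s)\<bar> \<le> B * (e i + \<kappa>) * h" using st by simp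
    moreover have "\<bar>X i - x ?s\<bar> \<le> E i" using Suc.IH st by simp
    moreover have "E (Suc i) = E i + B * (e i + \<kappa>) * h" by (simp add: E_def algebra_simps)
    ultimately show ?case by linarith
  qed
  \<comment> \<open>The factor 2 comes from the two values of the free path in x t - x u + l. The
    extra \<kappa> moves a maximising time \<open>u\<close> to the grid point on its left.\<close>
  have eE: "e i \<le> 2 * E i + \<kappa>" if i: "real i * h \<le> T" for i
  proof -
    let ?t = "real i * h"
    have t: "0 \<le> ?t" using h by simp
    have jle: "real j * h \<le> ?t" if "j \<le> i" for j using that h by simp
    have bnd: "\<bar>X j - x (real j * h)\<bar> \<le> E i" if "j \<le> i" for j
      using Xx[of j] jle[OF that] i Emono[OF that] by linarith
    have E0: "0 \<le> E i" using bnd[of i] by simp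
    have up: "Y i - y ?t \<le> 2 * E i + \<kappa>"
    proof -
      from euler_rep[of i] consider "Y i = X i" | j where "j \<le> i" "Y i = X i - X j + l" by blast
      then show ?thesis
      proof cases
        case 1 then show ?thesis using bnd[of i] rep_lower(2)[OF order.refl t] E0 \<kappa> by linarith
      next
        case 2 then show ?thesis
          using bnd[of i] bnd[of j] rep_lower(1)[of "real j * h" ?t] jle[of j] h \<kappa> by auto
      qed
    qed
    have lo: "y ?t - Y i \<le> 2 * E i + \<kappa>"
    proof -
      from rep_upper[OF t] consider "y ?t = x ?t" | u where "u \<in> {0..?t}" "y ?t = x ?t - x u + l" by blast
      then show ?thesis
      proof cases
        case 1 then show ?thesis using bnd[of i] euler_rep[of i] E0 \<kappa> by auto
      next
        case 2
        define j where "j = nat \<lfloor>u / h\<rfloor>"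
        have "0 \<le> u / h" using 2 h by simp
        then have j: "real j \<le> u / h" "u / h < real j + 1" unfolding j_def by linarith+
        have ju: "real j * h \<le> u" "u - real j * h \<le> h" using j h by (auto simp: field_simps)
        have "real j * h \<le> real i * h" using ju 2 by auto
        then have ji: "j \<le> i" using h by simp
        have "\<bar>x (real j * h) - x u\<bar> \<le> \<kappa>"
          using osc[of "real j * h" u] ju 2 i h by auto
        then show ?thesis using bnd[of i] bnd[OF ji] euler_rep[of i] ji 2(2) by fastforce
      qed
    qed
    show ?thesis using up lo by (auto simp: e_def)
  qed
  \<comment> \<open>At most T / h steps contribute 2 * h * B * \<kappa> each, and the last
    comparison contributes one more \<kappa>.\<close>
  define c where "c = (2 * T * B + 1) * \<kappa>"
  have c0: "0 \<le> c" using T B \<kappa> by (simp add: c_def)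
  have rec: "e i \<le> 2 * h * B * (\<Sum>j<i. e j) + c" if i: "real i * h \<le> T" for i
  proof -
    have "e i \<le> 2 * h * B * (\<Sum>j<i. e j) + 2 * (real i * h) * B * \<kappa> + \<kappa>"
      using eE[OF i] by (simp add: E_def sum.distrib algebra_simps)
    moreover have "(real i * h) * (B * \<kappa>) \<le> T * (B * \<kappa>)" using i B \<kappa> by (intro mult_right_mono) auto
    ultimately show ?thesis by (simp add: c_def algebra_simps)
  qed
  have gr: "real i * h \<le> T \<Longrightarrow> 2 * h * B * (\<Sum>j<i. e j) + c \<le> c * (1 + 2 * h * B) ^ i" for i
  proof (induction i)
    case (Suc i)
    have i: "real i * h \<le> T" using Suc.prems h by (simp add: algebra_simps)
    let ?s = "2 * h * B * (\<Sum>j<i. e j) + c"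
    have "2 * h * B * (\<Sum>j<Suc i. e j) + c = ?s + 2 * h * B * e i" by (simp add: algebra_simps)
    also have "\<dots> \<le> ?s + 2 * h * B * ?s"
      using rec[OF i] h B by (intro add_left_mono mult_left_mono) auto
    also have "\<dots> = ?s * (1 + 2 * h * B)" by (simp add: algebra_simps)
    also have "\<dots> \<le> c * (1 + 2 * h * B) ^ i * (1 + 2 * h * B)"
      using Suc.IH[OF i] h B by (intro mult_right_mono) auto
    finally show ?case by (simp add: mult_ac)
  qed simp
  have "e k \<le> c * (1 + 2 * h * B) ^ k" using rec[OF k] gr[OF k] by linarith
  also have "\<dots> \<le> c * exp (2 * h * B) ^ k"
    using c0 h B by (intro mult_left_mono power_mono) (auto intro: exp_ge_add_one_self[of "2 * h * B", simplified add.commute])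
  also have "\<dots> = c * exp (2 * B * (real k * h))"
    by (simp add: exp_of_nat_mult[symmetric] mult_ac)
  also have "\<dots> \<le> c * exp (2 * B * T)"
    using c0 B k by (intro mult_left_mono) (auto intro!: mult_left_mono)
  finally show ?thesis by (simp add: e_def c_def)
qed

end

lemma common_modulus:
  fixes f g :: "real \<Rightarrow> real"
  assumes "continuous_on {0..T} f" "continuous_on {0..T} g" "0 < \<kappa>"
  shows "\<exists>\<delta>>0. \<forall>s\<in>{0..T}. \<forall>t\<in>{0..T}. \<bar>s - t\<bar> < \<delta> \<longrightarrow> \<bar>f s - f t\<bar> \<le> \<kappa> \<and> \<bar>g s - g t\<bar> \<le> \<kappa>"
proof -
  have "uniformly_continuous_on {0..T} f" "uniformly_continuous_on {0..T} g"
    using assms compact_uniformly_continuous by auto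
  then obtain d1 d2 where d: "d1 > 0" "\<And>s t. s \<in> {0..T} \<Longrightarrow> t \<in> {0..T} \<Longrightarrow> dist s t < d1 \<Longrightarrow> dist (f s) (f t) < \<kappa>"
      "d2 > 0" "\<And>s t. s \<in> {0..T} \<Longrightarrow> t \<in> {0..T} \<Longrightarrow> dist s t < d2 \<Longrightarrow> dist (g s) (g t) < \<kappa>"
    using assms(3) unfolding uniformly_continuous_on_def by (metis dist_commute)
  show ?thesis
    by (rule exI[of _ "min d1 d2"]) (use d in \<open>auto simp: dist_real_def less_imp_le\<close>)
qed

text \<open>Uniform continuity of the free path and of \<open>y\<close> makes the \<kappa> of
  \<open>euler_error\<close> arbitrarily small. The condition on \<open>k m\<close> puts
  \<open>T\<close> itself on every grid.\<close>

theorem euler_converges: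
  assumes T: "0 \<le> T" and y0l: "l \<le> y0" and k: "\<And>m. real (k m) * h m = T" and h: "\<And>m. 0 < h m" "h \<longlonglongrightarrow> 0"
  shows "(\<lambda>m. euler b l (h m) y0 (\<lambda>j. w (real (Suc j) * h m) - w (real j * h m)) (k m)) \<longlonglongrightarrow> y T"
proof (rule LIMSEQ_I)
  fix \<epsilon> :: real assume e: "0 < \<epsilon>"
  define C where "C = (2 * T * B + 1) * exp (2 * B * T)"
  have C: "C > 0" using T B by (simp add: C_def add_nonneg_pos)
  define \<kappa> where "\<kappa> = \<epsilon> / (2 * C)"
  have \<kappa>: "\<kappa> > 0" using e C by (simp add: \<kappa>_def)
  have yc: "continuous_on {0..T} y" by (rule continuous_on_subset[OF y_cont]) auto
  obtain \<delta> where d: "\<delta> > 0" "\<And>s t. s\<in>{0..T} \<Longrightarrow> t\<in>{0..T} \<Longrightarrow> \<bar>s - t\<bar> < \<delta> \<Longrightarrow> \<bar>x s - x t\<bar> \<le> \<kappa> \<and> \<bar>y s - y t\<bar> \<le> \<kappa>"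
    using common_modulus[OF x_cont yc \<kappa>] by blast
  obtain m0 where m0: "\<And>m. m \<ge> m0 \<Longrightarrow> h m < \<delta>"
    using order_tendstoD(2)[OF h(2) d(1)] unfolding eventually_sequentially by blast
  show "\<exists>m0. \<forall>m\<ge>m0. norm (euler b l (h m) y0 (\<lambda>j. w (real (Suc j) * h m) - w (real j * h m)) (k m) - y T) < \<epsilon>"
  proof (intro exI allI impI)
    fix m assume m: "m0 \<le> m"
    have "\<bar>euler b l (h m) y0 (\<lambda>j. w (real (Suc j) * h m) - w (real j * h m)) (k m) - y (real (k m) * h m)\<bar>
      \<le> (2 * T * B + 1) * \<kappa> * exp (2 * B * T)"
      by (rule euler_error[OF h(1) refl y0l T]) (use \<kappa> d(2) m0[OF m] k[of m] in auto)
    also have "\<dots> = C * \<kappa>" by (simp add: C_def)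
    also have "\<dots> = \<epsilon> / 2" using C by (simp add: \<kappa>_def)
    also have "\<dots> < \<epsilon>" using e by simp
    finally show "norm (euler b l (h m) y0 (\<lambda>j. w (real (Suc j) * h m) - w (real j * h m)) (k m) - y T) < \<epsilon>"
      by (simp add: k)
  qed
qed


lemma y_increment:
  assumes "0 \<le> s" "s \<le> t"
  shows "y t - y s = (w t - w s) + integral {s..t} (\<lambda>u. b (y u)) + (K t - K s)"
  using y_eq[of s] y_eq[of t] by_combine[of s t] assms by simp

section \<open>Pathwise Ito expansion\<close>

text \<open>The remainder is measured against one plus the sum of squared increments, because that
  sum need not stay bounded along a given path; controlling it is left to expectations. The pushing
  term leaves no trace: it moves only on intervals where the path meets \<open>l\<close>, and there
  \<open>g'\<close> is small by the Neumann condition.\<close>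

theorem ito_remainder:
  fixes g g' g'' :: "real \<Rightarrow> real"
  assumes K_cont: "continuous_on {0..} K"
    and g: "\<And>x. l \<le> x \<Longrightarrow> (g has_real_derivative g' x) (at x within {l..})"
    and g': "\<And>x. l \<le> x \<Longrightarrow> (g' has_real_derivative g'' x) (at x within {l..})"
    and g''_cont: "continuous_on {l..} g''"
    and bnd: "\<And>x. l \<le> x \<Longrightarrow> \<bar>g' x\<bar> \<le> G" "\<And>x. l \<le> x \<Longrightarrow> \<bar>g'' x\<bar> \<le> G"
    and neumann: "g' l = 0" and T: "0 < T" and \<epsilon>: "0 < \<epsilon>"
  shows "\<exists>n0>0. \<forall>n\<ge>n0. \<bar>g (y T) - g (y 0) - (\<Sum>i<n. g' (y (real i * (T / real n))) * (w (real (Suc i) * (T / real n)) - w (real i * (T / real n)))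
      + g'' (y (real i * (T / real n))) * (w (real (Suc i) * (T / real n)) - w (real i * (T / real n)))\<^sup>2 / 2
      + b (y (real i * (T / real n))) * g' (y (real i * (T / real n))) * (T / real n))\<bar>
      \<le> \<epsilon> * (1 + (\<Sum>i<n. (w (real (Suc i) * (T / real n)) - w (real i * (T / real n)))\<^sup>2))"
proof -
  have G: "0 \<le> G" using bnd(1)[of l] by simp
  have yc: "continuous_on {0..T} y" and wc: "continuous_on {0..T} w" and bc: "continuous_on {0..T} (\<lambda>s. b (y s))" and Kc: "continuous_on {0..T} K"
    by (auto intro: continuous_on_subset[OF y_cont] continuous_on_subset[OF w_cont] continuous_on_subset[OF by_cont] continuous_on_subset[OF K_cont])
  obtain Cb where "\<forall>z\<in>(\<lambda>s. b (y s)) ` {0..T}. norm z \<le> Cb"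
    using compact_imp_bounded[OF compact_continuous_image[OF bc compact_Icc]] unfolding bounded_iff by blast
  then have Cb: "\<And>s. s \<in> {0..T} \<Longrightarrow> \<bar>b (y s)\<bar> \<le> Cb" by auto
  have Cb0: "0 \<le> Cb" using Cb[of 0] T by auto
  obtain ym where "\<forall>z\<in>y ` {0..T}. norm z \<le> ym"
    using compact_imp_bounded[OF compact_continuous_image[OF yc compact_Icc]] unfolding bounded_iff by blast
  then have ym: "\<And>s. s \<in> {0..T} \<Longrightarrow> y s \<le> ym" by (auto simp: abs_le_iff)
  \<comment> \<open>Collects the coefficients that appear when the one-step bounds are summed;
    \<kappa> is then taken with 2 * \<kappa> * c \<le> \<epsilon>.\<close>
  define c where "c = 1 + G * T + G * K T + (2 + 2 * G) * (Cb * T + K T)"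
  have KT: "0 \<le> K T" using K_mono[of 0 T] K0 T by simp
  have c: "c \<ge> 1" using G T KT Cb0 by (simp add: c_def)
  define \<kappa> where "\<kappa> = min 1 (\<epsilon> / (2 * c))"
  have \<kappa>: "0 < \<kappa>" "\<kappa> \<le> 1" "2 * \<kappa> * c \<le> \<epsilon>" using \<epsilon> c by (auto simp: \<kappa>_def min_def field_simps)
  have "uniformly_continuous_on {l..ym} g''"
    by (rule compact_uniformly_continuous[OF continuous_on_subset[OF g''_cont]]) auto
  then obtain \<delta>1 where d1: "\<delta>1 > 0" "\<And>u v. u \<in> {l..ym} \<Longrightarrow> v \<in> {l..ym} \<Longrightarrow> \<bar>u - v\<bar> < \<delta>1 \<Longrightarrow> \<bar>g'' u - g'' v\<bar> < \<kappa>"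
    using \<kappa>(1) unfolding uniformly_continuous_on_def dist_real_def by metis
  \<comment> \<open>Increments below this size are small in themselves and also lie within the
    modulus of continuity of \<open>g''\<close>.\<close>
  define \<kappa>' where "\<kappa>' = min \<kappa> (\<delta>1 / 2)"
  have \<kappa>': "\<kappa>' > 0" "\<kappa>' \<le> \<kappa>" "\<kappa>' < \<delta>1" using \<kappa> d1 by (auto simp: \<kappa>'_def)
  obtain \<delta>2 where d2: "\<delta>2 > 0" "\<And>s t. s\<in>{0..T} \<Longrightarrow> t\<in>{0..T} \<Longrightarrow> \<bar>s - t\<bar> < \<delta>2 \<Longrightarrow> \<bar>y s - y t\<bar> \<le> \<kappa>' \<and> \<bar>w s - w t\<bar> \<le> \<kappa>'"
    using common_modulus[OF yc wc \<kappa>'(1)] by blast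
  obtain \<delta>3 where d3: "\<delta>3 > 0" "\<And>s t. s\<in>{0..T} \<Longrightarrow> t\<in>{0..T} \<Longrightarrow> \<bar>s - t\<bar> < \<delta>3 \<Longrightarrow> \<bar>b (y s) - b (y t)\<bar> \<le> \<kappa>'"
    using common_modulus[OF bc Kc \<kappa>'(1)] by blast
  define n0 where "n0 = Suc (nat \<lceil>T / min \<delta>2 \<delta>3\<rceil>)"
  have step: "\<bar>g (y t) - g (y s) - (g' (y s) * (w t - w s) + g'' (y s) * (w t - w s)\<^sup>2 / 2 + b (y s) * g' (y s) * (t - s))\<bar>
     \<le> \<kappa> * (G * (t - s) + G * (K t - K s) + 2 * (w t - w s)\<^sup>2 + (4 + 2 * G) * (Cb * (t - s) + (K t - K s)))"
    if st: "0 \<le> s" "s \<le> t" "t \<le> T" "t - s < \<delta>2" "t - s < \<delta>3" for s t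
  proof -
    have in0: "s \<in> {0..T}" "t \<in> {0..T}" using st by auto
    define dw where "dw = w t - w s"
    define dK where "dK = K t - K s"
    define db where "db = integral {s..t} (\<lambda>u. b (y u))"
    define dA where "dA = db + dK"
    have dy: "y t - y s = dw + dA" using y_increment[of s t] st by (simp add: dw_def dA_def db_def dK_def)
    have ys: "l \<le> y s" "l \<le> y t" "y s \<le> ym" "y t \<le> ym" using y_ge ym in0 by auto
    have dK0: "0 \<le> dK" using K_mono st by (simp add: dK_def)
    have dyk: "\<bar>y t - y s\<bar> \<le> \<kappa>'" "\<bar>dw\<bar> \<le> \<kappa>'" using d2(2)[OF in0(2,1)] st by (auto simp: dw_def)
    have dAk: "\<bar>dA\<bar> \<le> 2 * \<kappa>" using dy dyk \<kappa>' by linarith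
    have e1: "\<bar>db - b (y s) * (t - s)\<bar> \<le> \<kappa> * (t - s)"
    proof -
      have "db - b (y s) * (t - s) = integral {s..t} (\<lambda>u. b (y u) - b (y s))"
        unfolding db_def by (subst Henstock_Kurzweil_Integration.integral_diff) (use by_int st in auto)
      also have "norm \<dots> \<le> \<kappa> * (t - s)"
      proof (rule integral_bound[OF st(2)])
        show "continuous_on {s..t} (\<lambda>u. b (y u) - b (y s))"
          by (intro continuous_intros continuous_on_subset[OF by_cont]) (use st in auto)
        fix u assume u: "u \<in> {s..t}"
        have "\<bar>b (y u) - b (y s)\<bar> \<le> \<kappa>'" by (rule d3(2)) (use u st in auto)
        then show "norm (b (y u) - b (y s)) \<le> \<kappa>" using \<kappa>'(2) by simp
      qed
      finally show ?thesis by simp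
    qed
    have dbC: "\<bar>db\<bar> \<le> Cb * (t - s)"
    proof -
      have "norm db \<le> Cb * (t - s)" unfolding db_def
        by (rule integral_bound[OF st(2)]) (use st Cb in \<open>auto intro!: continuous_on_subset[OF by_cont]\<close>)
      then show ?thesis by simp
    qed
    have dAC: "\<bar>dA\<bar> \<le> Cb * (t - s) + dK" using dbC dK0 by (simp add: dA_def)
    \<comment> \<open>If \<open>K\<close> moves between s and t, the path visits \<open>l\<close>
      there, so \<open>y s\<close> lies within \<kappa>' of the zero of \<open>g'\<close>.\<close>
    have e2: "\<bar>g' (y s) * dK\<bar> \<le> \<kappa> * (G * dK)"
    proof (cases "dK = 0")
      case False
      then have "\<exists>u. s < u \<and> u \<le> t \<and> y u = l"
        using K_const[of s t] st unfolding dK_def by auto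
      then obtain u where u: "s < u" "u \<le> t" "y u = l" by blast
      have near: "\<bar>y s - l\<bar> \<le> \<kappa>'" using d2(2)[of s u] u st by auto
      have "norm (g' (y s) - g' l) \<le> G * norm (y s - l)"
      proof (rule field_differentiable_bound[of "{l..}" g' g''])
        show "(g' has_real_derivative g'' z) (at z within {l..})" if "z \<in> {l..}" for z using g' that by simp
      qed (use ys bnd(2) in auto)
      also have "\<dots> \<le> G * \<kappa>" using near \<kappa>' G by (intro mult_left_mono) auto
      finally have "\<bar>g' (y s)\<bar> \<le> \<kappa> * G" using neumann by (simp add: mult.commute)
      then have "\<bar>g' (y s)\<bar> * dK \<le> \<kappa> * G * dK" by (rule mult_right_mono[OF _ dK0])
      then show ?thesis using dK0 by (simp add: abs_mult)
    qed simp
    have e3: "\<bar>g (y t) - g (y s) - g' (y s) * (y t - y s) - g'' (y s) * (y t - y s)\<^sup>2 / 2\<bar> \<le> \<kappa> * (y t - y s)\<^sup>2"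
    proof (rule taylor2_within[OF g g' ys(1,2)])
      fix u assume "u \<in> closed_segment (y s) (y t)"
      then have "u \<in> {l..ym}" "\<bar>u - y s\<bar> < \<delta>1" using dyk \<kappa>' ys
        by (auto simp: closed_segment_eq_real_ivl split: if_splits)
      then show "\<bar>g'' u - g'' (y s)\<bar> \<le> \<kappa>" using d1(2)[of u "y s"] ys by auto
    qed
    have sqb: "(y t - y s)\<^sup>2 \<le> 2 * dw\<^sup>2 + 2 * dA\<^sup>2"
    proof -
      have "0 \<le> (dw - dA)\<^sup>2" by simp
      then show ?thesis unfolding dy by (simp add: power2_sum power2_diff)
    qed
    have dA2: "dA\<^sup>2 \<le> 2 * \<bar>dA\<bar>"
    proof -
      have "dA\<^sup>2 = \<bar>dA\<bar> * \<bar>dA\<bar>" by (simp add: power2_eq_square)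
      also have "\<dots> \<le> 2 * \<bar>dA\<bar>" using dAk \<kappa>(2) by (intro mult_right_mono) auto
      finally show ?thesis .
    qed
    have e4: "\<bar>(y t - y s)\<^sup>2 - dw\<^sup>2\<bar> \<le> 2 * \<kappa> * \<bar>dA\<bar>"
    proof -
      have "(y t - y s)\<^sup>2 - dw\<^sup>2 = dA * ((y t - y s) + dw)" unfolding dy by (simp add: power2_eq_square algebra_simps)
      also have "\<bar>\<dots>\<bar> = \<bar>dA\<bar> * \<bar>(y t - y s) + dw\<bar>" by (rule abs_mult)
      also have "\<dots> \<le> \<bar>dA\<bar> * (2 * \<kappa>)" using dyk \<kappa>' by (intro mult_left_mono) auto
      finally show ?thesis by (simp add: mult_ac)
    qed
    have e5: "\<bar>g'' (y s) * ((y t - y s)\<^sup>2 - dw\<^sup>2) / 2\<bar> \<le> G * (\<kappa> * \<bar>dA\<bar>)"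
    proof -
      have "\<bar>g'' (y s)\<bar> * \<bar>(y t - y s)\<^sup>2 - dw\<^sup>2\<bar> \<le> G * (2 * \<kappa> * \<bar>dA\<bar>)"
        using bnd(2)[OF ys(1)] e4 G by (intro mult_mono) auto
      then show ?thesis by (simp add: abs_mult)
    qed
    have e6: "\<bar>g' (y s) * (db - b (y s) * (t - s))\<bar> \<le> G * (\<kappa> * (t - s))"
      using bnd(1)[OF ys(1)] e1 G unfolding abs_mult by (intro mult_mono) auto
    have split: "g (y t) - g (y s) - (g' (y s) * dw + g'' (y s) * dw\<^sup>2 / 2 + b (y s) * g' (y s) * (t - s))
      = (g (y t) - g (y s) - g' (y s) * (y t - y s) - g'' (y s) * (y t - y s)\<^sup>2 / 2)
        + g' (y s) * (db - b (y s) * (t - s)) + g' (y s) * dK + g'' (y s) * ((y t - y s)\<^sup>2 - dw\<^sup>2) / 2"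
    proof -
      have "g' (y s) * (y t - y s) = g' (y s) * dw + g' (y s) * db + g' (y s) * dK"
        unfolding dy dA_def by (simp add: algebra_simps)
      then show ?thesis by (simp add: diff_divide_distrib algebra_simps)
    qed
    have "\<bar>g (y t) - g (y s) - (g' (y s) * dw + g'' (y s) * dw\<^sup>2 / 2 + b (y s) * g' (y s) * (t - s))\<bar>
      \<le> \<kappa> * (y t - y s)\<^sup>2 + G * (\<kappa> * (t - s)) + \<kappa> * (G * dK) + G * (\<kappa> * \<bar>dA\<bar>)"
      unfolding split using e2 e3 e5 e6 by linarith
    also have "\<dots> \<le> \<kappa> * (2 * dw\<^sup>2 + 4 * \<bar>dA\<bar>) + G * (\<kappa> * (t - s)) + \<kappa> * (G * dK) + G * (\<kappa> * \<bar>dA\<bar>)"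
      using sqb dA2 \<kappa>(1) by (intro add_right_mono mult_left_mono) auto
    also have "\<dots> \<le> \<kappa> * (2 * dw\<^sup>2) + G * (\<kappa> * (t - s)) + \<kappa> * (G * dK) + \<kappa> * (4 + G) * \<bar>dA\<bar>"
      by (simp add: algebra_simps)
    also have "\<dots> \<le> \<kappa> * (2 * dw\<^sup>2) + G * (\<kappa> * (t - s)) + \<kappa> * (G * dK) + \<kappa> * (4 + G) * (Cb * (t - s) + dK)"
      using dAC \<kappa>(1) G by (intro add_left_mono mult_left_mono) auto
    also have "\<dots> \<le> \<kappa> * (G * (t - s) + G * dK + 2 * dw\<^sup>2 + (4 + 2 * G) * (Cb * (t - s) + dK))"
    proof -
      have "0 \<le> \<kappa> * (G * (Cb * (t - s) + dK))" using \<kappa>(1) G Cb0 st dK0 by auto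
      then show ?thesis by (simp add: algebra_simps)
    qed
    finally show ?thesis by (simp add: dw_def dK_def)
  qed
  show ?thesis
  proof (intro exI[of _ n0] conjI allI impI)
    show "0 < n0" by (simp add: n0_def)
    fix n assume n: "n0 \<le> n"
    define \<eta> where "\<eta> = T / real n"
    have np: "0 < n" using n by (simp add: n0_def)
    have \<eta>: "0 < \<eta>" "real n * \<eta> = T" using np T by (auto simp: \<eta>_def)
    define \<mu> where "\<mu> = min \<delta>2 \<delta>3"
    have "\<mu> > 0" using d2(1) d3(1) by (simp add: \<mu>_def)
    moreover have "T / \<mu> < real n" using n unfolding n0_def \<mu>_def by linarith
    ultimately have "\<eta> < \<mu>" using np by (simp add: \<eta>_def field_simps)
    then have small: "\<eta> < \<delta>2" "\<eta> < \<delta>3" by (auto simp: \<mu>_def)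
    let ?t = "\<lambda>i. real i * \<eta>"
    have tS: "?t (Suc i) - ?t i = \<eta>" for i by (simp add: algebra_simps)
    let ?r = "\<lambda>i. g' (y (?t i)) * (w (?t (Suc i)) - w (?t i)) + g'' (y (?t i)) * (w (?t (Suc i)) - w (?t i))\<^sup>2 / 2 + b (y (?t i)) * g' (y (?t i)) * \<eta>"
    let ?B = "\<lambda>i. \<kappa> * (G * (?t (Suc i) - ?t i) + G * (K (?t (Suc i)) - K (?t i)) + 2 * (w (?t (Suc i)) - w (?t i))\<^sup>2
          + (4 + 2 * G) * (Cb * (?t (Suc i) - ?t i) + (K (?t (Suc i)) - K (?t i))))"
    let ?Q = "\<Sum>i<n. (w (?t (Suc i)) - w (?t i))\<^sup>2"
    have s0: "g (y T) - g (y 0) - (\<Sum>i<n. ?r i) = (\<Sum>i<n. g (y (?t (Suc i))) - g (y (?t i)) - ?r i)"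
      using sum_lessThan_telescope[of "\<lambda>i. g (y (?t i))" n] \<eta>(2) by (simp add: sum_subtractf)
    have s1: "\<bar>g (y T) - g (y 0) - (\<Sum>i<n. ?r i)\<bar> \<le> (\<Sum>i<n. ?B i)"
      unfolding s0
    proof (rule order_trans[OF sum_abs sum_mono])
      fix i assume i: "i \<in> {..<n}"
      have "?t (Suc i) \<le> real n * \<eta>" by (rule mult_right_mono) (use i \<eta>(1) in auto)
      then have a3: "?t (Suc i) \<le> T" by (simp only: \<eta>(2))
      have a1: "0 \<le> ?t i" using \<eta>(1) by simp
      have a2: "?t i \<le> ?t (Suc i)" using \<eta>(1) tS[of i] by linarith
      show "\<bar>g (y (?t (Suc i))) - g (y (?t i)) - ?r i\<bar> \<le> ?B i"
        unfolding tS by (rule step[OF a1 a2 a3, unfolded tS, OF small])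
    qed
    have "(\<Sum>i<n. ?B i) = \<kappa> * (G * T + G * K T + 2 * ?Q + (4 + 2 * G) * (Cb * T + K T))"
    proof -
      have lin: "(\<Sum>i<n. \<kappa> * (G * p i + G * q i + 2 * u i + (4 + 2 * G) * (Cb * p i + q i)))
         = \<kappa> * (G * sum p {..<n} + G * sum q {..<n} + 2 * sum u {..<n} + (4 + 2 * G) * (Cb * sum p {..<n} + sum q {..<n}))"
        for p q u :: "nat \<Rightarrow> real"
        by (induction n) (auto simp: algebra_simps)
      have t1: "(\<Sum>i<n. ?t (Suc i) - ?t i) = T"
        using sum_lessThan_telescope[of ?t n] \<eta>(2) by simp
      have t2: "(\<Sum>i<n. K (?t (Suc i)) - K (?t i)) = K T"
        using sum_lessThan_telescope[of "\<lambda>i. K (?t i)" n] \<eta>(2) K0 by simp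
      have "(\<Sum>i<n. ?B i) = \<kappa> * (G * (\<Sum>i<n. ?t (Suc i) - ?t i) + G * (\<Sum>i<n. K (?t (Suc i)) - K (?t i)) + 2 * ?Q
          + (4 + 2 * G) * (Cb * (\<Sum>i<n. ?t (Suc i) - ?t i) + (\<Sum>i<n. K (?t (Suc i)) - K (?t i))))"
        by (rule lin)
      then show ?thesis by (simp only: t1 t2)
    qed
    also have "\<dots> \<le> \<kappa> * (2 * c * (1 + ?Q))"
    proof (rule mult_left_mono)
      have Q: "0 \<le> ?Q" by (simp add: sum_nonneg)
      have "G * T + G * K T + 2 * ?Q + (4 + 2 * G) * (Cb * T + K T) \<le> 2 * c + 2 * ?Q"
      proof -
        have "0 \<le> G * T" "0 \<le> G * K T" "0 \<le> G * (Cb * T + K T)" using G T KT Cb0 by auto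
        then show ?thesis by (simp add: c_def algebra_simps)
      qed
      also have "\<dots> \<le> 2 * c + 2 * c * ?Q" using mult_right_mono[OF c Q] by simp
      finally show "G * T + G * K T + 2 * ?Q + (4 + 2 * G) * (Cb * T + K T) \<le> 2 * c * (1 + ?Q)" by (simp add: algebra_simps)
    qed (use \<kappa> in simp)
    also have "\<dots> = (2 * \<kappa> * c) * (1 + ?Q)" by simp
    also have "\<dots> \<le> \<epsilon> * (1 + ?Q)"
      by (rule mult_right_mono[OF \<kappa>(3)]) (simp add: sum_nonneg add_nonneg_nonneg)
    finally have s2: "(\<Sum>i<n. ?B i) \<le> \<epsilon> * (1 + ?Q)" .
    show "\<bar>g (y T) - g (y 0) - (\<Sum>i<n. g' (y (real i * (T / real n))) * (w (real (Suc i) * (T / real n)) - w (real i * (T / real n)))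
      + g'' (y (real i * (T / real n))) * (w (real (Suc i) * (T / real n)) - w (real i * (T / real n)))\<^sup>2 / 2
      + b (y (real i * (T / real n))) * g' (y (real i * (T / real n))) * (T / real n))\<bar>
      \<le> \<epsilon> * (1 + (\<Sum>i<n. (w (real (Suc i) * (T / real n)) - w (real i * (T / real n)))\<^sup>2))"
      using order_trans[OF s1 s2] unfolding \<eta>_def .
  qed
qed

end

section \<open>Independence and the Euler scheme\<close>


lemma sets_LS_measure [simp, measurable_cong]: "sets (LS_measure L) = sets borel"
  and space_LS_measure [simp]: "space (LS_measure L) = UNIV"
  by (auto simp: LS_measure_def)

lemma emeasure_LS_measure:
  assumes c: "continuous_on {0..} L" and m: "mono_on {0..} L" and st: "0 \<le> s" "s \<le> t"
  shows "emeasure (LS_measure L) {s..t} = ennreal (L t - L s)" "emeasure (LS_measure L) {s<..t} = ennreal (L t - L s)"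
proof -
  let ?F = "\<lambda>u. L (max 0 u)"
  have mono: "?F u \<le> ?F v" if "u \<le> v" for u v
    using m that by (auto simp: mono_on_def)
  have cont: "continuous_on UNIV ?F"
    by (rule continuous_on_compose2[OF c]) (auto intro!: continuous_intros)
  then have right: "continuous (at_right u) ?F" for u
    by (simp add: continuous_on_eq_continuous_at continuous_at_imp_continuous_at_within)
  have e: "?F s = L s" "?F t = L t" using st by auto
  show "emeasure (LS_measure L) {s..t} = ennreal (L t - L s)"
    unfolding LS_measure_def using emeasure_interval_measure_Icc[OF st(2) mono cont] e by simp
  show "emeasure (LS_measure L) {s<..t} = ennreal (L t - L s)"
    unfolding LS_measure_def using emeasure_interval_measure_Ioc[OF st(2) mono right] e by simp
qed

context
  fixes L y :: "real \<Rightarrow> real" and l :: real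
  assumes c: "continuous_on {0..} L" and m: "mono_on {0..} L" and yc: "continuous_on {0..} y"
    and null: "emeasure (LS_measure L) {s \<in> {0..}. y s \<noteq> l} = 0"
begin

lemma off_boundary_sets: "{s \<in> {0..}. y s \<noteq> l} \<in> sets (LS_measure L)"
proof -
  have "closed {s \<in> {0..}. y s = l}"
    by (rule continuous_closed_preimage_constant[OF yc]) auto
  then have "{0..} - {s \<in> {0..}. y s = l} \<in> sets borel" by auto
  also have "{0..} - {s \<in> {0..}. y s = l} = {s \<in> {0..}. y s \<noteq> l}" by auto
  finally show ?thesis by (simp add: LS_measure_def)
qed

lemma LS_const:
  assumes st: "0 \<le> s" "s \<le> t" and off: "\<And>u. s < u \<Longrightarrow> u \<le> t \<Longrightarrow> y u \<noteq> l"
  shows "L s = L t"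
proof -
  have "emeasure (LS_measure L) {s<..t} \<le> emeasure (LS_measure L) {s \<in> {0..}. y s \<noteq> l}"
  proof (rule emeasure_mono)
    show "{s<..t} \<subseteq> {s \<in> {0..}. y s \<noteq> l}"
    proof
      fix u assume "u \<in> {s<..t}"
      then show "u \<in> {s \<in> {0..}. y s \<noteq> l}" using off[of u] st by simp
    qed
  qed (rule off_boundary_sets)
  then have "ennreal (L t - L s) = 0" using null emeasure_LS_measure(2)[OF c m st] by simp
  moreover have "L s \<le> L t" using m st by (auto simp: mono_on_def)
  ultimately show ?thesis by (simp add: ennreal_eq_0_iff)
qed

text \<open>\<open>L\<close> charges only times with y = l, so the integrand is the constant 2 l.
  With l = r / 2 the boundary term of the equation becomes \<open>r * L t\<close>, the pushing term
  of \<open>reflected_path\<close>.\<close>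

lemma LS_integral:
  assumes t: "0 \<le> t" and L0: "L 0 = 0"
  shows "(LINT s:{0..t}|LS_measure L. 2 * y s) = 2 * l * L t"
proof -
  have [measurable]: "(\<lambda>s. indicator {0..t} s *\<^sub>R (2 * y s)) \<in> borel_measurable borel"
    by (rule borel_measurable_continuous_on_indicator)
       (auto intro!: continuous_intros continuous_on_subset[OF yc])
  have "(LINT s:{0..t}|LS_measure L. 2 * y s) = (LINT s|LS_measure L. indicator {0..t} s *\<^sub>R (2 * l))"
    unfolding set_lebesgue_integral_def
  proof (rule integral_cong_AE)
    have "AE s in LS_measure L. s \<notin> {s \<in> {0..}. y s \<noteq> l}"
      by (rule AE_not_in) (use null off_boundary_sets in \<open>auto simp: null_sets_def\<close>)
    then show "AE s in LS_measure L. indicator {0..t} s *\<^sub>R (2 * y s) = indicator {0..t} s *\<^sub>R (2 * l)"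
      by eventually_elim (auto simp: indicator_def)
  qed measurable
  also have "\<dots> = measure (LS_measure L) {0..t} * (2 * l)"
    by simp
  also have "measure (LS_measure L) {0..t} = L t"
  proof -
    have "L 0 \<le> L t" using m t by (auto simp: mono_on_def)
    then show ?thesis using emeasure_LS_measure(1)[OF c m order.refl t] L0 by (simp add: measure_def)
  qed
  finally show ?thesis by simp
qed

end

section \<open>Parameters, drift and the solution on its probability space\<close>

locale hard_ball_params =
  fixes d :: nat and r a :: real
  assumes d: "2 \<le> d" and r: "0 < r" and a: "0 < a"
begin

definition l :: real where "l = r / 2"
definition b :: "real \<Rightarrow> real" where "b u = - 2 * a * u + (real d - 1) / (4 * u)"
text \<open>The supremum of the modulus of the derivative of \<open>b\<close> on
  \<open>{l..}\<close>, attained at the barrier.\<close>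

definition B :: real where "B = 2 * a + (real d - 1) / (4 * l\<^sup>2)"

lemma l_pos: "0 < l" using r by (simp add: l_def)
lemma d1_pos: "0 < real d - 1" using d by simp
lemma B_nonneg: "0 \<le> B" using a d1_pos l_pos by (simp add: B_def)

lemma b_lip:
  assumes uv: "l \<le> u" "l \<le> v"
  shows "\<bar>b u - b v\<bar> \<le> B * \<bar>u - v\<bar>"
proof -
  have p: "u > 0" "v > 0" using uv l_pos by auto
  define c where "c = 2 * a + (real d - 1) / (4 * (u * v))"
  have c: "0 < c" using p a d1_pos by (simp add: c_def add_pos_pos)
  have "b u - b v = - c * (u - v)"
    using p by (simp add: b_def c_def field_simps)
  then have "\<bar>b u - b v\<bar> = c * \<bar>u - v\<bar>"
    using c by (simp add: abs_mult)
  also have "\<dots> = (2 * a + (real d - 1) / (4 * (u * v))) * \<bar>u - v\<bar>" by (simp add: c_def)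
  also have "\<dots> \<le> B * \<bar>u - v\<bar>"
  proof (rule mult_right_mono)
    have "l * l \<le> u * v" using uv l_pos by (intro mult_mono) auto
    then show "2 * a + (real d - 1) / (4 * (u * v)) \<le> B"
      unfolding B_def power2_eq_square using d1_pos l_pos p by (intro add_left_mono divide_left_mono) auto
  qed simp
  finally show ?thesis .
qed

lemma b_measurable [measurable]: "b \<in> borel_measurable borel"
  unfolding b_def by measurable

end

locale reflected_sde = hard_ball_params +
  fixes y0 :: real and M :: "'a measure" and W y L :: "real \<Rightarrow> 'a \<Rightarrow> real"
  assumes y0: "r / 2 < y0" and sol: "refl_solution d r a y0 M W y L"
begin

lemma std_BM: "std_BM M W" using sol by (simp add: refl_solution_def)

sublocale prob_space M using std_BM by (simp add: std_BM_def)

lemma W_measurable [measurable]: "0 \<le> t \<Longrightarrow> W t \<in> borel_measurable M"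
  using std_BM by (simp add: std_BM_def)

lemma y_measurable [measurable]: "0 \<le> t \<Longrightarrow> y t \<in> borel_measurable M"
  using sol by (simp add: refl_solution_def)

lemma l_le_y0: "l \<le> y0" using y0 by (simp add: l_def)

text \<open>The only bridge from the stochastic equation to the deterministic theory: noise W / sqrt
  2, pushing term \<open>r * L\<close>.\<close>

lemma AE_path:
  "AE \<omega> in M. y 0 \<omega> = y0 \<and> reflected_path l y0 B b (\<lambda>t. W t \<omega> / sqrt 2) (\<lambda>t. y t \<omega>) (\<lambda>t. r * L t \<omega>)
     \<and> continuous_on {0..} (\<lambda>t. r * L t \<omega>)"
proof -
  have "AE \<omega> in M.
          y 0 \<omega> = y0
        \<and> continuous_on {0..} (\<lambda>t. y t \<omega>)
        \<and> (\<forall>t\<ge>0. y t \<omega> \<ge> r / 2)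
        \<and> L 0 \<omega> = 0
        \<and> continuous_on {0..} (\<lambda>t. L t \<omega>)
        \<and> mono_on {0..} (\<lambda>t. L t \<omega>)
        \<and> emeasure (LS_measure (\<lambda>t. L t \<omega>)) {s \<in> {0..}. y s \<omega> \<noteq> r / 2} = 0
        \<and> (\<forall>t\<ge>0. y t \<omega> = y0 + W t \<omega> / sqrt 2
               + integral {0..t} (\<lambda>s. - 2 * a * y s \<omega> + (real d - 1) / (4 * y s \<omega>))
               + (LINT s:{0..t}|LS_measure (\<lambda>t. L t \<omega>). 2 * y s \<omega>))"
    using sol unfolding refl_solution_def by blast
  then show ?thesis
    using AE_space
  proof eventually_elim
    case (elim \<omega>)
    then have h: "y 0 \<omega> = y0" "continuous_on {0..} (\<lambda>t. y t \<omega>)" "\<And>t. t \<ge> 0 \<Longrightarrow> y t \<omega> \<ge> l"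
      "L 0 \<omega> = 0" "continuous_on {0..} (\<lambda>t. L t \<omega>)" "mono_on {0..} (\<lambda>t. L t \<omega>)"
      "emeasure (LS_measure (\<lambda>t. L t \<omega>)) {s \<in> {0..}. y s \<omega> \<noteq> l} = 0"
      "\<And>t. t \<ge> 0 \<Longrightarrow> y t \<omega> = y0 + W t \<omega> / sqrt 2
               + integral {0..t} (\<lambda>s. b (y s \<omega>))
               + (LINT s:{0..t}|LS_measure (\<lambda>t. L t \<omega>). 2 * y s \<omega>)"
      unfolding l_def b_def using elim(1) by blast+
    have W: "W 0 \<omega> = 0" "continuous_on {0..} (\<lambda>t. W t \<omega>)"
      using std_BM elim(2) by (auto simp: std_BM_def)
    have "reflected_path l y0 B b (\<lambda>t. W t \<omega> / sqrt 2) (\<lambda>t. y t \<omega>) (\<lambda>t. r * L t \<omega>)"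
    proof
      show "continuous_on {0..} (\<lambda>t. W t \<omega> / sqrt 2)" by (intro continuous_intros W) auto
      show "r * L s \<omega> \<le> r * L t \<omega>" if "0 \<le> s" "s \<le> t" for s t
        using h(6) r that by (auto simp: mono_on_def)
      show "r * L s \<omega> = r * L t \<omega>" if "0 \<le> s" "s \<le> t" "\<And>u. s < u \<Longrightarrow> u \<le> t \<Longrightarrow> y u \<omega> \<noteq> l" for s t
        using LS_const[OF h(5,6,2,7) that] by simp
      show "y t \<omega> = y0 + W t \<omega> / sqrt 2 + integral {0..t} (\<lambda>s. b (y s \<omega>)) + r * L t \<omega>" if "0 \<le> t" for t
        using h(8)[OF that] LS_integral[OF h(5,6,2,7) that h(4)] by (simp add: l_def)
    qed (use h(1-7) W B_nonneg b_lip in auto)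
    then show ?case using h(1,5) by (auto intro!: continuous_intros)
  qed
qed

lemma AE_continuous: "AE \<omega> in M. continuous_on {0..} (\<lambda>t. y t \<omega>)"
  using AE_path by eventually_elim (blast intro: reflected_path.y_cont)

lemma AE_ge: assumes t: "0 \<le> t" shows "AE \<omega> in M. l \<le> y t \<omega>"
  using AE_path
proof eventually_elim
  case (elim \<omega>)
  then show ?case using reflected_path.y_ge[of l y0 B b _ "\<lambda>t. y t \<omega>", OF _ t] by blast
qed

definition dW :: "real \<Rightarrow> nat \<Rightarrow> 'a \<Rightarrow> real" where
  "dW h i \<omega> = W (real (Suc i) * h) \<omega> - W (real i * h) \<omega>"

lemma dW_measurable [measurable]: "0 < h \<Longrightarrow> dW h i \<in> borel_measurable M"
  unfolding dW_def by (intro borel_measurable_diff W_measurable) auto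

lemma dW_distributed: assumes h: "0 < h" shows "distributed M lborel (dW h i) (normal_density 0 (sqrt h))"
proof -
  have "distributed M lborel (\<lambda>\<omega>. W t \<omega> - W s \<omega>) (normal_density 0 (sqrt (t - s)))" if "0 \<le> s" "s < t" for s t
    using std_BM that by (simp add: std_BM_def)
  from this[of "real i * h" "real (Suc i) * h"] show ?thesis
    using h by (simp add: dW_def[abs_def] algebra_simps)
qed

lemma dW_moments:
  assumes h: "0 < h"
  shows "integrable M (\<lambda>\<omega>. dW h i \<omega> ^ k)" "expectation (dW h i) = 0"
    "expectation (\<lambda>\<omega>. (dW h i \<omega>)\<^sup>2) = h" "expectation (\<lambda>\<omega>. dW h i \<omega> ^ 4) = 3 * h\<^sup>2"
proof -
  have s: "0 < sqrt h" using h by simp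
  note D = dW_distributed[OF h, of i]
  show "integrable M (\<lambda>\<omega>. dW h i \<omega> ^ k)"
    using distributed_integrable[OF D, of "\<lambda>x. x ^ k"] integrable_normal_moment[OF s, of 0 k] by simp
  show "expectation (dW h i) = 0"
    using distributed_integral[OF D, of "\<lambda>x. x"] integral_normal_moment_odd[OF s, of 0 0] by simp
  show "expectation (\<lambda>\<omega>. (dW h i \<omega>)\<^sup>2) = h"
    using distributed_integral[OF D, of "\<lambda>x. x\<^sup>2"] integral_normal_moment_even[OF s, of 0 1] h by simp
  show "expectation (\<lambda>\<omega>. dW h i \<omega> ^ 4) = 3 * h\<^sup>2"
    using distributed_integral[OF D, of "\<lambda>x. x ^ 4"] integral_normal_moment_even[OF s, of 0 2] h
    by (simp add: fact_numeral power2_eq_square)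
qed

lemma dW_square_integrable:
  assumes h: "0 < h" shows "square_integrable M (\<lambda>\<omega>. dW h i \<omega> ^ k)"
  using dW_moments(1)[OF h, of i "k * 2"] h by (simp add: square_integrable_def power_mult)

lemma dW_indep: assumes h: "0 < h" shows "indep_vars (\<lambda>_. borel) (dW h) {..<N}"
proof -
  define ts where "ts = map (\<lambda>i. real i * h) [0..<Suc N]"
  have nth: "ts ! i = real i * h" if "i \<le> N" for i using that by (simp add: ts_def del: upt_Suc)
  have len: "length ts = Suc N" by (simp add: ts_def)
  have "sorted ts" unfolding ts_def
    using h by (auto simp: sorted_map sorted_wrt_upt intro!: sorted_wrt_mono_rel[OF _ sorted_wrt_upt] mult_right_mono simp del: upt_Suc)
  moreover have "ts \<noteq> []" using len by auto
  moreover have "0 \<le> hd ts" using nth[of 0] hd_conv_nth[of ts] \<open>ts \<noteq> []\<close> by simp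
  ultimately have "indep_vars (\<lambda>_. borel) (\<lambda>i \<omega>. W (ts ! Suc i) \<omega> - W (ts ! i) \<omega>) {..<length ts - 1}"
    using std_BM by (simp add: std_BM_def)
  then show ?thesis
    by (subst (asm) indep_vars_cong[where Y = "dW h" and J = "{..<N}" and N' = "\<lambda>_. borel"])
       (auto simp: len nth dW_def fun_eq_iff simp del: of_nat_Suc)
qed

text \<open>The sigma-algebra generated by the increments with index in \<open>A\<close>. Indexing
  by sets rather than times lets disjointness of index sets express independence, for the past as
  well as for a block of later increments.\<close>

definition increments :: "real \<Rightarrow> nat set \<Rightarrow> 'a measure" where
  "increments h A = vimage_algebra (space M) (\<lambda>\<omega>. \<lambda>i\<in>A. dW h i \<omega>) (PiM A (\<lambda>_. borel))"

abbreviation "past h K \<equiv> increments h {..<K}"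

lemma space_increments [simp]: "space (increments h A) = space M"
  by (simp add: increments_def)

lemma dW_past: assumes "i \<in> A" shows "dW h i \<in> borel_measurable (increments h A)"
proof -
  have "(\<lambda>\<omega>. \<lambda>i\<in>A. dW h i \<omega>) \<in> measurable (increments h A) (PiM A (\<lambda>_. borel))"
    unfolding increments_def by (rule measurable_vimage_algebra1) (auto simp: space_PiM)
  then have "(\<lambda>\<omega>. (\<lambda>i\<in>A. dW h i \<omega>) i) \<in> borel_measurable (increments h A)"
    by (rule measurable_compose[OF _ measurable_component_singleton]) (use assms in auto)
  then show ?thesis using assms by simp
qed

lemma increments_measurable:
  assumes h: "0 < h" and X: "X \<in> borel_measurable (increments h A)"
  shows "X \<in> borel_measurable M"
proof -
  have "(\<lambda>\<omega>. \<lambda>i\<in>A. dW h i \<omega>) \<in> measurable M (PiM A (\<lambda>_. borel))"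
    by (rule measurable_restrict) (use h in auto)
  then have "sets (increments h A) \<subseteq> events"
    unfolding increments_def by (intro sets_image_in_sets) auto
  then show ?thesis using X by (auto simp: measurable_def)
qed

text \<open>The two blocks of increments are independent as random vectors, and each variable
  generates a sub-sigma-algebra of the one generated by its block.\<close>

lemma increments_indep:
  fixes X Z :: "'a \<Rightarrow> real"
  assumes h: "0 < h" and disj: "A \<inter> A' = {}" and fin: "finite A" "finite A'"
    and X: "X \<in> borel_measurable (increments h A)" and Z: "Z \<in> borel_measurable (increments h A')"
  shows "indep_var borel X borel Z"
proof -
  obtain N where N: "A \<union> A' \<subseteq> {..<N}"
    using finite_nat_bounded[of "A \<union> A'"] fin by auto
  define P where "P A = (\<lambda>\<omega>. \<lambda>i\<in>A. dW h i \<omega>)" for A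
  have "indep_var (PiM A (\<lambda>_. borel)) (P A) (PiM A' (\<lambda>_. borel)) (P A')"
    unfolding P_def by (rule indep_var_restrict[OF dW_indep[OF h, of N]]) (use disj N in auto)
  then have ind: "indep_set (sigma_sets (space M) {P A -` S \<inter> space M | S. S \<in> sets (PiM A (\<lambda>_. borel))})
      (sigma_sets (space M) {P A' -` S \<inter> space M | S. S \<in> sets (PiM A' (\<lambda>_. borel))})"
    unfolding indep_var_eq by blast
  have gen: "sigma_sets (space M) {X -` S \<inter> space M | S. S \<in> sets borel}
      \<subseteq> sigma_sets (space M) {P A -` S \<inter> space M | S. S \<in> sets (PiM A (\<lambda>_. borel))}"
    if X: "X \<in> borel_measurable (increments h A)" for X :: "'a \<Rightarrow> real" and A
  proof -
    have "{X -` S \<inter> space M | S. S \<in> sets borel} \<subseteq> sets (increments h A)"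
      using measurable_sets[OF X] by auto
    then have "sigma_sets (space (increments h A)) {X -` S \<inter> space M | S. S \<in> sets borel} \<subseteq> sets (increments h A)"
      by (rule sets.sigma_sets_subset)
    then show ?thesis by (simp add: increments_def sets_vimage_algebra P_def)
  qed
  show ?thesis
    unfolding indep_var_eq
  proof (intro conjI)
    show "indep_set (sigma_sets (space M) {X -` S \<inter> space M | S. S \<in> sets borel}) (sigma_sets (space M) {Z -` S \<inter> space M | S. S \<in> sets borel})"
      unfolding indep_set_def
    proof (rule indep_sets_mono_sets[OF ind[unfolded indep_set_def]])
      fix i
      show "case_bool (sigma_sets (space M) {X -` S \<inter> space M | S. S \<in> sets borel}) (sigma_sets (space M) {Z -` S \<inter> space M | S. S \<in> sets borel}) i
        \<subseteq> case_bool (sigma_sets (space M) {P A -` S \<inter> space M | S. S \<in> sets (PiM A (\<lambda>_. borel))})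
            (sigma_sets (space M) {P A' -` S \<inter> space M | S. S \<in> sets (PiM A' (\<lambda>_. borel))}) i"
        using gen[OF X] gen[OF Z] by (cases i) simp_all
    qed
  qed (use increments_measurable[OF h] X Z in auto)
qed

definition approx :: "real \<Rightarrow> nat \<Rightarrow> 'a \<Rightarrow> real" where
  "approx h k \<omega> = euler b l h y0 (\<lambda>j. dW h j \<omega> / sqrt 2) k"

lemma approx_past: "k \<le> K \<Longrightarrow> approx h k \<in> borel_measurable (past h K)"
proof (induction k)
  case (Suc k)
  then have [measurable]: "approx h k \<in> borel_measurable (past h K)" "dW h k \<in> borel_measurable (past h K)"
    by (auto intro: dW_past)
  have "approx h (Suc k) = (\<lambda>\<omega>. max l (approx h k \<omega> + dW h k \<omega> / sqrt 2 + h * b (approx h k \<omega>)))"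
    by (simp add: approx_def fun_eq_iff)
  then show ?case by simp
next
  case 0
  have "approx h 0 = (\<lambda>_. y0)" by (simp add: approx_def fun_eq_iff)
  then show ?case by simp
qed

text \<open>Meshes of the form \<eta> / Suc m reach the coarse time i * \<eta> after exactly i * Suc
  m steps, so one exceptional null set serves all coarse times.\<close>

lemma AE_approx:
  assumes \<eta>: "0 < \<eta>"
  shows "AE \<omega> in M. \<forall>i. (\<lambda>m. approx (\<eta> / real (Suc m)) (i * Suc m) \<omega>) \<longlonglongrightarrow> y (real i * \<eta>) \<omega>"
  using AE_path
proof eventually_elim
  case (elim \<omega>)
  then interpret reflected_path l y0 B b "\<lambda>t. W t \<omega> / sqrt 2" "\<lambda>t. y t \<omega>" "\<lambda>t. r * L t \<omega>" by simp
  show ?case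
  proof
    fix i
    have "(\<lambda>m. euler b l (\<eta> / real (Suc m)) y0 (\<lambda>j. W (real (Suc j) * (\<eta> / real (Suc m))) \<omega> / sqrt 2 - W (real j * (\<eta> / real (Suc m))) \<omega> / sqrt 2) (i * Suc m)) \<longlonglongrightarrow> y (real i * \<eta>) \<omega>"
    proof (rule euler_converges[where h = "\<lambda>m. \<eta> / real (Suc m)" and k = "\<lambda>m. i * Suc m"])
      show "real (i * Suc m) * (\<eta> / real (Suc m)) = real i * \<eta>" for m
        by (simp del: of_nat_Suc mult_Suc_right)
      show "(\<lambda>m. \<eta> / real (Suc m)) \<longlonglongrightarrow> 0"
        using LIMSEQ_Suc[OF lim_const_over_n[of \<eta>]] by simp
    qed (use \<eta> l_le_y0 in auto)
    then show "(\<lambda>m. approx (\<eta> / real (Suc m)) (i * Suc m) \<omega>) \<longlonglongrightarrow> y (real i * \<eta>) \<omega>"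
      by (simp only: approx_def dW_def diff_divide_distrib)
  qed
qed

text \<open>Turns a coarse increment into a function of a single block of fine increments; the block
  with index k is disjoint from the fine indices below \<open>k * Suc m\<close>.\<close>

lemma dW_refine:
  "dW \<eta> k \<omega> = (\<Sum>i\<in>{k * Suc m..<Suc k * Suc m}. dW (\<eta> / real (Suc m)) i \<omega>)"
proof -
  let ?h = "\<eta> / real (Suc m)"
  have "(\<Sum>i\<in>{k * Suc m..<Suc k * Suc m}. dW ?h i \<omega>) = W (real (Suc k * Suc m) * ?h) \<omega> - W (real (k * Suc m) * ?h) \<omega>"
    unfolding dW_def using sum_Suc_diff'[of "k * Suc m" "Suc k * Suc m" "\<lambda>i. W (real i * ?h) \<omega>"] by simp
  also have "real (Suc k * Suc m) * ?h = real (Suc k) * \<eta>" by (simp del: of_nat_Suc mult_Suc mult_Suc_right)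
  also have "real (k * Suc m) * ?h = real k * \<eta>" by (simp del: of_nat_Suc mult_Suc_right)
  finally show ?thesis by (simp add: dW_def)
qed

lemma past_refine:
  assumes "i < k" shows "dW \<eta> i \<in> borel_measurable (past (\<eta> / real (Suc m)) (k * Suc m))"
proof -
  have le: "Suc i * Suc m \<le> k * Suc m" using assms by (intro mult_le_mono1) simp
  have "(\<lambda>\<omega>. \<Sum>j\<in>{i * Suc m..<Suc i * Suc m}. dW (\<eta> / real (Suc m)) j \<omega>) \<in> borel_measurable (past (\<eta> / real (Suc m)) (k * Suc m))"
    by (intro borel_measurable_sum dW_past) (use le in auto)
  then show ?thesis by (simp only: dW_refine[of \<eta> i _ m, symmetric])
qed

text \<open>The solution is not assumed to be adapted to \<open>W\<close>; instead the past-measurability needed here is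
  obtained by approximating with the Euler scheme.\<close>
lemma orthogonal_increment:
  assumes \<eta>: "0 < \<eta>" and X: "\<And>m. X m \<in> borel_measurable (past (\<eta> / real (Suc m)) (k * Suc m))"
    and X0 [measurable]: "X0 \<in> borel_measurable M" and lim: "AE \<omega> in M. (\<lambda>m. X m \<omega>) \<longlonglongrightarrow> X0 \<omega>"
    and D: "square_integrable M D" "\<And>m. AE \<omega> in M. \<bar>X m \<omega>\<bar> \<le> D \<omega>"
    and f: "f \<in> borel_measurable borel" "square_integrable M (\<lambda>\<omega>. f (dW \<eta> k \<omega>))" "expectation (\<lambda>\<omega>. f (dW \<eta> k \<omega>)) = 0"
  shows "integrable M (\<lambda>\<omega>. X0 \<omega> * f (dW \<eta> k \<omega>))" "expectation (\<lambda>\<omega>. X0 \<omega> * f (dW \<eta> k \<omega>)) = 0"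
proof -
  let ?Z = "\<lambda>\<omega>. f (dW \<eta> k \<omega>)"
  have hp: "0 < \<eta> / real (Suc m)" for m using \<eta> by simp
  have Zeq: "?Z = (\<lambda>\<omega>. f (\<Sum>i\<in>{k * Suc m..<Suc k * Suc m}. dW (\<eta> / real (Suc m)) i \<omega>))" for m
    by (simp only: dW_refine[of \<eta> k _ m, symmetric])
  have [measurable]: "X m \<in> borel_measurable M" for m by (rule increments_measurable[OF hp X])
  have [measurable]: "?Z \<in> borel_measurable M" using f(2) by (simp add: square_integrable_def)
  have [measurable]: "D \<in> borel_measurable M" using D by (simp add: square_integrable_def)
  have DZ: "integrable M (\<lambda>\<omega>. D \<omega> * \<bar>?Z \<omega>\<bar>)"
    by (rule square_integrable_mult[OF D(1)]) (use f(2) in \<open>auto simp: square_integrable_def\<close>)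
  have bound: "AE \<omega> in M. norm (X m \<omega> * ?Z \<omega>) \<le> D \<omega> * \<bar>?Z \<omega>\<bar>" for m
    using D(2)[of m] by eventually_elim (simp add: abs_mult mult_right_mono)
  show "integrable M (\<lambda>\<omega>. X0 \<omega> * ?Z \<omega>)"
    by (rule integrable_dominated_convergence[OF _ _ DZ _ bound])
       (use lim in \<open>auto elim!: eventually_mono intro!: tendsto_intros\<close>)
  have lim': "(\<lambda>m. expectation (\<lambda>\<omega>. X m \<omega> * ?Z \<omega>)) \<longlonglongrightarrow> expectation (\<lambda>\<omega>. X0 \<omega> * ?Z \<omega>)"
    by (rule integral_dominated_convergence[OF _ _ DZ _ bound])
       (use lim in \<open>auto elim!: eventually_mono intro!: tendsto_intros\<close>)
  have "expectation (\<lambda>\<omega>. X m \<omega> * ?Z \<omega>) = 0" for m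
  proof -
    have "indep_var borel (X m) borel ?Z"
    proof (rule increments_indep[OF hp _ _ _ X])
      show "?Z \<in> borel_measurable (increments (\<eta> / real (Suc m)) {k * Suc m..<Suc k * Suc m})"
        unfolding Zeq[of m] by (rule measurable_compose[OF _ f(1)], intro borel_measurable_sum dW_past)
    qed auto
    moreover have "integrable M (X m)"
      by (rule square_integrable_imp_integrable[OF square_integrable_bound[OF D(1) _ D(2)]]) measurable
    moreover have "integrable M ?Z" by (rule square_integrable_imp_integrable[OF f(2)])
    ultimately have "expectation (\<lambda>\<omega>. X m \<omega> * ?Z \<omega>) = expectation (X m) * expectation ?Z"
      by (rule indep_var_lebesgue_integral)
    then show ?thesis using f(3) by simp
  qed
  then show "expectation (\<lambda>\<omega>. X0 \<omega> * ?Z \<omega>) = 0" using LIMSEQ_unique[OF lim'] by simp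
qed

end

section \<open>Ito's formula in expectation\<close>


text \<open>The remainder is small only relative to the random normaliser \<open>T\<close>, which
  has bounded mean but no uniform bound. The truncated ratio \<open>q\<close> tends to zero in mean
  by bounded convergence, and the second moments of \<open>X\<close> control the event where the
  ratio is not small.\<close>

lemma (in prob_space) expectation_tendsto_zero:
  fixes X T :: "nat \<Rightarrow> 'a \<Rightarrow> real"
  assumes X: "\<And>n. square_integrable M (X n)" "\<And>n. expectation (\<lambda>\<omega>. (X n \<omega>)\<^sup>2) \<le> C"
    and T: "\<And>n. integrable M (T n)" "\<And>n. expectation (T n) \<le> C" "\<And>n \<omega>. 1 \<le> T n \<omega>"
    and lim: "AE \<omega> in M. (\<lambda>n. X n \<omega> / T n \<omega>) \<longlonglongrightarrow> 0"
  shows "(\<lambda>n. expectation (X n)) \<longlonglongrightarrow> 0"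
proof (rule LIMSEQ_I)
  fix \<epsilon> :: real assume e: "0 < \<epsilon>"
  have [measurable]: "X n \<in> borel_measurable M" "T n \<in> borel_measurable M" for n
    using X(1)[of n] T(1)[of n] by (auto simp: square_integrable_def)
  have C: "0 \<le> C"
    by (rule order_trans[OF _ X(2)[of 0]]) simp
  define q where "q n \<omega> = min (\<bar>X n \<omega>\<bar> / T n \<omega>) 1" for n \<omega>
  have [measurable]: "q n \<in> borel_measurable M" for n unfolding q_def by measurable
  have q01: "0 \<le> q n \<omega>" "q n \<omega> \<le> 1" for n \<omega> using T(3)[of n \<omega>] by (auto simp: q_def)
  have qint: "integrable M (q n)" for n
    by (rule integrable_const_bound[where B = 1]) (use q01 in auto)
  have "(\<lambda>n. expectation (q n)) \<longlonglongrightarrow> expectation (\<lambda>_. 0)"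
  proof (rule integral_dominated_convergence[where w = "\<lambda>_. 1"])
    show "AE \<omega> in M. (\<lambda>n. q n \<omega>) \<longlonglongrightarrow> 0"
      using lim
    proof eventually_elim
      case (elim \<omega>)
      have "(\<lambda>n. \<bar>X n \<omega> / T n \<omega>\<bar>) \<longlonglongrightarrow> 0" using tendsto_rabs_zero[OF elim] .
      moreover have eq: "\<bar>X n \<omega> / T n \<omega>\<bar> = \<bar>X n \<omega>\<bar> / T n \<omega>" for n using T(3)[of n \<omega>] by (simp add: abs_divide)
      ultimately have "(\<lambda>n. \<bar>X n \<omega>\<bar> / T n \<omega>) \<longlonglongrightarrow> 0" by (simp only: eq)
      then have "(\<lambda>n. min (\<bar>X n \<omega>\<bar> / T n \<omega>) 1) \<longlonglongrightarrow> min 0 1" by (intro tendsto_intros)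
      then show ?case by (simp add: q_def)
    qed
  qed (use q01 in auto)
  then have qlim: "(\<lambda>n. expectation (q n)) \<longlonglongrightarrow> 0" by simp
  define \<delta> where "\<delta> = min 1 (\<epsilon> / (4 * (C + 1)))"
  have \<delta>: "0 < \<delta>" "\<delta> \<le> 1" using e C by (auto simp: \<delta>_def)
  have \<delta>C: "2 * (\<delta> * C) \<le> \<epsilon> / 2"
  proof -
    have "\<delta> * C \<le> \<epsilon> / (4 * (C + 1)) * (C + 1)"
      using C e by (intro mult_mono) (auto simp: \<delta>_def)
    also have "\<dots> = \<epsilon> / 4" using C by (simp add: field_simps)
    finally show ?thesis by simp
  qed
  \<comment> \<open>If the ratio is at most \<delta>, the first term suffices. Otherwise
    \<open>q n\<close> is at least \<delta>, and Young's inequality gives \<delta> X^2 + 1 / (4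
    \<delta>), whose constant is at most q / (4 \<delta>^2).\<close>
  have pw: "\<bar>X n \<omega>\<bar> \<le> \<delta> * T n \<omega> + \<delta> * (X n \<omega>)\<^sup>2 + q n \<omega> / (4 * \<delta> * \<delta>)" for n \<omega>
  proof (cases "\<bar>X n \<omega>\<bar> / T n \<omega> \<le> \<delta>")
    case True
    then have "\<bar>X n \<omega>\<bar> \<le> \<delta> * T n \<omega>" using T(3)[of n \<omega>] by (simp add: field_simps)
    moreover have "0 \<le> \<delta> * (X n \<omega>)\<^sup>2" "0 \<le> q n \<omega> / (4 * \<delta> * \<delta>)" using \<delta> q01 by auto
    ultimately show ?thesis by linarith
  next
    case False
    then have q: "\<delta> \<le> q n \<omega>" using \<delta> by (simp add: q_def)
    have "0 \<le> (2 * \<delta> * \<bar>X n \<omega>\<bar> - 1)\<^sup>2" by simp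
    moreover have "(2 * \<delta> * \<bar>X n \<omega>\<bar> - 1)\<^sup>2 = 4 * \<delta> * (\<delta> * (X n \<omega>)\<^sup>2) - 4 * \<delta> * \<bar>X n \<omega>\<bar> + 1"
      by (simp add: power2_eq_square algebra_simps)
    ultimately have "4 * \<delta> * \<bar>X n \<omega>\<bar> \<le> 4 * \<delta> * (\<delta> * (X n \<omega>)\<^sup>2) + 1" by linarith
    then have "\<bar>X n \<omega>\<bar> \<le> (4 * \<delta> * (\<delta> * (X n \<omega>)\<^sup>2) + 1) / (4 * \<delta>)"
      using \<delta> by (simp add: pos_le_divide_eq mult.commute)
    also have "\<dots> = \<delta> * (X n \<omega>)\<^sup>2 + \<delta> / (4 * \<delta> * \<delta>)" using \<delta> by (simp add: field_simps)
    also have "\<dots> \<le> \<delta> * (X n \<omega>)\<^sup>2 + q n \<omega> / (4 * \<delta> * \<delta>)"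
      using q \<delta> by (intro add_left_mono divide_right_mono) auto
    moreover have "0 \<le> \<delta> * T n \<omega>" using T(3)[of n \<omega>] \<delta> by simp
    ultimately show ?thesis by linarith
  qed
  have E: "\<bar>expectation (X n)\<bar> \<le> \<epsilon> / 2 + expectation (q n) / (4 * \<delta> * \<delta>)" for n
  proof -
    have i2: "integrable M (\<lambda>\<omega>. (X n \<omega>)\<^sup>2)" using X(1) by (simp add: square_integrable_def)
    have i1: "integrable M (X n)" by (rule square_integrable_imp_integrable[OF X(1)])
    have "\<bar>expectation (X n)\<bar> \<le> expectation (\<lambda>\<omega>. \<bar>X n \<omega>\<bar>)" by (rule integral_abs_bound)
    also have "\<dots> \<le> expectation (\<lambda>\<omega>. \<delta> * T n \<omega> + \<delta> * (X n \<omega>)\<^sup>2 + q n \<omega> / (4 * \<delta> * \<delta>))"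
      by (rule integral_mono) (use i1 i2 T(1) qint pw in auto)
    also have "\<dots> = \<delta> * expectation (T n) + \<delta> * expectation (\<lambda>\<omega>. (X n \<omega>)\<^sup>2) + expectation (q n) / (4 * \<delta> * \<delta>)"
      using i2 T(1) qint by simp
    also have "\<dots> \<le> \<delta> * C + \<delta> * C + expectation (q n) / (4 * \<delta> * \<delta>)"
      using T(2) X(2) \<delta> by (intro add_mono mult_left_mono) auto
    finally show ?thesis using \<delta>C by linarith
  qed
  have "(\<lambda>n. expectation (q n) / (4 * \<delta> * \<delta>)) \<longlonglongrightarrow> 0 / (4 * \<delta> * \<delta>)"
    by (intro tendsto_intros qlim) (use \<delta> in auto)
  then have "eventually (\<lambda>n. expectation (q n) / (4 * \<delta> * \<delta>) < \<epsilon> / 2) sequentially"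
    using e by (intro order_tendstoD(2)) auto
  then obtain n0 where n0: "\<And>n. n \<ge> n0 \<Longrightarrow> expectation (q n) / (4 * \<delta> * \<delta>) < \<epsilon> / 2"
    unfolding eventually_sequentially by blast
  show "\<exists>n0. \<forall>n\<ge>n0. norm (expectation (X n) - 0) < \<epsilon>"
    using E n0 by (intro exI[of _ n0]) (smt (verit) field_sum_of_halves real_norm_def)
qed

lemma riemann_sum_tendsto:
  fixes f :: "real \<Rightarrow> real"
  assumes f: "continuous_on {0..T} f" and T: "0 < T"
  shows "(\<lambda>n. T / real n * (\<Sum>i<n. f (real i * (T / real n)))) \<longlonglongrightarrow> integral {0..T} f"
proof (rule LIMSEQ_I)
  fix \<epsilon> :: real assume e: "0 < \<epsilon>"
  have "uniformly_continuous_on {0..T} f" using f compact_uniformly_continuous by auto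
  then obtain \<delta> where \<delta>: "\<delta> > 0" "\<And>s t. s \<in> {0..T} \<Longrightarrow> t \<in> {0..T} \<Longrightarrow> dist s t < \<delta> \<Longrightarrow> dist (f s) (f t) < \<epsilon> / (2 * T)"
    using e T unfolding uniformly_continuous_on_def by (metis dist_commute divide_pos_pos mult_pos_pos zero_less_numeral)
  show "\<exists>n0. \<forall>n\<ge>n0. norm (T / real n * (\<Sum>i<n. f (real i * (T / real n))) - integral {0..T} f) < \<epsilon>"
  proof (intro exI[of _ "Suc (nat \<lceil>T / \<delta>\<rceil>)"] allI impI)
    fix n assume n: "Suc (nat \<lceil>T / \<delta>\<rceil>) \<le> n"
    define h where "h = T / real n"
    have np: "0 < n" using n by simp
    have h: "0 < h" "real n * h = T" using np T by (auto simp: h_def)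
    have "T / \<delta> < real n" using n by linarith
    then have hd: "h < \<delta>" using \<delta> np by (simp add: h_def field_simps)
    have part: "\<bar>h * (\<Sum>i<k. f (real i * h)) - integral {0..real k * h} f\<bar> \<le> real k * h * (\<epsilon> / (2 * T))" if "k \<le> n" for k
      using that
    proof (induction k)
      case (Suc k)
      let ?s = "real k * h" and ?t = "real (Suc k) * h"
      have "?t \<le> real n * h" using Suc.prems h by (intro mult_right_mono) auto
      then have st: "0 \<le> ?s" "?s \<le> ?t" "?t - ?s = h" "?t \<le> T" using h by (auto simp: algebra_simps)
      have sub: "{?s..?t} \<subseteq> {0..T}" using st(1,4) by (meson atLeastatMost_subset_iff)
      have sub0: "{0..?t} \<subseteq> {0..T}" using st(4) by auto
      have comb: "integral {0..?t} f = integral {0..?s} f + integral {?s..?t} f"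
        by (rule Henstock_Kurzweil_Integration.integral_combine[symmetric])
           (use st sub0 in \<open>auto intro!: integrable_continuous_real continuous_on_subset[OF f]\<close>)
      have "h * f ?s - integral {?s..?t} f = integral {?s..?t} (\<lambda>u. f ?s - f u)"
        by (subst Henstock_Kurzweil_Integration.integral_diff)
           (use st(2,3) integrable_continuous_real[OF continuous_on_subset[OF f sub]] in \<open>auto simp del: of_nat_Suc\<close>)
      also have "norm \<dots> \<le> \<epsilon> / (2 * T) * (?t - ?s)"
      proof (rule integral_bound[OF st(2)])
        show "continuous_on {?s..?t} (\<lambda>u. f ?s - f u)"
          by (intro continuous_intros continuous_on_subset[OF f sub])
        fix u assume u: "u \<in> {?s..?t}"
        then have "u \<in> {0..T}" "?s \<in> {0..T}" using sub st(2) by auto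
        moreover have "dist ?s u < \<delta>" using u st hd by (auto simp: dist_real_def simp del: of_nat_Suc)
        ultimately show "norm (f ?s - f u) \<le> \<epsilon> / (2 * T)" using \<delta>(2)[of ?s u] by (simp add: dist_real_def)
      qed
      finally have "\<bar>h * f ?s - integral {?s..?t} f\<bar> \<le> \<epsilon> / (2 * T) * h" using st by simp
      moreover have "\<bar>h * (\<Sum>i<k. f (real i * h)) - integral {0..?s} f\<bar> \<le> ?s * (\<epsilon> / (2 * T))"
        using Suc by simp
      moreover have "?t * (\<epsilon> / (2 * T)) = ?s * (\<epsilon> / (2 * T)) + \<epsilon> / (2 * T) * h" by (simp add: algebra_simps add_divide_distrib)
      moreover have "h * (\<Sum>i<Suc k. f (real i * h)) = h * (\<Sum>i<k. f (real i * h)) + h * f ?s" by (simp add: algebra_simps)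
      ultimately show ?case unfolding comb by linarith
    qed simp
    have "\<bar>h * (\<Sum>i<n. f (real i * h)) - integral {0..T} f\<bar> \<le> T * (\<epsilon> / (2 * T))"
      using part[of n] h by simp
    also have "\<dots> < \<epsilon>" using T e by simp
    finally show "norm (T / real n * (\<Sum>i<n. f (real i * (T / real n))) - integral {0..T} f) < \<epsilon>" by (simp add: h_def)
  qed
qed

context reflected_sde
begin

lemma expectation_continuous:
  fixes \<phi> :: "real \<Rightarrow> real"
  assumes \<phi>: "continuous_on UNIV \<phi>" "\<And>u. \<bar>\<phi> u\<bar> \<le> C"
  shows "continuous_on {0..} (\<lambda>t. expectation (\<lambda>\<omega>. \<phi> (y t \<omega>)))"
  unfolding continuous_on_sequentially
proof (intro allI ballI impI, elim conjE)
  fix s t assume t: "t \<in> {0..}" and s: "\<forall>n. s n \<in> {0..}" and lim: "s \<longlonglongrightarrow> (t::real)"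
  have [measurable]: "\<phi> \<in> borel_measurable borel" by (rule borel_measurable_continuous_onI[OF \<phi>(1)])
  have [measurable]: "y (s n) \<in> borel_measurable M" "y t \<in> borel_measurable M" for n using s t by auto
  show "((\<lambda>t. expectation (\<lambda>\<omega>. \<phi> (y t \<omega>))) \<circ> s) \<longlonglongrightarrow> expectation (\<lambda>\<omega>. \<phi> (y t \<omega>))"
    unfolding o_def
  proof (rule integral_dominated_convergence[where w = "\<lambda>_. C"])
    show "AE \<omega> in M. (\<lambda>n. \<phi> (y (s n) \<omega>)) \<longlonglongrightarrow> \<phi> (y t \<omega>)"
      using AE_continuous
    proof eventually_elim
      case (elim \<omega>)
      then have "(\<lambda>n. y (s n) \<omega>) \<longlonglongrightarrow> y t \<omega>"
        using s t lim by (auto simp: continuous_on_sequentially o_def)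
      then show ?case using \<phi>(1) by (auto simp: continuous_on_eq_continuous_at isCont_def intro: continuous_within_tendsto_compose isCont_tendsto_compose)
    qed
  qed (use \<phi>(2) in auto)
qed

section \<open>The centred part of the expansion\<close>

context
  fixes G1 G2 :: "real \<Rightarrow> real" and G \<eta> :: real
  assumes G1: "continuous_on UNIV G1" "\<And>u. \<bar>G1 u\<bar> \<le> G" and G2: "continuous_on UNIV G2" "\<And>u. \<bar>G2 u\<bar> \<le> G"
    and \<eta>: "0 < \<eta>"
begin

text \<open>With noise dW / sqrt 2 the expansion contains g' dW / sqrt 2 + g'' dW^2 / 4. Here
  \<open>G1\<close> and \<open>G2\<close> stand for g' and g'', and the mean \<eta> / 4 of dW^2 / 4
  has been removed; the compensator joins the drift.\<close>

definition \<xi> :: "nat \<Rightarrow> 'a \<Rightarrow> real" where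
  "\<xi> i \<omega> = G1 (y (real i * \<eta>) \<omega>) * (dW \<eta> i \<omega> / sqrt 2) + G2 (y (real i * \<eta>) \<omega>) * (((dW \<eta> i \<omega>)\<^sup>2 - \<eta>) / 4)"

text \<open>The same term with the Euler scheme in place of the solution: a function of finitely
  many fine increments, unlike \<open>\<xi>\<close>, and converging to it.\<close>

definition \<xi>' :: "nat \<Rightarrow> nat \<Rightarrow> 'a \<Rightarrow> real" where
  "\<xi>' m i \<omega> = G1 (approx (\<eta> / real (Suc m)) (i * Suc m) \<omega>) * (dW \<eta> i \<omega> / sqrt 2)
     + G2 (approx (\<eta> / real (Suc m)) (i * Suc m) \<omega>) * (((dW \<eta> i \<omega>)\<^sup>2 - \<eta>) / 4)"

definition \<xi>b :: "nat \<Rightarrow> 'a \<Rightarrow> real" where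
  "\<xi>b i \<omega> = G * (\<bar>dW \<eta> i \<omega>\<bar> + ((dW \<eta> i \<omega>)\<^sup>2 + \<eta>))"

lemma G_nonneg: "0 \<le> G" using G1(2)[of 0] by simp

lemma G_measurable: "G1 \<in> borel_measurable borel" "G2 \<in> borel_measurable borel"
  by (auto intro: borel_measurable_continuous_onI G1 G2)

lemma y_grid_measurable: "y (real i * \<eta>) \<in> borel_measurable M" "dW \<eta> i \<in> borel_measurable M"
  using \<eta> by auto

lemma \<xi>b_sq: "square_integrable M (\<xi>b i)"
proof -
  have "square_integrable M (\<lambda>\<omega>. \<bar>dW \<eta> i \<omega>\<bar>)" "square_integrable M (\<lambda>\<omega>. (dW \<eta> i \<omega>)\<^sup>2)" "square_integrable M (\<lambda>\<omega>. \<eta>)"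
    using dW_square_integrable[OF \<eta>, of i 1] dW_square_integrable[OF \<eta>, of i 2] by (auto simp: square_integrable_def)
  then show ?thesis unfolding \<xi>b_def by (intro square_integrable_cmult square_integrable_add)
qed

lemma combination_bound:
  "\<bar>G1 u * (w / sqrt 2) + G2 u * ((w\<^sup>2 - \<eta>) / 4)\<bar> \<le> G * (\<bar>w\<bar> + (w\<^sup>2 + \<eta>))"
proof -
  have s2: "1 \<le> sqrt (2::real)" by simp
  have "\<bar>w / sqrt 2\<bar> \<le> \<bar>w\<bar>"
    using s2 by (simp add: abs_divide divide_le_eq mult_le_cancel_left1 split: if_splits)
  then have h1: "\<bar>G1 u * (w / sqrt 2)\<bar> \<le> G * \<bar>w\<bar>"
    unfolding abs_mult using G1(2) G_nonneg by (intro mult_mono) auto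
  have "\<bar>(w\<^sup>2 - \<eta>) / 4\<bar> \<le> w\<^sup>2 + \<eta>" using \<eta> by (simp add: abs_if field_simps)
  then have h2: "\<bar>G2 u * ((w\<^sup>2 - \<eta>) / 4)\<bar> \<le> G * (w\<^sup>2 + \<eta>)"
    unfolding abs_mult using G2(2) G_nonneg by (intro mult_mono) auto
  show ?thesis
    unfolding distrib_left[of G "\<bar>w\<bar>"] by (rule order_trans[OF abs_triangle_ineq add_mono[OF h1 h2]])
qed

lemma \<xi>_bound: "\<bar>\<xi> i \<omega>\<bar> \<le> \<xi>b i \<omega>" "\<bar>\<xi>' m i \<omega>\<bar> \<le> \<xi>b i \<omega>"
  unfolding \<xi>_def \<xi>'_def \<xi>b_def by (rule combination_bound)+

lemma \<xi>_measurable: "\<xi> i \<in> borel_measurable M"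
  supply G_measurable [measurable] y_grid_measurable [measurable]
  unfolding \<xi>_def by measurable

lemma \<xi>_sq: "square_integrable M (\<xi> i)"
  by (rule square_integrable_bound[OF \<xi>b_sq[of i]]) (auto simp: \<xi>_bound \<xi>_measurable)

lemma \<xi>'_past: "i < k \<Longrightarrow> \<xi>' m i \<in> borel_measurable (past (\<eta> / real (Suc m)) (k * Suc m))"
proof -
  assume i: "i < k"
  have [measurable]: "approx (\<eta> / real (Suc m)) (i * Suc m) \<in> borel_measurable (past (\<eta> / real (Suc m)) (k * Suc m))"
    by (rule approx_past) (use i in \<open>intro mult_le_mono1, simp\<close>)
  have [measurable]: "dW \<eta> i \<in> borel_measurable (past (\<eta> / real (Suc m)) (k * Suc m))"
    by (rule past_refine[OF i])
  note [measurable] = G_measurable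
  show ?thesis unfolding \<xi>'_def by measurable
qed

lemma AE_\<xi>': "AE \<omega> in M. \<forall>i. (\<lambda>m. \<xi>' m i \<omega>) \<longlonglongrightarrow> \<xi> i \<omega>"
  using AE_approx[OF \<eta>]
proof eventually_elim
  case (elim \<omega>)
  show ?case
  proof (rule allI)
    fix i
    have c: "(\<lambda>m. \<phi> (approx (\<eta> / real (Suc m)) (i * Suc m) \<omega>)) \<longlonglongrightarrow> \<phi> (y (real i * \<eta>) \<omega>)"
      if "continuous_on UNIV \<phi>" for \<phi> :: "real \<Rightarrow> real"
      by (rule continuous_on_tendsto_compose[OF that]) (use elim in auto)
    show "(\<lambda>m. \<xi>' m i \<omega>) \<longlonglongrightarrow> \<xi> i \<omega>"
      unfolding \<xi>_def \<xi>'_def by (intro tendsto_intros c G1 G2)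
  qed
qed

lemma increment_functions:
  "square_integrable M (\<lambda>\<omega>. dW \<eta> k \<omega> / sqrt 2)" "expectation (\<lambda>\<omega>. dW \<eta> k \<omega> / sqrt 2) = 0"
  "square_integrable M (\<lambda>\<omega>. ((dW \<eta> k \<omega>)\<^sup>2 - \<eta>) / 4)" "expectation (\<lambda>\<omega>. ((dW \<eta> k \<omega>)\<^sup>2 - \<eta>) / 4) = 0"
  "expectation (\<lambda>\<omega>. ((dW \<eta> k \<omega>)\<^sup>2 - \<eta>)\<^sup>2) = 2 * \<eta>\<^sup>2" "integrable M (\<lambda>\<omega>. ((dW \<eta> k \<omega>)\<^sup>2 - \<eta>)\<^sup>2)"
proof -
  note m = dW_moments[OF \<eta>, of k]
  show "square_integrable M (\<lambda>\<omega>. dW \<eta> k \<omega> / sqrt 2)"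
    using square_integrable_cmult[OF dW_square_integrable[OF \<eta>, of k 1], of "1 / sqrt 2"] by simp
  show "expectation (\<lambda>\<omega>. dW \<eta> k \<omega> / sqrt 2) = 0" using m(2) by simp
  have sd: "square_integrable M (\<lambda>\<omega>. (dW \<eta> k \<omega>)\<^sup>2 - \<eta>)"
    by (rule square_integrable_diff[OF dW_square_integrable[OF \<eta>, of k 2]]) (simp add: square_integrable_def)
  show "square_integrable M (\<lambda>\<omega>. ((dW \<eta> k \<omega>)\<^sup>2 - \<eta>) / 4)"
    using square_integrable_cmult[OF sd, of "1 / 4"] by simp
  show "expectation (\<lambda>\<omega>. ((dW \<eta> k \<omega>)\<^sup>2 - \<eta>) / 4) = 0" using m(1)[of 2] m(3) by (simp add: prob_space)
  show "integrable M (\<lambda>\<omega>. ((dW \<eta> k \<omega>)\<^sup>2 - \<eta>)\<^sup>2)" using sd by (simp add: square_integrable_def)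
  have "expectation (\<lambda>\<omega>. ((dW \<eta> k \<omega>)\<^sup>2 - \<eta>)\<^sup>2) = expectation (\<lambda>\<omega>. dW \<eta> k \<omega> ^ 4 - 2 * \<eta> * (dW \<eta> k \<omega>)\<^sup>2 + \<eta>\<^sup>2)"
    by (rule Bochner_Integration.integral_cong) (auto simp: power2_diff algebra_simps power_mult[symmetric] simp flip: power_mult)
  also have "\<dots> = 3 * \<eta>\<^sup>2 - 2 * \<eta> * \<eta> + \<eta>\<^sup>2"
    using m(1)[of 4] m(1)[of 2] m(3,4) by (simp add: prob_space)
  finally show "expectation (\<lambda>\<omega>. ((dW \<eta> k \<omega>)\<^sup>2 - \<eta>)\<^sup>2) = 2 * \<eta>\<^sup>2" by (simp add: power2_eq_square)
qed

text \<open>Each summand of \<open>\<xi>\<close> is a bounded function of the position times a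
  centred function of the increment. The bounded factor is merged with the past variable, and
  \<open>orthogonal_increment\<close> is applied to u / sqrt 2 and to (u^2 - \<eta>) / 4.\<close>

lemma orthogonal_\<xi>:
  assumes X: "\<And>m. X m \<in> borel_measurable (past (\<eta> / real (Suc m)) (k * Suc m))"
    and X0 [measurable]: "X0 \<in> borel_measurable M" and lim: "AE \<omega> in M. (\<lambda>m. X m \<omega>) \<longlonglongrightarrow> X0 \<omega>"
    and D: "square_integrable M D" "\<And>m \<omega>. \<bar>X m \<omega>\<bar> \<le> D \<omega>"
  shows "integrable M (\<lambda>\<omega>. X0 \<omega> * \<xi> k \<omega>)" "expectation (\<lambda>\<omega>. X0 \<omega> * \<xi> k \<omega>) = 0"
proof -
  have ap: "approx (\<eta> / real (Suc m)) (k * Suc m) \<in> borel_measurable (past (\<eta> / real (Suc m)) (k * Suc m))" for m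
    by (rule approx_past) simp
  have GD: "square_integrable M (\<lambda>\<omega>. G * D \<omega>)" by (rule square_integrable_cmult[OF D(1)])
  have bd: "\<bar>X m \<omega> * c\<bar> \<le> G * D \<omega>" if "\<bar>c\<bar> \<le> G" for m \<omega> c
    unfolding abs_mult using D(2)[of m \<omega>] that G_nonneg by (subst mult.commute) (intro mult_mono, auto)
  have o: "integrable M (\<lambda>\<omega>. (X0 \<omega> * \<phi> (y (real k * \<eta>) \<omega>)) * f (dW \<eta> k \<omega>)) \<and>
      expectation (\<lambda>\<omega>. (X0 \<omega> * \<phi> (y (real k * \<eta>) \<omega>)) * f (dW \<eta> k \<omega>)) = 0"
    if \<phi>: "continuous_on UNIV \<phi>" "\<And>u. \<bar>\<phi> u\<bar> \<le> G"
      and f: "f \<in> borel_measurable borel" "square_integrable M (\<lambda>\<omega>. f (dW \<eta> k \<omega>))" "expectation (\<lambda>\<omega>. f (dW \<eta> k \<omega>)) = 0"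
    for \<phi> f :: "real \<Rightarrow> real"
  proof -
    have \<phi>m [measurable]: "\<phi> \<in> borel_measurable borel" by (rule borel_measurable_continuous_onI[OF \<phi>(1)])
    have p1: "(\<lambda>\<omega>. X m \<omega> * \<phi> (approx (\<eta> / real (Suc m)) (k * Suc m) \<omega>)) \<in> borel_measurable (past (\<eta> / real (Suc m)) (k * Suc m))" for m
      by (intro borel_measurable_times X measurable_compose[OF ap \<phi>m])
    note [measurable] = y_grid_measurable
    have p2: "(\<lambda>\<omega>. X0 \<omega> * \<phi> (y (real k * \<eta>) \<omega>)) \<in> borel_measurable M" by measurable
    have p3: "AE \<omega> in M. (\<lambda>m. X m \<omega> * \<phi> (approx (\<eta> / real (Suc m)) (k * Suc m) \<omega>)) \<longlonglongrightarrow> X0 \<omega> * \<phi> (y (real k * \<eta>) \<omega>)"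
      using lim AE_approx[OF \<eta>]
    proof eventually_elim
      case (elim \<omega>)
      have "(\<lambda>m. \<phi> (approx (\<eta> / real (Suc m)) (k * Suc m) \<omega>)) \<longlonglongrightarrow> \<phi> (y (real k * \<eta>) \<omega>)"
        by (rule continuous_on_tendsto_compose[OF \<phi>(1)]) (use elim(2) in auto)
      then show ?case by (intro tendsto_mult elim(1))
    qed
    have p4: "AE \<omega> in M. \<bar>X m \<omega> * \<phi> (approx (\<eta> / real (Suc m)) (k * Suc m) \<omega>)\<bar> \<le> G * D \<omega>" for m
      by (intro AE_I2 bd \<phi>)
    show ?thesis
      using orthogonal_increment[OF \<eta> p1 p2 p3 GD p4 f] by simp
  qed
  have o1: "integrable M (\<lambda>\<omega>. (X0 \<omega> * G1 (y (real k * \<eta>) \<omega>)) * (dW \<eta> k \<omega> / sqrt 2))"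
      "expectation (\<lambda>\<omega>. (X0 \<omega> * G1 (y (real k * \<eta>) \<omega>)) * (dW \<eta> k \<omega> / sqrt 2)) = 0"
    using o[OF G1, of "\<lambda>u. u / sqrt 2"] increment_functions(1,2)[of k] by simp_all
  have o2: "integrable M (\<lambda>\<omega>. (X0 \<omega> * G2 (y (real k * \<eta>) \<omega>)) * (((dW \<eta> k \<omega>)\<^sup>2 - \<eta>) / 4))"
      "expectation (\<lambda>\<omega>. (X0 \<omega> * G2 (y (real k * \<eta>) \<omega>)) * (((dW \<eta> k \<omega>)\<^sup>2 - \<eta>) / 4)) = 0"
    using o[OF G2, of "\<lambda>u. (u\<^sup>2 - \<eta>) / 4"] increment_functions(3,4)[of k] by simp_all
  have eq: "(\<lambda>\<omega>. X0 \<omega> * \<xi> k \<omega>) = (\<lambda>\<omega>. (X0 \<omega> * G1 (y (real k * \<eta>) \<omega>)) * (dW \<eta> k \<omega> / sqrt 2) + (X0 \<omega> * G2 (y (real k * \<eta>) \<omega>)) * (((dW \<eta> k \<omega>)\<^sup>2 - \<eta>) / 4))"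
    by (simp add: \<xi>_def fun_eq_iff distrib_left mult.assoc)
  show "integrable M (\<lambda>\<omega>. X0 \<omega> * \<xi> k \<omega>)" unfolding eq by (intro Bochner_Integration.integrable_add o1 o2)
  show "expectation (\<lambda>\<omega>. X0 \<omega> * \<xi> k \<omega>) = 0" unfolding eq using o1 o2 by (subst Bochner_Integration.integral_add) auto
qed

lemma \<xi>_mean: "expectation (\<xi> k) = 0"
proof -
  have "expectation (\<lambda>\<omega>. 1 * \<xi> k \<omega>) = 0"
    by (rule orthogonal_\<xi>(2)[where X = "\<lambda>_ _. 1" and D = "\<lambda>_. 1"]) (auto simp: square_integrable_def)
  then show ?thesis by (simp only: mult_1)
qed

lemma \<xi>_second_moment: "expectation (\<lambda>\<omega>. (\<xi> k \<omega>)\<^sup>2) \<le> G\<^sup>2 * (\<eta> + 2 * \<eta>\<^sup>2)"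
proof -
  have pw: "(\<xi> k \<omega>)\<^sup>2 \<le> G\<^sup>2 * ((dW \<eta> k \<omega>)\<^sup>2 + ((dW \<eta> k \<omega>)\<^sup>2 - \<eta>)\<^sup>2)" for \<omega>
  proof -
    define A where "A = G1 (y (real k * \<eta>) \<omega>)"
    define C where "C = G2 (y (real k * \<eta>) \<omega>)"
    define w where "w = dW \<eta> k \<omega>"
    have A: "A\<^sup>2 \<le> G\<^sup>2" and C: "C\<^sup>2 \<le> G\<^sup>2"
      using G1(2) G2(2) G_nonneg by (auto simp: A_def C_def abs_le_square_iff[symmetric])
    have "(A * (w / sqrt 2) + C * ((w\<^sup>2 - \<eta>) / 4))\<^sup>2 \<le> 2 * (A * (w / sqrt 2))\<^sup>2 + 2 * (C * ((w\<^sup>2 - \<eta>) / 4))\<^sup>2"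
      using sum_squares_bound[of "A * (w / sqrt 2)" "C * ((w\<^sup>2 - \<eta>) / 4)"] by (simp add: power2_sum)
    also have "\<dots> = A\<^sup>2 * w\<^sup>2 + C\<^sup>2 * ((w\<^sup>2 - \<eta>)\<^sup>2 / 8)"
      by (simp add: power_mult_distrib power_divide)
    also have "\<dots> \<le> G\<^sup>2 * w\<^sup>2 + G\<^sup>2 * (w\<^sup>2 - \<eta>)\<^sup>2"
      using A C by (intro add_mono mult_mono) auto
    finally show ?thesis by (simp add: \<xi>_def A_def C_def w_def distrib_left)
  qed
  have "expectation (\<lambda>\<omega>. (\<xi> k \<omega>)\<^sup>2) \<le> expectation (\<lambda>\<omega>. G\<^sup>2 * ((dW \<eta> k \<omega>)\<^sup>2 + ((dW \<eta> k \<omega>)\<^sup>2 - \<eta>)\<^sup>2))"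
    by (rule integral_mono)
       (use \<xi>_sq[of k] dW_moments(1)[OF \<eta>, of k 2] increment_functions(6)[of k] pw in \<open>auto simp: square_integrable_def\<close>)
  also have "\<dots> = G\<^sup>2 * (\<eta> + 2 * \<eta>\<^sup>2)"
    using dW_moments(1)[OF \<eta>, of k 2] dW_moments(3)[OF \<eta>, of k] increment_functions(5,6)[of k] by simp
  finally show ?thesis .
qed

text \<open>Orthogonality removes the cross terms, so second moments add. With n * \<eta> fixed the
  bound survives the refinement of the grid. In the cross term the past sum is approximated by sums
  of \<open>\<xi>'\<close>.\<close>

lemma \<xi>_sum:
  "square_integrable M (\<lambda>\<omega>. \<Sum>i<n. \<xi> i \<omega>)" "expectation (\<lambda>\<omega>. \<Sum>i<n. \<xi> i \<omega>) = 0"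
  "expectation (\<lambda>\<omega>. (\<Sum>i<n. \<xi> i \<omega>)\<^sup>2) \<le> real n * (G\<^sup>2 * (\<eta> + 2 * \<eta>\<^sup>2))"
proof -
  show sq: "square_integrable M (\<lambda>\<omega>. \<Sum>i<n. \<xi> i \<omega>)" for n by (intro square_integrable_sum \<xi>_sq)
  show "expectation (\<lambda>\<omega>. \<Sum>i<n. \<xi> i \<omega>) = 0"
    using square_integrable_imp_integrable[OF \<xi>_sq] \<xi>_mean by simp
  show "expectation (\<lambda>\<omega>. (\<Sum>i<n. \<xi> i \<omega>)\<^sup>2) \<le> real n * (G\<^sup>2 * (\<eta> + 2 * \<eta>\<^sup>2))"
  proof (induction n)
    case (Suc n)
    let ?S = "\<lambda>\<omega>. \<Sum>i<n. \<xi> i \<omega>"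
    have c1: "(\<lambda>\<omega>. \<Sum>i<n. \<xi>' m i \<omega>) \<in> borel_measurable (past (\<eta> / real (Suc m)) (n * Suc m))" for m
      by (intro borel_measurable_sum \<xi>'_past) simp
    have c2: "?S \<in> borel_measurable M" by (intro borel_measurable_sum \<xi>_measurable)
    have c3: "AE \<omega> in M. (\<lambda>m. \<Sum>i<n. \<xi>' m i \<omega>) \<longlonglongrightarrow> ?S \<omega>"
      using AE_\<xi>' by eventually_elim (intro tendsto_sum, blast)
    have c4: "square_integrable M (\<lambda>\<omega>. \<Sum>i<n. \<xi>b i \<omega>)" by (intro square_integrable_sum \<xi>b_sq)
    have c5: "\<bar>\<Sum>i<n. \<xi>' m i \<omega>\<bar> \<le> (\<Sum>i<n. \<xi>b i \<omega>)" for m \<omega>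
      by (rule order_trans[OF sum_abs sum_mono]) (rule \<xi>_bound)
    note cross = orthogonal_\<xi>[OF c1 c2 c3 c4 c5]
    have i: "integrable M (\<lambda>\<omega>. (?S \<omega>)\<^sup>2)" "integrable M (\<lambda>\<omega>. (\<xi> n \<omega>)\<^sup>2)"
      using sq[of n] \<xi>_sq[of n] by (auto simp: square_integrable_def)
    have "expectation (\<lambda>\<omega>. (\<Sum>i<Suc n. \<xi> i \<omega>)\<^sup>2) = expectation (\<lambda>\<omega>. (?S \<omega>)\<^sup>2 + 2 * (?S \<omega> * \<xi> n \<omega>) + (\<xi> n \<omega>)\<^sup>2)"
      by (simp add: power2_sum algebra_simps)
    also have "\<dots> = expectation (\<lambda>\<omega>. (?S \<omega>)\<^sup>2) + expectation (\<lambda>\<omega>. (\<xi> n \<omega>)\<^sup>2)"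
      using cross i by simp
    also have "\<dots> \<le> real n * (G\<^sup>2 * (\<eta> + 2 * \<eta>\<^sup>2)) + G\<^sup>2 * (\<eta> + 2 * \<eta>\<^sup>2)"
      by (intro add_mono Suc.IH \<xi>_second_moment)
    finally show ?case by (simp add: algebra_simps)
  qed simp
qed

end


text \<open>In the mean of the pathwise expansion the terms \<open>\<xi>\<close> vanish, the drift
  terms form a Riemann sum, and the remainder disappears by \<open>expectation_tendsto_zero\<close>.
  The factor 1 / 4 is half the squared diffusion coefficient. Evaluating at \<open>max l u\<close>
  makes \<open>gen\<close> continuous on the whole line. \<open>g\<close> itself may be unbounded,
  which is why square integrability of its terminal value is assumed.\<close>

theorem ito_expectation:
  fixes g g' g'' :: "real \<Rightarrow> real"
  assumes g: "\<And>x. l \<le> x \<Longrightarrow> (g has_real_derivative g' x) (at x within {l..})"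
    and g': "\<And>x. l \<le> x \<Longrightarrow> (g' has_real_derivative g'' x) (at x within {l..})"
    and g''_cont: "continuous_on {l..} g''"
    and bnd: "\<And>x. l \<le> x \<Longrightarrow> \<bar>g' x\<bar> \<le> G" "\<And>x. l \<le> x \<Longrightarrow> \<bar>g'' x\<bar> \<le> G" "\<And>x. l \<le> x \<Longrightarrow> \<bar>b x * g' x\<bar> \<le> G"
    and neumann: "g' l = 0" and T: "0 < T"
    and sq: "square_integrable M (\<lambda>\<omega>. g (y T \<omega>))"
  defines "gen \<equiv> \<lambda>u. b (max l u) * g' (max l u) + g'' (max l u) / 4"
  shows "expectation (\<lambda>\<omega>. g (y T \<omega>)) = g y0 + integral {0..T} (\<lambda>s. expectation (\<lambda>\<omega>. gen (y s \<omega>)))"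
proof -
  define G1 where "G1 u = g' (max l u)" for u
  define G2 where "G2 u = g'' (max l u)" for u
  have mx: "continuous_on UNIV (\<lambda>u. max l u)" by (intro continuous_intros)
  have ext: "continuous_on UNIV (\<lambda>u. \<phi> (max l u))" if "continuous_on {l..} \<phi>" for \<phi> :: "real \<Rightarrow> real"
    by (rule continuous_on_compose2[OF that mx]) auto
  have g'c: "continuous_on {l..} g'" by (rule DERIV_continuous_on[OF g']) auto
  have G1: "continuous_on UNIV G1" "\<And>u. \<bar>G1 u\<bar> \<le> G" and G2: "continuous_on UNIV G2" "\<And>u. \<bar>G2 u\<bar> \<le> G"
    using ext[OF g'c] ext[OF g''_cont] bnd by (auto simp: G1_def[abs_def] G2_def[abs_def])
  have bc: "continuous_on {l..} b"
    unfolding b_def using l_pos by (intro continuous_intros) auto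
  have gen_c: "continuous_on UNIV gen"
    unfolding gen_def by (intro continuous_intros ext[OF bc] ext[OF g'c] ext[OF g''_cont]) auto
  have "\<bar>p + q / 4\<bar> \<le> 2 * G" if "\<bar>p\<bar> \<le> G" "\<bar>q\<bar> \<le> G" for p q :: real
    using that by arith
  then have gen_b: "\<bar>gen u\<bar> \<le> 2 * G" for u
    unfolding gen_def using bnd(3)[of "max l u"] bnd(2)[of "max l u"] by simp
  have [measurable]: "gen \<in> borel_measurable borel" by (rule borel_measurable_continuous_onI[OF gen_c])
  have G0: "0 \<le> G" using bnd(1)[of l] by simp
  define h where "h n = T / real (Suc n)" for n
  have h: "0 < h n" "real (Suc n) * h n = T" for n using T by (auto simp: h_def)
  have hT: "h n \<le> T" for n using T by (simp add: h_def field_simps)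
  define \<Xi> where "\<Xi> n = \<xi> G1 G2 (h n)" for n
  define X where "X n \<omega> = (g (y T \<omega>) - g y0) - (\<Sum>i<Suc n. \<Xi> n i \<omega>) - h n * (\<Sum>i<Suc n. gen (y (real i * h n) \<omega>))" for n \<omega>
  note remainder_def = X_def
  define Q where "Q n \<omega> = 1 + (\<Sum>i<Suc n. (dW (h n) i \<omega> / sqrt 2)\<^sup>2)" for n \<omega>
  have [measurable]: "y (real i * h n) \<in> borel_measurable M" for i n using h(1)[of n] by auto
  note \<Xi>s = \<xi>_sum[OF G1 G2 h(1), folded \<Xi>_def]
  define R where "R n \<omega> = h n * (\<Sum>i<Suc n. gen (y (real i * h n) \<omega>))" for n \<omega>
  have [measurable]: "R n \<in> borel_measurable M" for n unfolding R_def by measurable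
  have R_b: "\<bar>R n \<omega>\<bar> \<le> 2 * G * T" for n \<omega>
  proof -
    have "\<bar>\<Sum>i<Suc n. gen (y (real i * h n) \<omega>)\<bar> \<le> real (card {..<Suc n}) * (2 * G)"
      by (rule order_trans[OF sum_abs sum_bounded_above]) (rule gen_b)
    then have "h n * \<bar>\<Sum>i<Suc n. gen (y (real i * h n) \<omega>)\<bar> \<le> h n * (real (Suc n) * (2 * G))"
      using h(1)[of n] by (intro mult_left_mono) auto
    also have "\<dots> = (real (Suc n) * h n) * (2 * G)" by (simp add: mult_ac)
    finally show ?thesis using h(1)[of n] unfolding h(2) R_def by (simp add: abs_mult mult_ac)
  qed
  have R_sq: "square_integrable M (R n)" for n
    by (rule square_integrable_bound[where f = "\<lambda>_. 2 * G * T"]) (use R_b in \<open>auto simp: square_integrable_def\<close>)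
  have g_sq: "square_integrable M (\<lambda>\<omega>. g (y T \<omega>) - g y0)"
    by (rule square_integrable_diff[OF sq]) (simp add: square_integrable_def)
  have X_eq: "X n = (\<lambda>\<omega>. (g (y T \<omega>) - g y0) - (\<Sum>i<Suc n. \<Xi> n i \<omega>) - R n \<omega>)" for n
    by (simp add: X_def R_def fun_eq_iff)
  have X_sq: "square_integrable M (X n)" for n
    unfolding X_eq by (intro square_integrable_diff g_sq \<Xi>s(1) R_sq)
  define C0 where "C0 = expectation (\<lambda>\<omega>. (g (y T \<omega>) - g y0)\<^sup>2)"
  have C00: "0 \<le> C0" by (simp add: C0_def)
  \<comment> \<open>Three second moments with the factor 3 from the square of a sum of three terms;
    the summand 1 + T makes the same constant bound the mean of \<open>Q\<close>.\<close>
  define C where "C = 3 * C0 + 3 * (T * (G\<^sup>2 * (1 + 2 * T))) + 3 * (2 * G * T)\<^sup>2 + (1 + T)"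
  have X2: "expectation (\<lambda>\<omega>. (X n \<omega>)\<^sup>2) \<le> C" for n
  proof -
    have sq3: "(p - q - s)\<^sup>2 \<le> 3 * p\<^sup>2 + 3 * q\<^sup>2 + 3 * s\<^sup>2" for p q s :: real
    proof -
      have "0 \<le> (p + q)\<^sup>2 + (p + s)\<^sup>2 + (q - s)\<^sup>2" by simp
      then show ?thesis by (simp add: power2_eq_square algebra_simps)
    qed
    have i: "integrable M (\<lambda>\<omega>. (g (y T \<omega>) - g y0)\<^sup>2)" "integrable M (\<lambda>\<omega>. (\<Sum>i<Suc n. \<Xi> n i \<omega>)\<^sup>2)" "integrable M (\<lambda>\<omega>. (R n \<omega>)\<^sup>2)" "integrable M (\<lambda>\<omega>. (X n \<omega>)\<^sup>2)"
      using g_sq \<Xi>s(1)[of n "Suc n"] R_sq[of n] X_sq[of n] by (auto simp only: square_integrable_def)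
    have Rb2: "(R n \<omega>)\<^sup>2 \<le> (2 * G * T)\<^sup>2" for \<omega>
      using R_b[of n \<omega>] G0 T by (simp add: abs_le_square_iff[symmetric] abs_mult)
    have "expectation (\<lambda>\<omega>. (X n \<omega>)\<^sup>2) \<le> expectation (\<lambda>\<omega>. 3 * (g (y T \<omega>) - g y0)\<^sup>2 + 3 * (\<Sum>i<Suc n. \<Xi> n i \<omega>)\<^sup>2 + 3 * (R n \<omega>)\<^sup>2)"
      by (rule integral_mono[OF i(4)]) (use i(1-3) sq3 in \<open>auto simp only: X_eq intro!: Bochner_Integration.integrable_add integrable_mult_right\<close>)
    also have "\<dots> = 3 * C0 + 3 * expectation (\<lambda>\<omega>. (\<Sum>i<Suc n. \<Xi> n i \<omega>)\<^sup>2) + 3 * expectation (\<lambda>\<omega>. (R n \<omega>)\<^sup>2)"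
      using i(1-3) by (simp add: C0_def del: sum.lessThan_Suc)
    also have "\<dots> \<le> 3 * C0 + 3 * (T * (G\<^sup>2 * (1 + 2 * T))) + 3 * (2 * G * T)\<^sup>2"
    proof (intro add_mono mult_left_mono order.refl)
      have "expectation (\<lambda>\<omega>. (\<Sum>i<Suc n. \<Xi> n i \<omega>)\<^sup>2) \<le> real (Suc n) * (G\<^sup>2 * (h n + 2 * (h n)\<^sup>2))" by (rule \<Xi>s(3))
      also have "\<dots> = (real (Suc n) * h n) * (G\<^sup>2 * (1 + 2 * h n))" by (simp add: power2_eq_square algebra_simps)
      also have "\<dots> \<le> T * (G\<^sup>2 * (1 + 2 * T))" unfolding h(2) using hT[of n] T by (intro mult_left_mono) auto
      finally show "expectation (\<lambda>\<omega>. (\<Sum>i<Suc n. \<Xi> n i \<omega>)\<^sup>2) \<le> T * (G\<^sup>2 * (1 + 2 * T))" .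
      have "expectation (\<lambda>\<omega>. (R n \<omega>)\<^sup>2) \<le> expectation (\<lambda>\<omega>. (2 * G * T)\<^sup>2)"
        by (rule integral_mono[OF i(3)]) (use Rb2 in auto)
      then show "expectation (\<lambda>\<omega>. (R n \<omega>)\<^sup>2) \<le> (2 * G * T)\<^sup>2" by (simp add: prob_space)
    qed auto
    finally show ?thesis using T by (simp add: C_def)
  qed
  have Q_int: "integrable M (Q n)" "expectation (Q n) \<le> C" for n
  proof -
    have i: "integrable M (\<lambda>\<omega>. (dW (h n) i \<omega> / sqrt 2)\<^sup>2)" for i
      using dW_moments(1)[OF h(1), of n i 2] by (simp add: power_divide)
    have e: "expectation (\<lambda>\<omega>. (dW (h n) i \<omega> / sqrt 2)\<^sup>2) = h n / 2" for i
      using dW_moments(3)[OF h(1), of n i] by (simp add: power_divide)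
    show "integrable M (Q n)" unfolding Q_def using i by auto
    have "expectation (Q n) = 1 + (\<Sum>i<Suc n. h n / 2)"
      unfolding Q_def using i by (simp add: prob_space e del: sum.lessThan_Suc)
    also have "\<dots> = 1 + (real (Suc n) * h n) / 2" by (simp only: sum_constant card_lessThan times_divide_eq_right)
    also have "\<dots> = 1 + T / 2" by (simp only: h(2))
    also have "\<dots> \<le> C" using C00 T by (simp add: C_def add_nonneg_nonneg)
    finally show "expectation (Q n) \<le> C" .
  qed
  have Q1: "1 \<le> Q n \<omega>" for n \<omega> by (simp add: Q_def sum_nonneg del: sum.lessThan_Suc)
  have "AE \<omega> in M. (\<lambda>n. X n \<omega> / Q n \<omega>) \<longlonglongrightarrow> 0"
    using AE_path
  proof eventually_elim
    case (elim \<omega>)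
    then have "reflected_path l y0 B b (\<lambda>t. W t \<omega> / sqrt 2) (\<lambda>t. y t \<omega>) (\<lambda>t. r * L t \<omega>)"
      and y00: "y 0 \<omega> = y0" and Kc: "continuous_on {0..} (\<lambda>t. r * L t \<omega>)" by auto
    then interpret reflected_path l y0 B b "\<lambda>t. W t \<omega> / sqrt 2" "\<lambda>t. y t \<omega>" "\<lambda>t. r * L t \<omega>" by simp
    have gi: "g' (y (real i * h n) \<omega>) = G1 (y (real i * h n) \<omega>)" "g'' (y (real i * h n) \<omega>) = G2 (y (real i * h n) \<omega>)"
      "gen (y (real i * h n) \<omega>) = b (y (real i * h n) \<omega>) * G1 (y (real i * h n) \<omega>) + G2 (y (real i * h n) \<omega>) / 4" for i n
      using y_ge[of "real i * h n"] h(1)[of n] by (auto simp: G1_def G2_def gen_def max_def)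
    have Xr: "X n \<omega> = g (y T \<omega>) - g (y 0 \<omega>) - (\<Sum>i<Suc n. g' (y (real i * h n) \<omega>) * (W (real (Suc i) * h n) \<omega> / sqrt 2 - W (real i * h n) \<omega> / sqrt 2)
      + g'' (y (real i * h n) \<omega>) * (W (real (Suc i) * h n) \<omega> / sqrt 2 - W (real i * h n) \<omega> / sqrt 2)\<^sup>2 / 2
      + b (y (real i * h n) \<omega>) * g' (y (real i * h n) \<omega>) * h n)" for n
    proof -
      have E: "(\<Sum>i<Suc n. g' (y (real i * h n) \<omega>) * (W (real (Suc i) * h n) \<omega> / sqrt 2 - W (real i * h n) \<omega> / sqrt 2)
        + g'' (y (real i * h n) \<omega>) * (W (real (Suc i) * h n) \<omega> / sqrt 2 - W (real i * h n) \<omega> / sqrt 2)\<^sup>2 / 2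
        + b (y (real i * h n) \<omega>) * g' (y (real i * h n) \<omega>) * h n)
        = (\<Sum>i<Suc n. \<Xi> n i \<omega> + h n * gen (y (real i * h n) \<omega>))"
      proof (rule sum.cong[OF refl])
        fix i
        have w: "W (real (Suc i) * h n) \<omega> / sqrt 2 - W (real i * h n) \<omega> / sqrt 2 = dW (h n) i \<omega> / sqrt 2"
          by (simp only: dW_def diff_divide_distrib)
        show "g' (y (real i * h n) \<omega>) * (W (real (Suc i) * h n) \<omega> / sqrt 2 - W (real i * h n) \<omega> / sqrt 2)
          + g'' (y (real i * h n) \<omega>) * (W (real (Suc i) * h n) \<omega> / sqrt 2 - W (real i * h n) \<omega> / sqrt 2)\<^sup>2 / 2
          + b (y (real i * h n) \<omega>) * g' (y (real i * h n) \<omega>) * h n = \<Xi> n i \<omega> + h n * gen (y (real i * h n) \<omega>)"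
          unfolding w gi \<Xi>_def \<xi>_def[OF G1 G2 h(1)] by (simp add: power_divide field_simps)
      qed
      show ?thesis unfolding remainder_def y00 E by (simp only: sum.distrib sum_distrib_left[symmetric] diff_diff_eq)
    qed
    show "(\<lambda>n. X n \<omega> / Q n \<omega>) \<longlonglongrightarrow> 0"
    proof (rule LIMSEQ_I)
      fix \<epsilon> :: real assume e: "0 < \<epsilon>"
      have e2: "0 < \<epsilon> / 2" using e by simp
      obtain n0 where n0: "n0 > 0" "\<And>n. n \<ge> n0 \<Longrightarrow> \<bar>g (y T \<omega>) - g (y 0 \<omega>) - (\<Sum>i<n. g' (y (real i * (T / real n)) \<omega>) * (W (real (Suc i) * (T / real n)) \<omega> / sqrt 2 - W (real i * (T / real n)) \<omega> / sqrt 2)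
          + g'' (y (real i * (T / real n)) \<omega>) * (W (real (Suc i) * (T / real n)) \<omega> / sqrt 2 - W (real i * (T / real n)) \<omega> / sqrt 2)\<^sup>2 / 2
          + b (y (real i * (T / real n)) \<omega>) * g' (y (real i * (T / real n)) \<omega>) * (T / real n))\<bar>
          \<le> \<epsilon> / 2 * (1 + (\<Sum>i<n. (W (real (Suc i) * (T / real n)) \<omega> / sqrt 2 - W (real i * (T / real n)) \<omega> / sqrt 2)\<^sup>2))"
        using ito_remainder[OF Kc g g' g''_cont bnd(1,2) neumann T e2] by blast
      have le: "\<bar>X n \<omega>\<bar> \<le> \<epsilon> / 2 * Q n \<omega>" if "n \<ge> n0" for n
        using n0(2)[of "Suc n"] that unfolding Xr Q_def dW_def diff_divide_distrib h_def by simp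
      show "\<exists>n0. \<forall>n\<ge>n0. norm (X n \<omega> / Q n \<omega> - 0) < \<epsilon>"
      proof (intro exI allI impI)
        fix n assume "n0 \<le> n"
        then have "\<bar>X n \<omega>\<bar> / Q n \<omega> \<le> \<epsilon> / 2" using le[of n] Q1[of n \<omega>] by (simp add: field_simps)
        moreover have "\<bar>X n \<omega> / Q n \<omega>\<bar> = \<bar>X n \<omega>\<bar> / Q n \<omega>" using Q1[of n \<omega>] by (simp add: abs_divide)
        ultimately have "\<bar>X n \<omega> / Q n \<omega>\<bar> < \<epsilon>" using e by linarith
        then show "norm (X n \<omega> / Q n \<omega> - 0) < \<epsilon>" by simp
      qed
    qed
  qed
  then have lim0: "(\<lambda>n. expectation (X n)) \<longlonglongrightarrow> 0"
    by (rule expectation_tendsto_zero[OF X_sq X2 Q_int Q1])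
  define f where "f s = expectation (\<lambda>\<omega>. gen (y s \<omega>))" for s
  have EX: "expectation (X n) = expectation (\<lambda>\<omega>. g (y T \<omega>)) - g y0 - T / real (Suc n) * (\<Sum>i<Suc n. f (real i * (T / real (Suc n))))" for n
  proof -
    have i1: "integrable M (\<lambda>\<omega>. g (y T \<omega>))" by (rule square_integrable_imp_integrable[OF sq])
    have i2: "integrable M (\<lambda>\<omega>. \<Sum>i<Suc n. \<Xi> n i \<omega>)" by (rule square_integrable_imp_integrable[OF \<Xi>s(1)])
    have i3: "integrable M (\<lambda>\<omega>. gen (y (real i * h n) \<omega>))" for i
      by (rule integrable_const_bound[where B = "2 * G"]) (use gen_b in auto)
    have "expectation (X n) = expectation (\<lambda>\<omega>. g (y T \<omega>)) - g y0 - expectation (\<lambda>\<omega>. \<Sum>i<Suc n. \<Xi> n i \<omega>) - expectation (R n)"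
      unfolding X_eq using i1 i2 square_integrable_imp_integrable[OF R_sq[of n]] by (simp add: prob_space del: sum.lessThan_Suc)
    also have "expectation (R n) = h n * (\<Sum>i<Suc n. f (real i * h n))"
      unfolding R_def f_def using i3 by (simp del: sum.lessThan_Suc)
    finally show ?thesis using \<Xi>s(2)[of n "Suc n"] by (simp add: h_def del: sum.lessThan_Suc)
  qed
  have fc: "continuous_on {0..T} f"
    unfolding f_def by (rule continuous_on_subset[OF expectation_continuous[OF gen_c gen_b]]) auto
  have "(\<lambda>n. T / real (Suc n) * (\<Sum>i<Suc n. f (real i * (T / real (Suc n))))) \<longlonglongrightarrow> integral {0..T} f"
    using LIMSEQ_Suc[OF riemann_sum_tendsto[OF fc T]] .
  then have "(\<lambda>n. expectation (X n)) \<longlonglongrightarrow> expectation (\<lambda>\<omega>. g (y T \<omega>)) - g y0 - integral {0..T} f"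
    unfolding EX by (intro tendsto_intros)
  from LIMSEQ_unique[OF this lim0] show ?thesis by (simp add: f_def[abs_def])
qed

end

section \<open>The reversible density and its Green kernel\<close>


lemma FTC_atLeast:
  fixes f :: "real \<Rightarrow> real"
  assumes f: "continuous_on {c..} f" and x: "c \<le> x"
  shows "((\<lambda>x. integral {c..x} f) has_real_derivative f x) (at x within {c..})"
proof -
  have "((\<lambda>x. integral {c..x} f) has_real_derivative f x) (at x within {c..x + 1})"
    by (rule integral_has_real_derivative) (use x in \<open>auto intro: continuous_on_subset[OF f]\<close>)
  also have "at x within {c..x + 1} = at x within {c..}"
    by (rule at_within_nhd[where S = "{..<x + 1}"]) auto
  finally show ?thesis .
qed

lemma has_derivative_at_interior:
  fixes f :: "real \<Rightarrow> real"
  assumes "(f has_real_derivative D) (at x within {c..})" "c < x"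
  shows "(f has_real_derivative D) (at x)"
proof -
  have "at x within {c..} = at x within UNIV"
    by (rule at_within_nhd[where S = "{c<..}"]) (use assms in auto)
  then show ?thesis using assms by simp
qed

lemma AE_ge_eq_gt: "AE x in lborel. indicator {c<..} x = (indicator {c..} x :: real)" for c :: real
  using AE_lborel_singleton[of c] by eventually_elim (auto simp: indicator_def)

lemma set_integral_Ioi_Ici:
  fixes f :: "real \<Rightarrow> real"
  assumes [measurable]: "f \<in> borel_measurable borel"
  shows "(LBINT x:{c<..}. f x) = (LBINT x:{c..}. f x)"
  unfolding set_lebesgue_integral_def
  by (rule integral_cong_AE) (use AE_ge_eq_gt[of c] in auto)

context hard_ball_params
begin

definition rho :: "real \<Rightarrow> real" where "rho x = x ^ (d - 1) * exp (- 4 * a * x\<^sup>2)"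

lemma rho_pos: "0 < x \<Longrightarrow> 0 < rho x" by (simp add: rho_def)

lemma rho_cont: "continuous_on A rho" unfolding rho_def by (intro continuous_intros)

lemma rho_measurable [measurable]: "rho \<in> borel_measurable borel"
  by (rule borel_measurable_continuous_onI[OF rho_cont])

text \<open>This identity is reversibility: it turns b g' + g'' / 4 into (\<rho> g')' / (4
  \<rho>).\<close>

lemma rho_deriv: assumes x: "0 < x" shows "(rho has_real_derivative 4 * b x * rho x) (at x)"
proof -
  obtain m where m: "d = Suc (Suc m)" using d by (metis add_2_eq_Suc le_Suc_ex)
  define E where "E x = exp (- 4 * a * x\<^sup>2)" for x
  have E: "(E has_real_derivative E x * (- 8 * a * x)) (at x)"
    unfolding E_def by (rule derivative_eq_intros refl | simp)+
  have "((\<lambda>x. x ^ Suc m * E x) has_real_derivative (real (Suc m) * x ^ m) * E x + E x * (- 8 * a * x) * x ^ Suc m) (at x)"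
    using DERIV_mult[OF DERIV_pow[of "Suc m" x UNIV] E] by simp
  moreover have "(real (Suc m) * x ^ m) * E x + E x * (- 8 * a * x) * x ^ Suc m = 4 * b x * (x ^ Suc m * E x)"
  proof -
    have "4 * b x * x = - 8 * a * x * x + (real d - 1)" using x by (simp add: b_def field_simps)
    also have "real d - 1 = real (Suc m)" using m by simp
    finally have "4 * b x * x = - 8 * a * x * x + real (Suc m)" .
    then have "4 * b x * x * (x ^ m * E x) = (- 8 * a * x * x + real (Suc m)) * (x ^ m * E x)" by simp
    then show ?thesis by (simp add: algebra_simps)
  qed
  moreover have "d - 1 = Suc m" using m by simp
  then have "(\<lambda>x. x ^ Suc m * E x) = rho" by (simp only: fun_eq_iff rho_def E_def simp_thms)
  ultimately show ?thesis by (metis (no_types, lifting))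
qed

lemma rho_deriv_within: "l \<le> x \<Longrightarrow> (rho has_real_derivative 4 * b x * rho x) (at x within A)"
  using rho_deriv[of x] l_pos by (auto intro: has_field_derivative_at_within)

lemma rho_integrable: "integrable lborel rho"
proof -
  define \<sigma> where "\<sigma> = sqrt (1 / (8 * a))"
  have s: "0 < \<sigma>" "\<sigma>\<^sup>2 = 1 / (8 * a)" using a by (auto simp: \<sigma>_def)
  have "integrable lborel (\<lambda>x. sqrt (2 * pi * \<sigma>\<^sup>2) * (normal_density 0 \<sigma> x * (x - 0) ^ (d - 1)))"
    by (intro integrable_mult_right integrable_normal_moment s)
  also have "(\<lambda>x. sqrt (2 * pi * \<sigma>\<^sup>2) * (normal_density 0 \<sigma> x * (x - 0) ^ (d - 1))) = rho"
  proof
    fix x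
    have "sqrt (2 * pi * \<sigma>\<^sup>2) > 0" using s(1) by simp
    moreover have "x\<^sup>2 / (2 * \<sigma>\<^sup>2) = 4 * a * x\<^sup>2" unfolding s(2) using a by (simp add: field_simps)
    ultimately show "sqrt (2 * pi * \<sigma>\<^sup>2) * (normal_density 0 \<sigma> x * (x - 0) ^ (d - 1)) = rho x"
      using s(1) by (simp add: normal_density_def rho_def)
  qed
  finally show ?thesis .
qed

lemma rho_set_integrable: "A \<in> sets borel \<Longrightarrow> set_integrable lborel A rho"
  unfolding set_integrable_def using rho_integrable by (intro integrable_mult_indicator) auto

lemma bounded_rho_integrable:
  assumes [measurable]: "f \<in> borel_measurable borel" and "\<And>x. \<bar>f x\<bar> \<le> K" "A \<in> sets borel"
  shows "set_integrable lborel A (\<lambda>x. f x * rho x)"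
proof -
  have "integrable lborel (\<lambda>x. f x * rho x)"
  proof (rule Bochner_Integration.integrable_bound)
    show "integrable lborel (\<lambda>x. K * rho x)" using rho_integrable by simp
    show "AE x in lborel. norm (f x * rho x) \<le> norm (K * rho x)"
      using assms(2) by (intro AE_I2) (simp add: abs_mult mult_right_mono order_trans[OF _ abs_ge_self])
  qed measurable
  then show ?thesis unfolding set_integrable_def using assms(3) by (intro integrable_mult_indicator) auto
qed

definition R :: "real \<Rightarrow> real" where "R x = integral {l..x} rho"

abbreviation Z :: real where "Z \<equiv> Z_a d r a"

lemma Z_eq: "Z = (LBINT x:{l<..}. rho x)" "Z = (LBINT x:{l..}. rho x)"
proof -
  show "Z = (LBINT x:{l<..}. rho x)" by (simp add: Z_a_def rho_def l_def)
  then show "Z = (LBINT x:{l..}. rho x)" by (simp only: set_integral_Ioi_Ici[OF rho_measurable])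
qed

lemma R_eq: "R x = (LBINT u:{l..x}. rho u)"
  using set_borel_integral_eq_integral(2)[OF rho_set_integrable[of "{l..x}"]] by (simp add: R_def)

lemma R_low: "x \<le> l \<Longrightarrow> R x = 0"
  by (cases "x = l") (auto simp: R_def)

lemma R_deriv_within: "l \<le> x \<Longrightarrow> (R has_real_derivative rho x) (at x within {l..})"
  unfolding R_def[abs_def] by (rule FTC_atLeast[OF rho_cont])

lemma R_deriv: "l < x \<Longrightarrow> (R has_real_derivative rho x) (at x)"
  using has_derivative_at_interior[OF R_deriv_within[of x]] by simp

lemma R_strict: assumes "l \<le> x" "x < y" shows "R x < R y"
proof (rule DERIV_pos_imp_increasing_open[OF assms(2)])
  show "\<exists>D. (R has_real_derivative D) (at u) \<and> 0 < D" if "x < u" "u < y" for u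
    using R_deriv[of u] rho_pos[of u] that assms l_pos by (intro exI[of _ "rho u"]) auto
  show "continuous_on {x..y} R"
    by (rule continuous_on_subset[of "{l..}"]) (use assms R_deriv_within in \<open>auto intro: DERIV_continuous_on\<close>)
qed

lemma R_mono: "mono R"
proof (rule monoI)
  fix x y :: real assume "x \<le> y"
  then consider "x = y" | "x < y" "l \<le> x" | "x < l" "y \<le> l" | "x < l" "l < y" by linarith
  then show "R x \<le> R y"
    using R_strict[of x y] R_strict[of l y] R_low[of x] R_low[of y] R_low[of l] by cases auto
qed

lemma R_nonneg: "0 \<le> R x"
  using monoD[OF R_mono, of "min l x" x] R_low[of "min l x"] by simp

lemma R_tendsto: "(R \<longlongrightarrow> Z) at_top"
  using tendsto_set_lebesgue_integral_at_top[of l lborel rho] rho_set_integrable[of "{l..}"]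
  by (simp add: R_eq[abs_def] Z_eq(2))

lemma R_le_Z: "R x \<le> Z"
proof (rule tendsto_lowerbound[OF R_tendsto])
  show "\<forall>\<^sub>F u in at_top. R x \<le> R u"
    using eventually_ge_at_top[of x] by eventually_elim (rule monoD[OF R_mono])
qed simp

lemma Z_pos: "0 < Z"
  using R_strict[of l "l + 1"] R_low[of l] R_le_Z[of "l + 1"] by simp

definition Rb :: "real \<Rightarrow> real" where "Rb x = Z - R x"

lemma Rb_nonneg: "0 \<le> Rb x" using R_le_Z by (simp add: Rb_def)
lemma Rb_le: "Rb x \<le> Z" using R_nonneg by (simp add: Rb_def)

lemma R_measurable [measurable]: "R \<in> borel_measurable borel" "Rb \<in> borel_measurable borel"
  using borel_measurable_mono[OF R_mono] by (auto simp: Rb_def[abs_def])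

lemma Rb_eq: assumes x: "l \<le> x" shows "Rb x = (LBINT u:{x<..}. rho u)"
proof -
  have "(LBINT u:{l..x} \<union> {x<..}. rho u) = (LBINT u:{l..x}. rho u) + (LBINT u:{x<..}. rho u)"
    by (rule set_integral_Un) (auto intro: rho_set_integrable)
  also have "{l..x} \<union> {x<..} = {l..}" using x by auto
  finally show ?thesis by (simp add: Rb_def Z_eq(2) R_eq)
qed

text \<open>Far out, R + \<rho> / (4 a x) is nonincreasing, because the derivative \<rho> ((d - 2) /
  x^2 - 8 a) of \<rho> / x is at most -4 a \<rho>; comparison with the limit \<open>Z\<close> gives
  the bound. On the remaining compact interval \<rho> / x has a positive minimum. The factor 1 / x
  matters: it will compensate the linear growth of the drift.\<close>

lemma mills_ratio: "\<exists>C>0. \<forall>x\<ge>l. Rb x \<le> C * rho x / x"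
proof -
  define q where "q x = rho x / x" for x
  have q_deriv: "(q has_real_derivative rho x * ((real d - 2) / x\<^sup>2 - 8 * a)) (at x)" if "0 < x" for x
    unfolding q_def
    by (rule derivative_eq_intros rho_deriv[OF that] refl | use that in \<open>simp add: b_def field_simps power2_eq_square\<close>)+
  \<comment> \<open>Chosen with 4 * a * l * (x0 - l) = d - 2, so that (d - 2) / u^2 \<le> 4 * a for
    all u \<ge> x0.\<close>
  define x0 where "x0 = l + (real d - 2) / (4 * a * l)"
  have x0: "l \<le> x0" using d a l_pos by (simp add: x0_def)
  have far: "Rb x \<le> rho x / x / (4 * a)" if x: "x0 \<le> x" "l < x" for x
  proof -
    have mono: "R y \<le> R x + q x / (4 * a)" if y: "x \<le> y" for y
    proof -
      have "R y + q y / (4 * a) \<le> R x + q x / (4 * a)"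
      proof (rule DERIV_nonpos_imp_nonincreasing[OF y])
        fix u assume u: "x \<le> u" "u \<le> y"
        have u0: "l < u" "0 < u" using u x l_pos by auto
        have "(real d - 2) / u\<^sup>2 \<le> 4 * a"
        proof -
          have "(real d - 2) \<le> (4 * a * l) * (x0 - l)" using a l_pos by (simp add: x0_def)
          also have "\<dots> \<le> (4 * a * u) * u" using u x u0 a l_pos x0 by (intro mult_mono) auto
          finally show ?thesis using u0 by (simp add: divide_le_eq power2_eq_square)
        qed
        then have "rho u + rho u * ((real d - 2) / u\<^sup>2 - 8 * a) / (4 * a) \<le> rho u + rho u * (- (4 * a)) / (4 * a)"
          using rho_pos[OF u0(2)] a by (intro add_left_mono divide_right_mono mult_left_mono) auto
        also have "\<dots> = 0" using a by simp
        finally have "rho u + rho u * ((real d - 2) / u\<^sup>2 - 8 * a) / (4 * a) \<le> 0" .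
        moreover have "((\<lambda>u. R u + q u / (4 * a)) has_real_derivative rho u + rho u * ((real d - 2) / u\<^sup>2 - 8 * a) / (4 * a)) (at u)"
          by (intro DERIV_add DERIV_cdivide R_deriv q_deriv u0)
        ultimately show "\<exists>D. ((\<lambda>u. R u + q u / (4 * a)) has_real_derivative D) (at u) \<and> D \<le> 0" by blast
      qed
      moreover have "0 \<le> q y / (4 * a)" using rho_pos[of y] y x l_pos a by (simp add: q_def)
      ultimately show ?thesis by linarith
    qed
    have "Z \<le> R x + q x / (4 * a)"
    proof (rule tendsto_upperbound[OF R_tendsto])
      show "\<forall>\<^sub>F u in at_top. R u \<le> R x + q x / (4 * a)"
        using eventually_ge_at_top[of x] by eventually_elim (rule mono)
    qed simp
    then show ?thesis by (simp add: Rb_def q_def)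
  qed
  have "compact (q ` {l..x0 + 1})"
    unfolding q_def using l_pos by (intro compact_continuous_image continuous_intros rho_cont) auto
  moreover have "q ` {l..x0 + 1} \<noteq> {}" using x0 by auto
  ultimately have "\<exists>m\<in>q ` {l..x0 + 1}. \<forall>s\<in>q ` {l..x0 + 1}. m \<le> s" by (rule compact_attains_inf)
  then obtain m where m: "m \<in> q ` {l..x0 + 1}" "\<And>s. s \<in> q ` {l..x0 + 1} \<Longrightarrow> m \<le> s" by blast
  have m0: "0 < m"
  proof -
    obtain u where u: "u \<in> {l..x0 + 1}" "m = q u" using m(1) by blast
    have "0 < u" using u l_pos by simp
    then show ?thesis using rho_pos[of u] u by (simp add: q_def)
  qed
  define C where "C = Z / m + 1 / (4 * a)"
  have C: "Z / m \<le> C" "1 / (4 * a) \<le> C" "0 < C" using Z_pos m0 a by (auto simp: C_def add_pos_pos)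
  show ?thesis
  proof (intro exI[of _ C] conjI allI impI C(3))
    fix x assume x: "l \<le> x"
    have q0: "0 < q x" using x l_pos rho_pos by (simp add: q_def)
    show "Rb x \<le> C * rho x / x"
    proof (cases "x \<le> x0 + 1")
      case True
      have "Rb x \<le> Z / m * m" using Rb_le[of x] m0 by simp
      also have "\<dots> \<le> C * q x" using C m(2)[of "q x"] True x m0 Z_pos by (intro mult_mono) auto
      finally show ?thesis by (simp add: q_def)
    next
      case False
      then have "Rb x \<le> q x * (1 / (4 * a))" using far[of x] x0 by (simp add: q_def)
      also have "\<dots> \<le> q x * C" using C q0 by (intro mult_left_mono) auto
      finally show ?thesis by (simp add: q_def mult.commute)
    qed
  qed
qed

lemma x_rho_tendsto: "((\<lambda>x. x * rho x) \<longlongrightarrow> 0) at_top"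
  unfolding rho_def using a by real_asymp

section \<open>The Green kernel of the tail equation\<close>

text \<open>Tails evolve by the operator (\<rho> / 4) (F' / \<rho>)' with zero values at
  \<open>l\<close> and at infinity. Its harmonic functions are \<open>R\<close>, vanishing at
  \<open>l\<close>, and \<open>Rb\<close>, vanishing at infinity; the factor 4 / Z normalises the
  jump of the derivative on the diagonal.\<close>

definition k :: "real \<Rightarrow> real \<Rightarrow> real" where
  "k x z = 4 * R (min x z) * Rb (max x z) / Z"

text \<open>The value 1 off the half line secures positivity everywhere, as
  \<open>sym_kernel\<close> demands; the measure \<open>N\<close> does not see it.\<close>

definition hw :: "real \<Rightarrow> real" where "hw x = (if l < x then x * rho x else 1)"

text \<open>Under this weight a gradient g' and a tail F pair as \<rho> g' and F: the factor \<rho>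
  cancels, and the pairing is the Lebesgue integral of g' F over the half line.\<close>

definition N :: "real measure" where
  "N = density lborel (\<lambda>x. ennreal (indicator {l<..} x / rho x))"

lemma sets_N [simp, measurable_cong]: "sets N = sets borel" by (simp add: N_def)
lemma space_N [simp]: "space N = UNIV" by (simp add: N_def)

lemma weight_nonneg: "0 \<le> indicator {l<..} x / rho x"
  using rho_pos[of x] l_pos by (auto simp: indicator_def)

lemma integrable_N:
  assumes [measurable]: "f \<in> borel_measurable borel"
  shows "integrable N f \<longleftrightarrow> integrable lborel (\<lambda>x. indicator {l<..} x / rho x * f x)"
    and "(\<integral>x. f x \<partial>N) = (\<integral>x. indicator {l<..} x / rho x * f x \<partial>lborel)"
  unfolding N_def using weight_nonneg
  by (subst integrable_density integral_density; simp)+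

lemma nn_integral_N:
  assumes [measurable]: "f \<in> borel_measurable borel"
  shows "(\<integral>\<^sup>+x. f x \<partial>N) = (\<integral>\<^sup>+x. ennreal (indicator {l<..} x / rho x) * f x \<partial>lborel)"
  unfolding N_def by (subst nn_integral_density) auto

lemma AE_N: "(AE x in N. P x) \<longleftrightarrow> (AE x in lborel. l < x \<longrightarrow> P x)"
proof -
  have "(AE x in N. P x) \<longleftrightarrow> (AE x in lborel. 0 < ennreal (indicator {l<..} x / rho x) \<longrightarrow> P x)"
    unfolding N_def by (rule AE_density) measurable
  also have "\<dots> \<longleftrightarrow> (AE x in lborel. l < x \<longrightarrow> P x)"
  proof (intro AE_cong)
    fix x
    have "0 < rho x" if "l < x" using rho_pos[of x] l_pos that by simp
    then have "0 < ennreal (indicator {l<..} x / rho x) \<longleftrightarrow> l < x" by (cases "l < x") auto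
    then show "(0 < ennreal (indicator {l<..} x / rho x) \<longrightarrow> P x) \<longleftrightarrow> (l < x \<longrightarrow> P x)" by simp
  qed
  finally show ?thesis .
qed

text \<open>The Schur weight \<open>x \<rho>(x)\<close> is \<open>\<rho>\<close> times the derivative of the ground state \<open>x\<^sup>2/2 - const\<close> of the
  process without reflection, whose eigenvalue is \<open>4 a\<close>.\<close>
lemma schur_test: "(\<integral>\<^sup>+x. ennreal (k x z * hw x) \<partial>N) \<le> ennreal (hw z / (4 * a))"
proof (cases "l < z")
  case False
  then have "k x z = 0" for x by (simp add: k_def R_low min_def)
  then show ?thesis by simp
next
  case z: True
  obtain C where C: "C > 0" "\<And>x. l \<le> x \<Longrightarrow> Rb x \<le> C * rho x / x" using mills_ratio by blast
  define c1 where "c1 = 4 * Rb z / Z"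
  define c2 where "c2 = 4 * R z / Z"
  have c: "0 \<le> c1" "0 \<le> c2" using Rb_nonneg R_nonneg Z_pos by (auto simp: c1_def c2_def)
  have xrho: "((\<lambda>x. x * rho x) has_real_derivative rho x * (real d - 8 * a * x\<^sup>2)) (at x within A)" if "l \<le> x" for x A
    by (rule derivative_eq_intros rho_deriv_within[OF that] refl | use that l_pos in \<open>simp add: b_def field_simps power2_eq_square\<close>)+
  \<comment> \<open>Antiderivatives of x R and x Rb: integrate by parts and use x^2 \<rho> = (d
    \<rho> - (x \<rho>)') / (8 a).\<close>
  define S1 where "S1 x = x\<^sup>2 * R x / 2 - (real d * R x - x * rho x) / (16 * a)" for x
  define S2 where "S2 x = x\<^sup>2 * Rb x / 2 - (real d * Rb x + x * rho x) / (16 * a)" for x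
  have S1: "(S1 has_real_derivative x * R x) (at x within {l..z})" if "l \<le> x" "x \<le> z" for x
  proof -
    have R': "(R has_real_derivative rho x) (at x within {l..z})"
      by (rule DERIV_subset[OF R_deriv_within[OF that(1)]]) auto
    have "(S1 has_real_derivative (2 * x * R x + x\<^sup>2 * rho x) / 2 - (real d * rho x - rho x * (real d - 8 * a * x\<^sup>2)) / (16 * a)) (at x within {l..z})"
      unfolding S1_def
    proof (intro DERIV_diff DERIV_cdivide DERIV_cmult xrho that R')
      show "((\<lambda>x. x\<^sup>2 * R x) has_real_derivative 2 * x * R x + x\<^sup>2 * rho x) (at x within {l..z})"
        by (rule derivative_eq_intros R' refl | simp)+
    qed
    moreover have "(2 * x * R x + x\<^sup>2 * rho x) / 2 - (real d * rho x - rho x * (real d - 8 * a * x\<^sup>2)) / (16 * a) = x * R x"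
      using a by (simp add: field_simps)
    ultimately show ?thesis by simp
  qed
  have S2: "(S2 has_real_derivative x * Rb x) (at x)" if "z \<le> x" for x
  proof -
    have lx: "l < x" "l \<le> x" using that z by auto
    have R': "(Rb has_real_derivative - rho x) (at x)"
      unfolding Rb_def[abs_def] using DERIV_diff[OF DERIV_const R_deriv[OF lx(1)]] by simp
    have "(S2 has_real_derivative (2 * x * Rb x + x\<^sup>2 * (- rho x)) / 2 - (real d * (- rho x) + rho x * (real d - 8 * a * x\<^sup>2)) / (16 * a)) (at x)"
      unfolding S2_def
    proof (intro DERIV_diff DERIV_add DERIV_cdivide DERIV_cmult xrho lx R')
      show "((\<lambda>x. x\<^sup>2 * Rb x) has_real_derivative 2 * x * Rb x + x\<^sup>2 * (- rho x)) (at x)"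
        by (rule derivative_eq_intros R' refl | simp)+
    qed
    moreover have "(2 * x * Rb x + x\<^sup>2 * (- rho x)) / 2 - (real d * (- rho x) + rho x * (real d - 8 * a * x\<^sup>2)) / (16 * a) = x * Rb x"
      using a by (simp add: field_simps)
    ultimately show ?thesis by simp
  qed
  have RbT: "(Rb \<longlongrightarrow> 0) at_top"
    unfolding Rb_def[abs_def] using tendsto_diff[OF tendsto_const[of Z] R_tendsto] by simp
  have x2: "((\<lambda>x. x\<^sup>2 * Rb x) \<longlongrightarrow> 0) at_top"
  proof (rule tendsto_sandwich[of "\<lambda>_. 0" _ _ "\<lambda>x. C * (x * rho x)"])
    show "\<forall>\<^sub>F x in at_top. x\<^sup>2 * Rb x \<le> C * (x * rho x)"
      using eventually_ge_at_top[of l]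
    proof eventually_elim
      case (elim x)
      have x0: "0 < x" using elim l_pos by simp
      have "x\<^sup>2 * Rb x \<le> x\<^sup>2 * (C * rho x / x)" using C(2)[OF elim] by (intro mult_left_mono) auto
      also have "\<dots> = C * (x * rho x)" using x0 by (simp add: field_simps power2_eq_square)
      finally show ?case .
    qed
    show "((\<lambda>x. C * (x * rho x)) \<longlongrightarrow> 0) at_top" using tendsto_mult_left[OF x_rho_tendsto, of C] by simp
  qed (use Rb_nonneg in auto)
  have S2T: "(S2 \<longlongrightarrow> 0) at_top"
    unfolding S2_def by (rule tendsto_eq_intros x2 RbT x_rho_tendsto refl | use a in simp)+
  have I1: "(\<integral>\<^sup>+x. ennreal (x * R x) * indicator {l..z} x \<partial>lborel) = ennreal (S1 z - S1 l)"
  proof (rule nn_integral_has_integral_lebesgue'[of "{l..z}" "\<lambda>x. x * R x"])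
    show "((\<lambda>x. x * R x) has_integral S1 z - S1 l) {l..z}"
      by (rule fundamental_theorem_of_calculus)
         (use S1 z in \<open>auto simp: has_real_derivative_iff_has_vector_derivative[symmetric]\<close>)
  qed (use R_nonneg l_pos in auto)
  have I2: "(\<integral>\<^sup>+x. ennreal (x * Rb x) * indicator {z..} x \<partial>lborel) = ennreal (0 - S2 z)"
    by (rule nn_integral_FTC_atLeast[OF _ S2 _ S2T]) (use Rb_nonneg l_pos z in auto)
  have S10: "0 \<le> S1 z - S1 l"
  proof -
    have "S1 l \<le> S1 z"
    proof (rule DERIV_nonneg_imp_increasing_open[where f = S1 and a = l and b = z])
      show "continuous_on {l..z} S1" by (rule DERIV_continuous_on) (use S1 in auto)
      show "\<exists>D. (S1 has_real_derivative D) (at x) \<and> 0 \<le> D" if "l < x" "x < z" for x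
      proof -
        have "(S1 has_real_derivative x * R x) (at x)"
          using S1[of x] that at_within_Icc_at[of l x z] by auto
        then show ?thesis using R_nonneg[of x] that l_pos by (intro exI[of _ "x * R x"]) auto
      qed
    qed (use z in simp)
    then show ?thesis by simp
  qed
  have S20: "0 \<le> - S2 z"
  proof -
    have "S2 z \<le> 0"
    proof (rule tendsto_lowerbound[OF S2T])
      show "\<forall>\<^sub>F u in at_top. S2 z \<le> S2 u"
        using eventually_ge_at_top[of z]
      proof eventually_elim
        case (elim u)
        show ?case
        proof (rule DERIV_nonneg_imp_nondecreasing[OF elim])
          fix x assume "z \<le> x" "x \<le> u"
          then show "\<exists>D. (S2 has_real_derivative D) (at x) \<and> 0 \<le> D"
            using S2[of x] Rb_nonneg[of x] z l_pos by (intro exI[of _ "x * Rb x"]) auto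
        qed
      qed
    qed simp
    then show ?thesis by simp
  qed
  have "(\<integral>\<^sup>+x. ennreal (k x z * hw x) \<partial>N) = (\<integral>\<^sup>+x. ennreal (indicator {l<..} x / rho x) * ennreal (k x z * hw x) \<partial>lborel)"
    by (rule nn_integral_N) (simp add: k_def hw_def[abs_def])
  also have "\<dots> \<le> (\<integral>\<^sup>+x. ennreal c1 * (ennreal (x * R x) * indicator {l..z} x) + ennreal c2 * (ennreal (x * Rb x) * indicator {z..} x) \<partial>lborel)"
  proof (rule nn_integral_mono)
    fix x :: real
    consider "x \<le> l" | "l < x" "x \<le> z" | "z < x" "l < x" using z by linarith
    then show "ennreal (indicator {l<..} x / rho x) * ennreal (k x z * hw x)
      \<le> ennreal c1 * (ennreal (x * R x) * indicator {l..z} x) + ennreal c2 * (ennreal (x * Rb x) * indicator {z..} x)"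
    proof cases
      case 1 then show ?thesis by simp
    next
      case 2
      have p: "0 < rho x" "0 < x" using 2 l_pos rho_pos by auto
      have "ennreal (indicator {l<..} x / rho x) * ennreal (k x z * hw x) = ennreal (c1 * (x * R x))"
        using 2 p R_nonneg[of x] Rb_nonneg[of z] Z_pos
        by (subst ennreal_mult[symmetric]) (auto simp: k_def hw_def c1_def min_def max_def)
      also have "\<dots> = ennreal c1 * ennreal (x * R x)" using c p R_nonneg[of x] by (intro ennreal_mult) auto
      finally show ?thesis using 2 by simp
    next
      case 3
      have p: "0 < rho x" "0 < x" using 3 l_pos rho_pos by auto
      have "ennreal (indicator {l<..} x / rho x) * ennreal (k x z * hw x) = ennreal (c2 * (x * Rb x))"
        using 3 p R_nonneg[of z] Rb_nonneg[of x] Z_pos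
        by (subst ennreal_mult[symmetric]) (auto simp: k_def hw_def c2_def min_def max_def)
      also have "\<dots> = ennreal c2 * ennreal (x * Rb x)" using c p Rb_nonneg[of x] by (intro ennreal_mult) auto
      finally show ?thesis using 3 by simp
    qed
  qed
  also have "\<dots> = ennreal c1 * (\<integral>\<^sup>+x. ennreal (x * R x) * indicator {l..z} x \<partial>lborel) + ennreal c2 * (\<integral>\<^sup>+x. ennreal (x * Rb x) * indicator {z..} x \<partial>lborel)"
    by (subst nn_integral_add) (auto simp: nn_integral_cmult)
  also have "\<dots> = ennreal (c1 * (S1 z - S1 l) + c2 * (- S2 z))"
  proof -
    have "0 \<le> c1 * (S1 z - S1 l)" "0 \<le> c2 * (- S2 z)" using c S10 S20 by (intro mult_nonneg_nonneg; simp)+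
    then have "ennreal (c1 * (S1 z - S1 l) + c2 * (- S2 z)) = ennreal (c1 * (S1 z - S1 l)) + ennreal (c2 * (- S2 z))"
      by (rule ennreal_plus)
    then show ?thesis unfolding I1 I2 using c S10 S20 by (simp only: ennreal_mult diff_0)
  qed
  also have "\<dots> \<le> ennreal (hw z / (4 * a))"
  proof (rule ennreal_leI)
    \<comment> \<open>The polynomial parts cancel and R + Rb = Z remains. The barrier contributes
      only the subtracted term with l \<rho>(l), which has the favourable sign.\<close>
    have "c1 * (S1 z - S1 l) + c2 * (- S2 z) = (z * rho z - Rb z * (l * rho l) / Z) / (4 * a)"
    proof -
      have Zn: "Z \<noteq> 0" and an: "a \<noteq> 0" using Z_pos a by auto
      have "Z * (16 * a) * (c1 * (S1 z - S1 l) + c2 * (- S2 z))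
        = 4 * Rb z * (16 * a * (S1 z - S1 l)) - 4 * R z * (16 * a * S2 z)"
        using Zn by (simp add: c1_def c2_def field_simps)
      also have "16 * a * (S1 z - S1 l) = 8 * a * z\<^sup>2 * R z - real d * R z + z * rho z - l * rho l"
        using an R_low[of l] by (simp add: S1_def field_simps)
      also have "16 * a * S2 z = 8 * a * z\<^sup>2 * Rb z - real d * Rb z - z * rho z"
        using an by (simp add: S2_def field_simps)
      also have "4 * Rb z * (8 * a * z\<^sup>2 * R z - real d * R z + z * rho z - l * rho l) - 4 * R z * (8 * a * z\<^sup>2 * Rb z - real d * Rb z - z * rho z)
        = 4 * ((R z + Rb z) * (z * rho z) - Rb z * (l * rho l))" by (simp add: algebra_simps)
      also have "R z + Rb z = Z" by (simp add: Rb_def)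
      finally show ?thesis using Zn an by (simp add: field_simps)
    qed
    also have "\<dots> \<le> z * rho z / (4 * a)"
      using Rb_nonneg[of z] l_pos rho_pos[of l] Z_pos a by (intro divide_right_mono) auto
    finally show "c1 * (S1 z - S1 l) + c2 * (- S2 z) \<le> hw z / (4 * a)" using z by (simp add: hw_def)
  qed
  finally show ?thesis .
qed

sublocale kernel: sym_kernel N k hw "4 * a"
proof
  have "sigma_finite_measure (density lborel (\<lambda>x. ennreal (indicator {l<..} x / rho x)))"
    by (rule sigma_finite_measure.sigma_finite_iff_density_finite[THEN iffD2, OF lborel.sigma_finite_measure_axioms]) auto
  then show "\<exists>A. countable A \<and> A \<subseteq> sets N \<and> \<Union> A = space N \<and> (\<forall>a\<in>A. emeasure N a \<noteq> \<infinity>)"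
    unfolding N_def sigma_finite_measure_def .
  show "case_prod k \<in> borel_measurable (N \<Otimes>\<^sub>M N)" unfolding k_def by measurable
  show "hw \<in> borel_measurable N" unfolding hw_def[abs_def] by measurable
  show "0 < hw x" for x using l_pos rho_pos[of x] by (auto simp: hw_def)
qed (use R_nonneg Rb_nonneg Z_pos a schur_test in \<open>auto simp: k_def min.commute max.commute\<close>)

end


section \<open>A Lyapunov function and square-integrable envelopes\<close>

context hard_ball_params
begin

text \<open>\<open>V\<close> solves L V = 1 with zero slope at \<open>l\<close>, so its mean along
  the process can grow at most linearly in time. Its gradient is of order 1 / \<rho> at infinity,
  which is just what makes 1 / V square integrable for dx / \<rho>.\<close>

definition V' :: "real \<Rightarrow> real" where "V' x = 4 * R x / rho x"
definition V :: "real \<Rightarrow> real" where "V x = integral {l..x} V'"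

lemma R_cont: "continuous_on {l..} R"
  by (rule DERIV_continuous_on[OF R_deriv_within]) auto

lemma rho_pos_l: "l \<le> x \<Longrightarrow> 0 < rho x" using rho_pos l_pos by simp

lemma V'_cont: "continuous_on {l..} V'"
  unfolding V'_def by (intro continuous_intros R_cont rho_cont) (use rho_pos_l in fastforce)

lemma V_deriv_within: "l \<le> x \<Longrightarrow> (V has_real_derivative V' x) (at x within {l..})"
  unfolding V_def[abs_def] by (rule FTC_atLeast[OF V'_cont])

text \<open>Shared by \<open>V'\<close> and \<open>dK\<close>: a function with gradient 4 f / \<rho>
  has generator f' / \<rho>.\<close>

lemma quotient_rho_deriv:
  assumes f: "(f has_real_derivative D) (at x within {l..})" and x: "l \<le> x"
  shows "((\<lambda>x. 4 * f x / rho x) has_real_derivative 4 * D / rho x - 4 * b x * (4 * f x / rho x)) (at x within {l..})"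
proof -
  have "((\<lambda>x. 4 * f x / rho x) has_real_derivative (4 * D * rho x - 4 * f x * (4 * b x * rho x)) / (rho x * rho x)) (at x within {l..})"
    using rho_pos_l[OF x] by (intro DERIV_divide DERIV_cmult f rho_deriv_within x) auto
  moreover have "(4 * D * rho x - 4 * f x * (4 * b x * rho x)) / (rho x * rho x) = 4 * D / rho x - 4 * b x * (4 * f x / rho x)"
    using rho_pos_l[OF x] by (simp add: field_simps)
  ultimately show ?thesis by simp
qed

lemma V'_deriv: "l \<le> x \<Longrightarrow> (V' has_real_derivative 4 - 4 * b x * V' x) (at x within {l..})"
  using quotient_rho_deriv[OF R_deriv_within, of x] rho_pos_l[of x] by (simp add: V'_def[abs_def])

lemma V'_nonneg: "l \<le> x \<Longrightarrow> 0 \<le> V' x"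
  using R_nonneg[of x] rho_pos_l[of x] by (simp add: V'_def)

lemma V'_integrable: "V' integrable_on {l..x}"
  by (rule integrable_continuous_real[OF continuous_on_subset[OF V'_cont]]) auto

lemma V_mono: "mono V"
  unfolding V_def by (intro monoI integral_subset_le V'_integrable) (auto simp: V'_nonneg)

lemma V_measurable [measurable]: "V \<in> borel_measurable borel"
  by (rule borel_measurable_mono[OF V_mono])

lemma V_l: "V l = 0" by (simp add: V_def)

lemma V_nonneg: "0 \<le> V x"
  unfolding V_def by (rule integral_nonneg[OF V'_integrable]) (auto simp: V'_nonneg)

lemma V_pos: assumes x: "l < x" shows "0 < V x"
proof -
  have "V l < V x"
  proof (rule DERIV_pos_imp_increasing_open[OF x])
    fix u assume u: "l < u" "u < x"
    have "0 < R u" using R_strict[of l u] R_low[of l] u by simp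
    then have "0 < V' u" using rho_pos_l[of u] u by (simp add: V'_def)
    then show "\<exists>D. (V has_real_derivative D) (at u) \<and> 0 < D"
      using has_derivative_at_interior[OF V_deriv_within[of u] u(1)] u by (intro exI[of _ "V' u"]) auto
  next
    show "continuous_on {l..x} V"
      by (rule continuous_on_subset[of "{l..}"]) (use V_deriv_within in \<open>auto intro: DERIV_continuous_on\<close>)
  qed
  then show ?thesis by (simp add: V_l)
qed

text \<open>A crude bound whose purpose is to give \<open>y t\<close> a second moment. It holds
  because x \<rho> is bounded away from the barrier, so that V' dominates a multiple of x.\<close>

lemma V_growth: "\<exists>C>0. \<forall>x\<ge>l. x\<^sup>2 \<le> C * (1 + V x)"
proof -
  define x1 where "x1 = l + 1"
  have x1: "l < x1" "0 < x1" "1 \<le> x1" using l_pos by (auto simp: x1_def)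
  obtain X where X: "\<And>x. X \<le> x \<Longrightarrow> x * rho x < 1"
    using order_tendstoD(2)[OF x_rho_tendsto zero_less_one] unfolding eventually_at_top_linorder by blast
  have "bounded ((\<lambda>x. x * rho x) ` {x1..max X x1})"
    by (intro compact_imp_bounded compact_continuous_image continuous_intros rho_cont) auto
  then obtain M0 where M0: "\<And>x. x \<in> {x1..max X x1} \<Longrightarrow> x * rho x \<le> M0"
    unfolding bounded_iff by (metis abs_le_D1 imageI real_norm_def)
  define M where "M = max 1 M0"
  have M: "0 < M" by (simp add: M_def)
  have Mb: "x * rho x \<le> M" if "x1 \<le> x" for x
    using X[of x] M0[of x] that by (cases "X \<le> x") (auto simp: M_def)
  \<comment> \<open>Then 2 * c * u \<le> V' u for u \<ge> x1, from R u \<ge> R x1 and u \<rho>(u)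
    \<le> M.\<close>
  define c where "c = 2 * R x1 / M"
  have c: "0 < c" using R_strict[of l x1] R_low[of l] x1 M by (simp add: c_def)
  have far: "c * (x\<^sup>2 - x1\<^sup>2) \<le> V x" if x: "x1 \<le> x" for x
  proof -
    have "V x1 - c * x1\<^sup>2 \<le> V x - c * x\<^sup>2"
    proof (rule DERIV_nonneg_imp_nondecreasing[OF x])
      fix u assume u: "x1 \<le> u" "u \<le> x"
      have lu: "l < u" "0 < u" using u x1 by auto
      have "2 * c * u \<le> V' u"
      proof -
        have "2 * c * u = 4 * R x1 * (u * rho u) / (M * rho u)" using rho_pos_l[of u] lu by (simp add: c_def)
        also have "\<dots> \<le> 4 * R u * M / (M * rho u)"
          using Mb[OF u(1)] monoD[OF R_mono u(1)] R_nonneg rho_pos_l[of u] lu M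
          by (intro divide_right_mono mult_mono) auto
        also have "\<dots> = V' u" using M by (simp add: V'_def)
        finally show ?thesis .
      qed
      moreover have "((\<lambda>x. V x - c * x\<^sup>2) has_real_derivative V' u - c * (2 * u)) (at u)"
        using has_derivative_at_interior[OF V_deriv_within[of u] lu(1)] lu by (auto intro!: derivative_eq_intros)
      ultimately show "\<exists>D. ((\<lambda>x. V x - c * x\<^sup>2) has_real_derivative D) (at u) \<and> 0 \<le> D"
        by (intro exI[of _ "V' u - c * (2 * u)"]) auto
    qed
    then show ?thesis using V_nonneg[of x1] by (simp add: algebra_simps)
  qed
  show ?thesis
  proof (intro exI[of _ "x1\<^sup>2 + 1 / c"] conjI allI impI)
    show "0 < x1\<^sup>2 + 1 / c" using x1 c by (simp add: add_pos_pos)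
    fix x assume x: "l \<le> x"
    have "x\<^sup>2 \<le> x1\<^sup>2 + V x / c"
    proof (cases "x1 \<le> x")
      case True then show ?thesis using far[OF True] c by (simp add: field_simps)
    next
      case False
      then have "x\<^sup>2 \<le> x1\<^sup>2" using x l_pos by (intro power_mono) auto
      then show ?thesis using V_nonneg[of x] c by (simp add: add_increasing2)
    qed
    also have "\<dots> \<le> (x1\<^sup>2 + 1 / c) * (1 + V x)"
      using V_nonneg[of x] c by (simp add: algebra_simps)
    finally show "x\<^sup>2 \<le> (x1\<^sup>2 + 1 / c) * (1 + V x)" .
  qed
qed

lemma V_at_top: "filterlim V at_top at_top"
proof -
  obtain C where C: "C > 0" "\<And>x. l \<le> x \<Longrightarrow> x\<^sup>2 \<le> C * (1 + V x)" using V_growth by blast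
  have "filterlim (\<lambda>x. x\<^sup>2 / C - 1) at_top at_top" using C(1) by real_asymp
  moreover have "\<forall>\<^sub>F x in at_top. x\<^sup>2 / C - 1 \<le> V x"
    using eventually_ge_at_top[of l] by eventually_elim (use C in \<open>simp add: field_simps\<close>)
  ultimately show ?thesis by (rule filterlim_at_top_mono)
qed

lemma square_integrable_N_near: "square_integrable N (\<lambda>x. if x \<le> l + 1 then 1 else 0)"
proof -
  have "set_integrable lborel {l..l+1} (\<lambda>x. 1 / rho x)"
    by (rule borel_integrable_atLeastAtMost') (intro continuous_intros rho_cont, use rho_pos_l in fastforce)
  then have "integrable lborel (\<lambda>x. indicator {l..l+1} x * (1 / rho x))" by (simp add: set_integrable_def)
  then have "integrable lborel (\<lambda>x. indicator {l<..} x / rho x * (if x \<le> l + 1 then 1 else 0)\<^sup>2)"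
  proof (rule Bochner_Integration.integrable_bound)
    show "AE x in lborel. norm (indicator {l<..} x / rho x * (if x \<le> l + 1 then 1 else 0)\<^sup>2) \<le> norm (indicator {l..l+1} x * (1 / rho x))"
      by (intro AE_I2) (auto simp: indicator_def)
  qed measurable
  then show ?thesis by (simp add: square_integrable_def integrable_N)
qed

text \<open>Beyond l + 1 the weight 1 / \<rho> is at most a multiple of V', and V' / V^2 is the
  derivative of -1 / V. The cut at l + 1 avoids the zero of \<open>V\<close> at
  \<open>l\<close>.\<close>

lemma square_integrable_N_far: "square_integrable N (\<lambda>x. if x \<le> l + 1 then 0 else 1 / V x)"
proof -
  define x1 where "x1 = l + 1"
  have x1: "l < x1" by (simp add: x1_def)
  have R1: "0 < R x1" using R_strict[of l x1] R_low[of l] x1 by simp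
  have "(\<integral>\<^sup>+x. ennreal (V' x / (V x)\<^sup>2) * indicator {x1..} x \<partial>lborel) = ennreal (0 - (- (1 / V x1)))"
  proof -
    let ?f = "\<lambda>x. indicator {l..} x * V' x / (V x)\<^sup>2"
    have [measurable]: "(\<lambda>x. indicator {l..} x * V' x) \<in> borel_measurable borel"
      using borel_measurable_continuous_on_indicator[OF _ V'_cont] by simp
    have "(\<integral>\<^sup>+x. ennreal (?f x) * indicator {x1..} x \<partial>lborel) = ennreal (0 - (- (1 / V x1)))"
    proof (rule nn_integral_FTC_atLeast)
      show "?f \<in> borel_measurable borel" by measurable
      fix x assume x: "x1 \<le> x"
      have lx: "l < x" using x x1 by simp
      have "((\<lambda>x. - (1 / V x)) has_real_derivative V' x / (V x)\<^sup>2) (at x)"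
        using has_derivative_at_interior[OF V_deriv_within[of x] lx] V_pos[OF lx] lx
        by (auto intro!: derivative_eq_intros simp: power2_eq_square)
      then show "((\<lambda>x. - (1 / V x)) has_real_derivative ?f x) (at x)" using lx by simp
      show "0 \<le> ?f x" using V'_nonneg lx by (simp add: indicator_def)
    next
      show "((\<lambda>x. - (1 / V x)) \<longlongrightarrow> 0) at_top"
        using tendsto_minus[OF tendsto_divide_0[OF tendsto_const filterlim_at_top_imp_at_infinity[OF V_at_top], of 1]] by simp
    qed
    moreover have "(\<integral>\<^sup>+x. ennreal (?f x) * indicator {x1..} x \<partial>lborel) = (\<integral>\<^sup>+x. ennreal (V' x / (V x)\<^sup>2) * indicator {x1..} x \<partial>lborel)"
      by (rule nn_integral_cong) (use x1 in \<open>auto simp: indicator_def\<close>)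
    ultimately show ?thesis by simp
  qed
  then have fin: "(\<integral>\<^sup>+x. ennreal (V' x / (V x)\<^sup>2) * indicator {x1..} x \<partial>lborel) < \<infinity>" by simp
  have "(\<integral>\<^sup>+x. ennreal (norm (indicator {l<..} x / rho x * (if x \<le> l + 1 then 0 else 1 / V x)\<^sup>2)) \<partial>lborel)
     \<le> (\<integral>\<^sup>+x. ennreal (1 / (4 * R x1)) * (ennreal (V' x / (V x)\<^sup>2) * indicator {x1..} x) \<partial>lborel)"
  proof (rule nn_integral_mono)
    fix x :: real
    show "ennreal (norm (indicator {l<..} x / rho x * (if x \<le> l + 1 then 0 else 1 / V x)\<^sup>2)) \<le> ennreal (1 / (4 * R x1)) * (ennreal (V' x / (V x)\<^sup>2) * indicator {x1..} x)"
    proof (cases "x \<le> l + 1")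
      case False
      then have x: "x1 < x" "l < x" by (auto simp: x1_def)
      have p: "0 < rho x" "0 < V x" using x rho_pos_l V_pos by auto
      have "R x1 \<le> R x" using monoD[OF R_mono, of x1 x] x by simp
      then have "1 \<le> R x / R x1" using R1 by simp
      then have "1 / rho x * (1 / V x)\<^sup>2 * 1 \<le> 1 / rho x * (1 / V x)\<^sup>2 * (R x / R x1)"
        using p by (intro mult_left_mono) auto
      also have "\<dots> = 1 / (4 * R x1) * (V' x / (V x)\<^sup>2)" by (simp add: V'_def power_divide)
      finally have "1 / rho x * (1 / V x)\<^sup>2 \<le> 1 / (4 * R x1) * (V' x / (V x)\<^sup>2)" by simp
      moreover have "0 \<le> V' x / (V x)\<^sup>2" using V'_nonneg x by simp
      ultimately show ?thesis using False x p R1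
        by (simp add: ennreal_mult[symmetric] ennreal_leI)
    qed simp
  qed
  also have "\<dots> < \<infinity>"
  proof -
    have [measurable]: "(\<lambda>x. ennreal (V' x / (V x)\<^sup>2) * indicator {x1..} x) \<in> borel_measurable borel"
    proof -
      have [measurable]: "(\<lambda>x. indicator {l..} x * V' x) \<in> borel_measurable borel"
        using borel_measurable_continuous_on_indicator[OF _ V'_cont] by simp
      have "(\<lambda>x. ennreal ((indicator {l..} x * V' x) / (V x)\<^sup>2) * indicator {x1..} x) \<in> borel_measurable borel" by measurable
      also have "(\<lambda>x. ennreal ((indicator {l..} x * V' x) / (V x)\<^sup>2) * indicator {x1..} x) = (\<lambda>x. ennreal (V' x / (V x)\<^sup>2) * indicator {x1..} x)"
        using x1 by (auto simp: fun_eq_iff indicator_def)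
      finally show ?thesis .
    qed
    show ?thesis using fin by (subst nn_integral_cmult) (auto simp: ennreal_mult_less_top)
  qed
  finally have "integrable lborel (\<lambda>x. indicator {l<..} x / rho x * (if x \<le> l + 1 then 0 else 1 / V x)\<^sup>2)"
    by (intro integrableI_bounded) auto
  then show ?thesis by (simp add: square_integrable_def integrable_N)
qed

lemma square_integrable_N_Rb: "square_integrable N Rb"
proof -
  obtain C where C: "C > 0" "\<And>x. l \<le> x \<Longrightarrow> Rb x \<le> C * rho x / x" using mills_ratio by blast
  have "integrable lborel (\<lambda>x. indicator {l<..} x / rho x * (Rb x)\<^sup>2)"
  proof (rule Bochner_Integration.integrable_bound)
    show "integrable lborel (\<lambda>x. (C / l)\<^sup>2 * rho x)" using rho_integrable by simp
    show "AE x in lborel. norm (indicator {l<..} x / rho x * (Rb x)\<^sup>2) \<le> norm ((C / l)\<^sup>2 * rho x)"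
    proof (rule AE_I2)
      fix x
      show "norm (indicator {l<..} x / rho x * (Rb x)\<^sup>2) \<le> norm ((C / l)\<^sup>2 * rho x)"
      proof (cases "l < x")
        case True
        have p: "0 < rho x" "0 < x" using True rho_pos_l l_pos by auto
        have "Rb x \<le> C * rho x / x" using C(2)[of x] True by simp
        also have "\<dots> \<le> C * rho x / l" using True C(1) p l_pos by (intro divide_left_mono) auto
        finally have "Rb x \<le> C / l * rho x" by simp
        then have "(Rb x)\<^sup>2 \<le> (C / l * rho x)\<^sup>2" using Rb_nonneg by (intro power_mono) auto
        then have "1 / rho x * (Rb x)\<^sup>2 \<le> 1 / rho x * (C / l * rho x)\<^sup>2" using p by (intro mult_left_mono) auto
        also have "\<dots> = (C / l)\<^sup>2 * rho x" using p by (simp add: power_mult_distrib power2_eq_square)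
        finally show ?thesis using True p by simp
      qed simp
    qed
  qed measurable
  then show ?thesis by (simp add: square_integrable_def integrable_N)
qed

section \<open>The Poisson equation\<close>

definition nuf :: "(real \<Rightarrow> real) \<Rightarrow> real" where "nuf f = (LBINT u:{l..}. f u * rho u) / Z"
text \<open>One integration of (\<rho> (K f)')' = 4 \<rho> (\<nu>(f) - f) from \<open>l\<close>,
  with zero flux at the barrier, gives \<rho> (K f)' = 4 S f; this is where \<open>dK\<close> and
  \<open>K\<close> come from.\<close>

definition S :: "(real \<Rightarrow> real) \<Rightarrow> real \<Rightarrow> real" where "S f x = (LBINT u:{l..x}. (nuf f - f u) * rho u)"
definition dK :: "(real \<Rightarrow> real) \<Rightarrow> real \<Rightarrow> real" where "dK f x = 4 * S f x / rho x"
definition K :: "(real \<Rightarrow> real) \<Rightarrow> real \<Rightarrow> real" where "K f x = integral {l..x} (dK f)"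

context
  fixes f :: "real \<Rightarrow> real"
  assumes f_meas [measurable]: "f \<in> borel_measurable borel" and f_bound: "\<And>u. \<bar>f u\<bar> \<le> 1"
begin

lemma f_rho_integrable: "A \<in> sets borel \<Longrightarrow> set_integrable lborel A (\<lambda>u. f u * rho u)"
  by (rule bounded_rho_integrable[OF f_meas f_bound])

lemma nuf_bound: "\<bar>nuf f\<bar> \<le> 1"
proof -
  have "\<bar>LBINT u:{l..}. f u * rho u\<bar> \<le> (LBINT u:{l..}. \<bar>f u * rho u\<bar>)"
    using set_integral_norm_bound[OF f_rho_integrable[of "{l..}"]] by simp
  also have "\<dots> \<le> (LBINT u:{l..}. rho u)"
  proof (rule set_integral_mono)
    show "set_integrable lborel {l..} (\<lambda>u. \<bar>f u * rho u\<bar>)"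
      using set_integrable_abs[OF f_rho_integrable[of "{l..}"]] by simp
    show "\<bar>f u * rho u\<bar> \<le> rho u" if "u \<in> {l..}" for u
      using f_bound[of u] rho_pos_l[of u] that by (simp add: abs_mult mult_left_le_one_le)
  qed (rule rho_set_integrable, simp)
  also have "\<dots> = Z" by (simp add: Z_eq(2))
  finally show ?thesis using Z_pos by (simp add: nuf_def)
qed

lemma S_integrable: "A \<in> sets borel \<Longrightarrow> set_integrable lborel A (\<lambda>u. (nuf f - f u) * rho u)"
  by (rule bounded_rho_integrable[where K = 2])
     (auto intro: order_trans[OF abs_triangle_ineq4 add_mono[OF nuf_bound f_bound], simplified])

lemma S_total: "(LBINT u:{l..}. (nuf f - f u) * rho u) = 0"
proof -
  have "(LBINT u:{l..}. (nuf f - f u) * rho u) = (LBINT u:{l..}. nuf f * rho u - f u * rho u)"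
    by (simp add: left_diff_distrib)
  also have "\<dots> = nuf f * Z - (LBINT u:{l..}. f u * rho u)"
    using rho_set_integrable[of "{l..}"] f_rho_integrable[of "{l..}"] by (simp add: Z_eq(2))
  also have "\<dots> = 0" using Z_pos by (simp add: nuf_def)
  finally show ?thesis .
qed

text \<open>Centring by \<nu>(f) makes the full integral vanish, so the integral up to x is minus
  the integral beyond x. This yields a bound that decays with \<rho>, as the division by \<rho> in
  \<open>dK\<close> requires.\<close>

lemma S_bound: assumes x: "l \<le> x" shows "\<bar>S f x\<bar> \<le> 2 * Rb x"
proof -
  have "(LBINT u:{l..x} \<union> {x<..}. (nuf f - f u) * rho u) = S f x + (LBINT u:{x<..}. (nuf f - f u) * rho u)"
    unfolding S_def by (rule set_integral_Un) (auto intro: S_integrable)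
  moreover have "{l..x} \<union> {x<..} = {l..}" using x by auto
  ultimately have "S f x = - (LBINT u:{x<..}. (nuf f - f u) * rho u)" using S_total by simp
  then have "\<bar>S f x\<bar> = \<bar>LBINT u:{x<..}. (nuf f - f u) * rho u\<bar>" by simp
  also have "\<dots> \<le> (LBINT u:{x<..}. \<bar>(nuf f - f u) * rho u\<bar>)"
    using set_integral_norm_bound[OF S_integrable[of "{x<..}"]] by simp
  also have "\<dots> \<le> (LBINT u:{x<..}. 2 * rho u)"
  proof (rule set_integral_mono)
    show "set_integrable lborel {x<..} (\<lambda>u. \<bar>(nuf f - f u) * rho u\<bar>)"
      using set_integrable_abs[OF S_integrable[of "{x<..}"]] by simp
    show "\<bar>(nuf f - f u) * rho u\<bar> \<le> 2 * rho u" if "u \<in> {x<..}" for u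
    proof -
      have "\<bar>nuf f - f u\<bar> \<le> 2" using nuf_bound f_bound[of u] by simp
      moreover have "0 < rho u" using rho_pos_l[of u] that x by simp
      ultimately show ?thesis by (simp add: abs_mult)
    qed
    show "set_integrable lborel {x<..} (\<lambda>u. 2 * rho u)" using rho_set_integrable[of "{x<..}"] by simp
  qed
  also have "\<dots> = 2 * Rb x" using Rb_eq[OF x] by simp
  finally show ?thesis .
qed

lemma S_l: "S f l = 0"
proof -
  have "AE u in lborel. indicator {l..l} u *\<^sub>R ((nuf f - f u) * rho u) = 0"
    using AE_lborel_singleton[of l] by eventually_elim (auto simp: indicator_def)
  then show ?thesis unfolding S_def set_lebesgue_integral_def by (rule integral_eq_zero_AE)
qed

text \<open>Only the bound 1 on the modulus of \<open>f\<close> enters, which is what makes the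
  final estimate uniform over test functions.\<close>

lemma dK_bound:
  assumes C: "\<And>x. l \<le> x \<Longrightarrow> Rb x \<le> C * rho x / x" and x: "l \<le> x"
  shows "\<bar>dK f x\<bar> \<le> 8 * C / x"
proof -
  have p: "0 < rho x" "0 < x" using x rho_pos_l l_pos by auto
  have "\<bar>dK f x\<bar> = 4 * \<bar>S f x\<bar> / rho x" using p by (simp add: dK_def abs_mult)
  also have "\<dots> \<le> 4 * (2 * (C * rho x / x)) / rho x"
    using S_bound[OF x] C[OF x] p by (intro divide_right_mono mult_left_mono) auto
  also have "\<dots> = 8 * C / x" using p by simp
  finally show ?thesis .
qed

context
  assumes f_cont: "continuous_on UNIV f"
begin

lemma S_deriv: assumes x: "l \<le> x" shows "(S f has_real_derivative (nuf f - f x) * rho x) (at x within {l..})"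
proof -
  have c: "continuous_on {l..} (\<lambda>u. (nuf f - f u) * rho u)"
    by (intro continuous_intros rho_cont continuous_on_subset[OF f_cont]) auto
  have "S f = (\<lambda>u. integral {l..u} (\<lambda>u. (nuf f - f u) * rho u))"
    unfolding S_def by (rule ext, rule set_borel_integral_eq_integral(2)[OF S_integrable]) simp
  then show ?thesis using FTC_atLeast[OF c x] by simp
qed

lemma dK_deriv: "l \<le> x \<Longrightarrow> (dK f has_real_derivative 4 * (nuf f - f x) - 4 * b x * dK f x) (at x within {l..})"
  using quotient_rho_deriv[OF S_deriv, of x] rho_pos_l[of x] by (simp add: dK_def[abs_def])

lemma dK_cont: "continuous_on {l..} (dK f)"
  by (rule DERIV_continuous_on[OF dK_deriv]) auto

lemma K_deriv: "l \<le> x \<Longrightarrow> (K f has_real_derivative dK f x) (at x within {l..})"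
  unfolding K_def[abs_def] by (rule FTC_atLeast[OF dK_cont])

end
end

lemma dK_l: "\<lbrakk>f \<in> borel_measurable borel; \<And>u. \<bar>f u\<bar> \<le> 1\<rbrakk> \<Longrightarrow> dK f l = 0"
  by (simp add: dK_def S_l)

text \<open>Carries results from continuous test functions, for which Ito's formula is proved, to
  indicators, from which the kernel arises.\<close>

lemma bounded_convergence:
  assumes m: "\<And>n. f n \<in> borel_measurable borel" "\<And>n u. \<bar>f n u\<bar> \<le> 1" and lim: "\<And>u. (\<lambda>n. f n u) \<longlonglongrightarrow> f0 u"
    and x: "l \<le> x"
  shows "(\<lambda>n. nuf (f n)) \<longlonglongrightarrow> nuf f0" "(\<lambda>n. dK (f n) x) \<longlonglongrightarrow> dK f0 x"
proof -
  have m0 [measurable]: "f0 \<in> borel_measurable borel" by (rule borel_measurable_LIMSEQ_real[OF lim m(1)])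
  note [measurable] = m(1)
  have dom: "integrable lborel (\<lambda>u. 2 * \<bar>rho u\<bar>)" using rho_integrable by simp
  have "(\<lambda>n. LBINT u:{l..}. f n u * rho u) \<longlonglongrightarrow> (LBINT u:{l..}. f0 u * rho u)"
    unfolding set_lebesgue_integral_def
  proof (rule integral_dominated_convergence[OF _ _ dom])
    show "AE u in lborel. (\<lambda>n. indicator {l..} u *\<^sub>R (f n u * rho u)) \<longlonglongrightarrow> indicator {l..} u *\<^sub>R (f0 u * rho u)"
      by (intro AE_I2 tendsto_intros lim)
    show "AE u in lborel. norm (indicator {l..} u *\<^sub>R (f n u * rho u)) \<le> 2 * \<bar>rho u\<bar>" for n
      by (intro AE_I2) (use m(2)[of n] in \<open>auto simp: indicator_def abs_mult intro!: mult_right_mono order_trans[OF m(2)]\<close>)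
  qed measurable
  then show nul: "(\<lambda>n. nuf (f n)) \<longlonglongrightarrow> nuf f0"
    unfolding nuf_def using Z_pos by (intro tendsto_intros) auto
  have "(\<lambda>n. S (f n) x) \<longlonglongrightarrow> S f0 x"
    unfolding S_def set_lebesgue_integral_def
  proof (rule integral_dominated_convergence[OF _ _ dom])
    show "AE u in lborel. (\<lambda>n. indicator {l..x} u *\<^sub>R ((nuf (f n) - f n u) * rho u)) \<longlonglongrightarrow> indicator {l..x} u *\<^sub>R ((nuf f0 - f0 u) * rho u)"
      by (intro AE_I2 tendsto_intros lim nul)
    show "AE u in lborel. norm (indicator {l..x} u *\<^sub>R ((nuf (f n) - f n u) * rho u)) \<le> 2 * \<bar>rho u\<bar>" for n
    proof (rule AE_I2)
      fix u
      have "\<bar>nuf (f n) - f n u\<bar> \<le> 2" using nuf_bound[OF m(1,2), of n] m(2)[of n u] by simp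
      then show "norm (indicator {l..x} u *\<^sub>R ((nuf (f n) - f n u) * rho u)) \<le> 2 * \<bar>rho u\<bar>"
        by (auto simp: indicator_def abs_mult intro!: mult_right_mono)
    qed
  qed measurable
  then show "(\<lambda>n. dK (f n) x) \<longlonglongrightarrow> dK f0 x"
    unfolding dK_def using rho_pos_l[OF x] by (intro tendsto_intros) auto
qed

lemma nuf_indicator: assumes z: "l \<le> z" shows "nuf (indicator {z<..}) = Rb z / Z"
proof -
  have "(LBINT u:{l..}. indicator {z<..} u * rho u) = (LBINT u:{z<..}. rho u)"
    unfolding set_lebesgue_integral_def
    by (rule Bochner_Integration.integral_cong) (use z in \<open>auto simp: indicator_def\<close>)
  then show ?thesis by (simp add: nuf_def Rb_eq[OF z])
qed

text \<open>The link between the process and the operator: the Green kernel is \<rho> times the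
  gradient of the Poisson solution for the indicator of the half line beyond z. Thus
  \<open>T (F t) z\<close> measures how far the mean of that solution is from equilibrium.\<close>

lemma dK_indicator:
  assumes z: "l \<le> z" and x: "l \<le> x"
  shows "dK (indicator {z<..}) x = k x z / rho x"
proof -
  have tail: "(LBINT u:{l..x}. indicator {z<..} u * rho u) = R x - R (min x z)"
  proof (cases "x \<le> z")
    case True
    then have "(\<lambda>u. indicator {l..x} u *\<^sub>R (indicator {z<..} u * rho u)) = (\<lambda>_. 0)"
      by (auto simp: fun_eq_iff indicator_def)
    then show ?thesis using True by (simp add: set_lebesgue_integral_def min_def)
  next
    case False
    have "(LBINT u:{l..z} \<union> {z<..x}. rho u) = (LBINT u:{l..z}. rho u) + (LBINT u:{z<..x}. rho u)"
      by (rule set_integral_Un) (auto intro: rho_set_integrable)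
    moreover have "{l..z} \<union> {z<..x} = {l..x}" using False z by auto
    moreover have "(LBINT u:{l..x}. indicator {z<..} u * rho u) = (LBINT u:{z<..x}. rho u)"
      unfolding set_lebesgue_integral_def
      by (rule Bochner_Integration.integral_cong) (use z in \<open>auto simp: indicator_def\<close>)
    ultimately show ?thesis using False by (simp add: R_eq min_def)
  qed
  have "S (indicator {z<..}) x = (LBINT u:{l..x}. Rb z / Z * rho u - indicator {z<..} u * rho u)"
    unfolding S_def nuf_indicator[OF z] by (simp add: left_diff_distrib)
  also have "\<dots> = Rb z / Z * R x - (R x - R (min x z))"
    using rho_set_integrable[of "{l..x}"] bounded_rho_integrable[of "indicator {z<..}" 1 "{l..x}"]
    by (subst set_integral_diff) (auto simp: tail R_eq)
  also have "\<dots> = R (min x z) * Rb (max x z) / Z"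
    using Z_pos by (cases "x \<le> z") (auto simp: min_def max_def Rb_def field_simps)
  finally show ?thesis by (simp add: dK_def k_def)
qed

lemma nu_integral:
  assumes [measurable]: "f \<in> borel_measurable borel"
  shows "(\<integral>x. f x \<partial>nu_a d r a) = nuf f" "integrable (nu_a d r a) f \<longleftrightarrow> set_integrable lborel {l..} (\<lambda>u. f u * rho u)"
proof -
  let ?w = "\<lambda>x. rho x * indicator {l<..} x / Z"
  have w: "0 \<le> ?w x" for x using rho_pos_l[of x] Z_pos by (auto simp: indicator_def intro!: divide_nonneg_pos)
  have nu: "nu_a d r a = density lborel (\<lambda>x. ennreal (?w x))" by (simp add: nu_a_def rho_def l_def)
  have eq: "AE x in lborel. ?w x * f x = (indicator {l..} x *\<^sub>R (f x * rho x)) / Z"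
    using AE_ge_eq_gt[of l] by eventually_elim simp
  have "(\<integral>x. f x \<partial>nu_a d r a) = (\<integral>x. ?w x * f x \<partial>lborel)"
    unfolding nu by (rule integral_real_density) (use w in auto)
  also have "\<dots> = (\<integral>x. (indicator {l..} x *\<^sub>R (f x * rho x)) / Z \<partial>lborel)"
    by (rule integral_cong_AE[OF _ _ eq]) measurable
  also have "\<dots> = nuf f" by (simp add: nuf_def set_lebesgue_integral_def)
  finally show "(\<integral>x. f x \<partial>nu_a d r a) = nuf f" .
  have "integrable (nu_a d r a) f \<longleftrightarrow> integrable lborel (\<lambda>x. ?w x * f x)"
    unfolding nu by (rule integrable_real_density) (use w in auto)
  also have "\<dots> \<longleftrightarrow> integrable lborel (\<lambda>x. (indicator {l..} x *\<^sub>R (f x * rho x)) / Z)"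
    by (rule integrable_cong_AE[OF _ _ eq]) measurable
  also have "\<dots> \<longleftrightarrow> set_integrable lborel {l..} (\<lambda>u. f u * rho u)"
    using Z_pos by (simp add: set_integrable_def divide_inverse)
  finally show "integrable (nu_a d r a) f \<longleftrightarrow> set_integrable lborel {l..} (\<lambda>u. f u * rho u)" .
qed

lemma sets_nu_a [simp, measurable_cong]: "sets (nu_a d r a) = sets borel"
  and space_nu_a [simp]: "space (nu_a d r a) = UNIV"
  by (auto simp: nu_a_def)

lemma nu_prob: "prob_space (nu_a d r a)"
proof
  have "emeasure (nu_a d r a) UNIV = (\<integral>\<^sup>+x. 1 \<partial>nu_a d r a)" by simp
  also have "\<dots> = ennreal (\<integral>x. 1 \<partial>nu_a d r a)"
    using nn_integral_eq_integral[of "nu_a d r a" "\<lambda>_. 1"] nu_integral(2)[of "\<lambda>_. 1"] rho_set_integrable[of "{l..}"] by simp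
  also have "(\<integral>x. 1 \<partial>nu_a d r a) = nuf (\<lambda>_. 1)" by (rule nu_integral) simp
  also have "nuf (\<lambda>_. 1) = 1" using Z_pos by (simp add: nuf_def Z_eq(2)[symmetric])
  finally show "emeasure (nu_a d r a) (space (nu_a d r a)) = 1" by simp
qed

end

section \<open>Moment bounds and the Fokker-Planck equation\<close>


lemma pos_part_square_deriv: "((\<lambda>u::real. (max 0 u)\<^sup>2) has_real_derivative 2 * max 0 u) (at u)"
proof -
  consider "0 < u" | "u < 0" | "u = 0" by linarith
  then show ?thesis
  proof cases
    case 1
    have "((\<lambda>u::real. u\<^sup>2) has_real_derivative 2 * max 0 u) (at u)"
      using 1 by (auto intro!: derivative_eq_intros)
    then show ?thesis
      by (rule has_field_derivative_transform_within_open[of _ _ _ "{0<..}"]) (use 1 in auto)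
  next
    case 2
    have "((\<lambda>u::real. 0) has_real_derivative 2 * max 0 u) (at u)"
      using 2 by simp
    then show ?thesis
      by (rule has_field_derivative_transform_within_open[of _ _ _ "{..<0}"]) (use 2 in auto)
  next
    case 3
    have "((\<lambda>h::real. max 0 h) \<longlongrightarrow> max 0 0) (at 0)" by (intro tendsto_intros)
    moreover have "(\<lambda>h::real. ((max 0 (0 + h))\<^sup>2 - (max 0 0)\<^sup>2) / h) = (\<lambda>h. max 0 h)"
      by (auto simp: fun_eq_iff max_def power2_eq_square)
    ultimately show ?thesis unfolding 3 DERIV_def by simp
  qed
qed

lemma pos_part_cube_deriv: "((\<lambda>u::real. (max 0 u) ^ 3) has_real_derivative 3 * (max 0 u)\<^sup>2) (at u)"
proof -
  have "(\<lambda>u::real. (max 0 u) ^ 3) = (\<lambda>u. u * (max 0 u)\<^sup>2)"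
    by (auto simp: fun_eq_iff max_def power2_eq_square power3_eq_cube)
  moreover have "((\<lambda>u::real. u * (max 0 u)\<^sup>2) has_real_derivative 1 * (max 0 u)\<^sup>2 + 2 * max 0 u * u) (at u)"
    by (intro DERIV_mult DERIV_ident pos_part_square_deriv)
  moreover have "1 * (max 0 u)\<^sup>2 + 2 * max 0 u * u = 3 * (max 0 u)\<^sup>2"
    by (auto simp: max_def power2_eq_square)
  ultimately show ?thesis by (simp only:)
qed

lemma bounded_if_eventually_zero:
  fixes f :: "real \<Rightarrow> real"
  assumes "continuous_on {c..} f" "\<And>x. X < x \<Longrightarrow> f x = 0"
  shows "\<exists>G. \<forall>x\<ge>c. \<bar>f x\<bar> \<le> G"
proof -
  have "bounded (f ` {c..X})"
    by (intro compact_imp_bounded compact_continuous_image continuous_on_subset[OF assms(1)]) auto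
  then obtain G where G: "\<forall>z\<in>f ` {c..X}. norm z \<le> G" unfolding bounded_iff by blast
  show ?thesis
  proof (intro exI[of _ "max G 0"] allI impI)
    fix x assume "c \<le> x"
    then show "\<bar>f x\<bar> \<le> max G 0" using G assms(2)[of x] by (cases "x \<le> X") (auto simp: le_max_iff_disj)
  qed
qed

context reflected_sde
begin

text \<open>A concave truncation of the identity. Its derivative is the squared positive part of 1 -
  v / c, so the cube gives a continuous second derivative and both derivatives vanish for v \<ge>
  c.\<close>

definition cut :: "real \<Rightarrow> real \<Rightarrow> real" where "cut c v = c / 3 * (1 - (max 0 (1 - v / c)) ^ 3)"

lemma cut_deriv: "0 < c \<Longrightarrow> (cut c has_real_derivative (max 0 (1 - v / c))\<^sup>2) (at v)"
proof -
  assume c: "0 < c"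
  have i: "((\<lambda>v. 1 - v / c) has_real_derivative - (1 / c)) (at v)"
    using c by (auto intro!: derivative_eq_intros)
  have "((\<lambda>v. (max 0 (1 - v / c)) ^ 3) has_real_derivative 3 * (max 0 (1 - v / c))\<^sup>2 * (- (1 / c))) (at v)"
    by (rule DERIV_chain2[OF pos_part_cube_deriv i])
  then have "(cut c has_real_derivative c / 3 * (0 - 3 * (max 0 (1 - v / c))\<^sup>2 * (- (1 / c)))) (at v)"
    unfolding cut_def by (intro DERIV_cmult DERIV_diff DERIV_const)
  then show ?thesis using c by simp
qed

lemma cut_deriv2: "0 < c \<Longrightarrow> ((\<lambda>v. (max 0 (1 - v / c))\<^sup>2) has_real_derivative - (2 / c) * max 0 (1 - v / c)) (at v)"
proof -
  assume c: "0 < c"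
  have i: "((\<lambda>v. 1 - v / c) has_real_derivative - (1 / c)) (at v)"
    using c by (auto intro!: derivative_eq_intros)
  have "((\<lambda>v. (max 0 (1 - v / c))\<^sup>2) has_real_derivative 2 * max 0 (1 - v / c) * (- (1 / c))) (at v)"
    by (rule DERIV_chain2[OF pos_part_square_deriv i])
  then show ?thesis by (simp add: mult.commute)
qed

lemma cut_bounds:
  assumes c: "0 < c" and v: "0 \<le> v"
  shows "0 \<le> cut c v" "cut c v \<le> c" "cut c v \<le> v"
proof -
  define s where "s = max 0 (1 - v / c)"
  have s: "0 \<le> s" "s \<le> 1" using c v by (auto simp: s_def)
  then have s3: "0 \<le> s ^ 3" "s ^ 3 \<le> 1" by (auto intro: power_le_one)
  have cs: "cut c v = c / 3 * (1 - s ^ 3)" by (simp add: cut_def s_def)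
  show "0 \<le> cut c v" unfolding cs using c s3 by simp
  have "c / 3 * (1 - s ^ 3) \<le> c / 3 * 1" using c s3 by (intro mult_left_mono) auto
  also have "\<dots> \<le> c" using c by simp
  finally show cc: "cut c v \<le> c" unfolding cs .
  show "cut c v \<le> v"
  proof (cases "v \<le> c")
    case True
    then have sv: "v = c * (1 - s)" using c by (simp add: s_def max_def field_simps)
    have "0 \<le> (1 - s) * (s + 2) * (1 - s)" using s by simp
    then have "1 - s ^ 3 \<le> 3 * (1 - s)" by (simp add: power3_eq_cube algebra_simps)
    then have "c / 3 * (1 - s ^ 3) \<le> c / 3 * (3 * (1 - s))" using c by (intro mult_left_mono) auto
    also have "\<dots> = v" using sv by (simp only: times_divide_eq_left)
    finally show ?thesis unfolding cs .
  next
    case False then show ?thesis using cc by simp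
  qed
qed

text \<open>The truncation supplies the bounded derivatives that \<open>ito_expectation\<close>
  requires. The generator of the truncated function is cut'(V) L V + cut''(V) (V')^2 / 4, and
  concavity, L V = 1 and cut' \<le> 1 bound it by 1.\<close>

lemma V_cut_expectation:
  assumes c: "0 < c" and t: "0 < t"
  shows "expectation (\<lambda>\<omega>. cut c (V (y t \<omega>))) \<le> V y0 + t"
proof -
  define p where "p x = (max 0 (1 - V x / c))\<^sup>2" for x
  define p' where "p' x = - (2 / c) * max 0 (1 - V x / c)" for x
  define g' where "g' x = p x * V' x" for x
  define g'' where "g'' x = p' x * V' x * V' x + p x * (4 - 4 * b x * V' x)" for x
  have g: "((\<lambda>x. cut c (V x)) has_real_derivative g' x) (at x within {l..})" if "l \<le> x" for x
    unfolding g'_def p_def by (rule DERIV_chain2[OF cut_deriv[OF c] V_deriv_within[OF that]])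
  have pd: "(p has_real_derivative p' x * V' x) (at x within {l..})" if "l \<le> x" for x
    unfolding p_def p'_def by (rule DERIV_chain2[OF cut_deriv2[OF c] V_deriv_within[OF that]])
  have g'd: "(g' has_real_derivative g'' x) (at x within {l..})" if "l \<le> x" for x
    using DERIV_mult[OF pd[OF that] V'_deriv[OF that]] unfolding g'_def[abs_def] g''_def by (simp add: algebra_simps)
  have Vc: "continuous_on {l..} V" by (rule DERIV_continuous_on[OF V_deriv_within]) auto
  have bc: "continuous_on {l..} b" unfolding b_def using l_pos by (intro continuous_intros) auto
  have g'c: "continuous_on {l..} g'" unfolding g'_def p_def using c by (intro continuous_intros Vc V'_cont) auto
  have g''c: "continuous_on {l..} g''" unfolding g''_def p_def p'_def using c by (intro continuous_intros Vc V'_cont bc) auto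
  obtain X where X: "\<And>x. X \<le> x \<Longrightarrow> c \<le> V x"
    using V_at_top unfolding filterlim_at_top eventually_at_top_linorder by blast
  have z: "p x = 0" "p' x = 0" if "X < x" for x
  proof -
    have "1 - V x / c \<le> 0" using X[of x] that c by (simp add: field_simps)
    then show "p x = 0" "p' x = 0" by (auto simp: p_def p'_def max_def)
  qed
  obtain G1 where G1: "\<And>x. l \<le> x \<Longrightarrow> \<bar>g' x\<bar> \<le> G1"
    using bounded_if_eventually_zero[OF g'c, of X] z by (auto simp: g'_def)
  obtain G2 where G2: "\<And>x. l \<le> x \<Longrightarrow> \<bar>g'' x\<bar> \<le> G2"
    using bounded_if_eventually_zero[OF g''c, of X] z by (auto simp: g''_def)
  have "continuous_on {l..} (\<lambda>x. b x * g' x)" by (intro continuous_intros bc g'c)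
  then obtain G3 where G3: "\<And>x. l \<le> x \<Longrightarrow> \<bar>b x * g' x\<bar> \<le> G3"
    using bounded_if_eventually_zero[of l "\<lambda>x. b x * g' x" X] z by (auto simp: g'_def)
  define G where "G = max G1 (max G2 G3)"
  have [measurable]: "cut c \<in> borel_measurable borel"
    unfolding cut_def by measurable
  have [measurable]: "y t \<in> borel_measurable M" using t by simp
  have sq: "square_integrable M (\<lambda>\<omega>. cut c (V (y t \<omega>)))"
  proof (rule square_integrable_bound[where f = "\<lambda>_. c"])
    show "AE \<omega> in M. \<bar>cut c (V (y t \<omega>))\<bar> \<le> c" using cut_bounds[OF c V_nonneg] by simp
  qed (auto simp: square_integrable_def)
  define gen where "gen u = b (max l u) * g' (max l u) + g'' (max l u) / 4" for u
  have gen_le: "gen u \<le> 1" for u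
  proof -
    define x where "x = max l u"
    have "gen u = p x + p' x * (V' x)\<^sup>2 / 4"
      unfolding gen_def x_def[symmetric] g'_def g''_def by (simp add: field_simps power2_eq_square)
    also have "\<dots> \<le> p x"
    proof -
      have "p' x \<le> 0" using c by (simp add: p'_def)
      then have "p' x * (V' x)\<^sup>2 \<le> 0" by (intro mult_nonpos_nonneg) auto
      then show ?thesis by simp
    qed
    also have "\<dots> \<le> 1" unfolding p_def using c V_nonneg[of x] by (intro power_le_one) auto
    finally show ?thesis .
  qed
  have "expectation (\<lambda>\<omega>. cut c (V (y t \<omega>))) = cut c (V y0) + integral {0..t} (\<lambda>s. expectation (\<lambda>\<omega>. gen (y s \<omega>)))"
    unfolding gen_def
    by (rule ito_expectation[OF g g'd g''c, of G]) (use G1 G2 G3 sq t in \<open>auto simp: G_def le_max_iff_disj g'_def V'_def R_low\<close>)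
  also have "\<dots> \<le> V y0 + t"
  proof (rule add_mono)
    show "cut c (V y0) \<le> V y0" by (rule cut_bounds[OF c V_nonneg])
    have ext: "continuous_on UNIV (\<lambda>u. \<phi> (max l u))" if "continuous_on {l..} \<phi>" for \<phi> :: "real \<Rightarrow> real"
      by (rule continuous_on_compose2[OF that]) (auto intro!: continuous_intros)
    have genc: "continuous_on UNIV gen"
      unfolding gen_def[abs_def] by (intro continuous_intros ext bc g'c g''c) auto
    have genb: "\<bar>gen u\<bar> \<le> G3 + G2" for u
    proof -
      have "\<bar>gen u\<bar> \<le> \<bar>b (max l u) * g' (max l u)\<bar> + \<bar>g'' (max l u)\<bar>" unfolding gen_def by linarith
      then show ?thesis using G3[of "max l u"] G2[of "max l u"] by simp
    qed
    have [measurable]: "gen \<in> borel_measurable borel" by (rule borel_measurable_continuous_onI[OF genc])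
    have "integral {0..t} (\<lambda>s. expectation (\<lambda>\<omega>. gen (y s \<omega>))) \<le> integral {0..t} (\<lambda>s. 1)"
    proof (rule integral_le)
      show "(\<lambda>s. expectation (\<lambda>\<omega>. gen (y s \<omega>))) integrable_on {0..t}"
        by (rule integrable_continuous_real[OF continuous_on_subset[OF expectation_continuous[OF genc genb]]]) auto
      show "expectation (\<lambda>\<omega>. gen (y s \<omega>)) \<le> 1" if "s \<in> {0..t}" for s
      proof -
        have [measurable]: "y s \<in> borel_measurable M" using that by simp
        have "integrable M (\<lambda>\<omega>. gen (y s \<omega>))"
          by (rule integrable_const_bound[where B = "G3 + G2"]) (use genb in auto)
        then have "expectation (\<lambda>\<omega>. gen (y s \<omega>)) \<le> expectation (\<lambda>_. 1)"
          by (intro integral_mono) (use gen_le in auto)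
        then show ?thesis by (simp add: prob_space)
      qed
    qed auto
    then show "integral {0..t} (\<lambda>s. expectation (\<lambda>\<omega>. gen (y s \<omega>))) \<le> t" using t by simp
  qed
  finally show ?thesis .
qed

lemma AE_y_0: "AE \<omega> in M. y 0 \<omega> = y0"
  using AE_path by eventually_elim simp

text \<open>Fatou's lemma removes the truncation, since its bound is independent of the
  level.\<close>

lemma V_nn_expectation:
  assumes t: "0 \<le> t" shows "(\<integral>\<^sup>+\<omega>. ennreal (V (y t \<omega>)) \<partial>M) \<le> ennreal (V y0 + t)"
proof (cases "t = 0")
  case True
  have "(\<integral>\<^sup>+\<omega>. ennreal (V (y t \<omega>)) \<partial>M) = (\<integral>\<^sup>+\<omega>. ennreal (V y0) \<partial>M)"
    by (rule nn_integral_cong_AE) (use AE_y_0 True in \<open>auto elim: eventually_mono\<close>)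
  then show ?thesis using True by (simp add: emeasure_space_1)
next
  case False
  then have t0: "0 < t" using t by simp
  have [measurable]: "y t \<in> borel_measurable M" using t by simp
  have [measurable]: "cut c \<in> borel_measurable borel" for c unfolding cut_def by measurable
  have lim: "(\<lambda>n. cut (real (Suc n)) v) \<longlonglongrightarrow> v" if v: "0 \<le> v" for v
  proof -
    have "(\<lambda>n. real (Suc n) / 3 * (1 - (1 - v / real (Suc n)) ^ 3)) \<longlonglongrightarrow> v" by real_asymp
    moreover have "\<forall>\<^sub>F n in sequentially. real (Suc n) / 3 * (1 - (1 - v / real (Suc n)) ^ 3) = cut (real (Suc n)) v"
      using eventually_ge_at_top[of "nat \<lceil>v\<rceil>"]
    proof eventually_elim
      case (elim n)
      then have "v \<le> real (Suc n)" by linarith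
      then have "0 \<le> 1 - v / real (Suc n)" by (simp add: divide_le_eq)
      then show ?case by (simp add: cut_def max_def)
    qed
    ultimately show ?thesis by (rule Lim_transform_eventually)
  qed
  have "(\<integral>\<^sup>+\<omega>. ennreal (V (y t \<omega>)) \<partial>M) = (\<integral>\<^sup>+\<omega>. liminf (\<lambda>n. ennreal (cut (real (Suc n)) (V (y t \<omega>)))) \<partial>M)"
    by (intro nn_integral_cong lim_imp_Liminf[symmetric] tendsto_ennrealI lim V_nonneg) auto
  also have "\<dots> \<le> liminf (\<lambda>n. \<integral>\<^sup>+\<omega>. ennreal (cut (real (Suc n)) (V (y t \<omega>))) \<partial>M)"
    by (rule nn_integral_liminf) measurable
  also have "\<dots> \<le> ennreal (V y0 + t)"
  proof -
    have "(\<integral>\<^sup>+\<omega>. ennreal (cut (real (Suc n)) (V (y t \<omega>))) \<partial>M) \<le> ennreal (V y0 + t)" for n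
    proof -
      have "integrable M (\<lambda>\<omega>. cut (real (Suc n)) (V (y t \<omega>)))"
        by (rule integrable_const_bound[where B = "real (Suc n)"]) (use cut_bounds[of "real (Suc n)", OF _ V_nonneg] in auto)
      then have "(\<integral>\<^sup>+\<omega>. ennreal (cut (real (Suc n)) (V (y t \<omega>))) \<partial>M) = ennreal (expectation (\<lambda>\<omega>. cut (real (Suc n)) (V (y t \<omega>))))"
        by (rule nn_integral_eq_integral) (use cut_bounds[of "real (Suc n)", OF _ V_nonneg] in auto)
      also have "\<dots> \<le> ennreal (V y0 + t)" by (intro ennreal_leI V_cut_expectation t0) simp
      finally show ?thesis .
    qed
    then have "limsup (\<lambda>n. \<integral>\<^sup>+\<omega>. ennreal (cut (real (Suc n)) (V (y t \<omega>))) \<partial>M) \<le> ennreal (V y0 + t)"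
      by (intro Limsup_bounded) auto
    then show ?thesis by (rule order_trans[OF Liminf_le_Limsup, rotated]) simp
  qed
  finally show ?thesis .
qed

lemma V_integrable:
  assumes t: "0 \<le> t"
  shows "integrable M (\<lambda>\<omega>. V (y t \<omega>))" "expectation (\<lambda>\<omega>. V (y t \<omega>)) \<le> V y0 + t"
proof -
  have [measurable]: "y t \<in> borel_measurable M" using t by simp
  show i: "integrable M (\<lambda>\<omega>. V (y t \<omega>))"
    by (rule integrableI_bounded) (use le_less_trans[OF V_nn_expectation[OF t]] V_nonneg in auto)
  have "ennreal (expectation (\<lambda>\<omega>. V (y t \<omega>))) \<le> ennreal (V y0 + t)"
    using nn_integral_eq_integral[OF i] V_nn_expectation[OF t] V_nonneg by simp
  then show "expectation (\<lambda>\<omega>. V (y t \<omega>)) \<le> V y0 + t" using V_nonneg[of y0] t by (subst (asm) ennreal_le_iff) auto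
qed

lemma y_square_integrable: assumes t: "0 \<le> t" shows "square_integrable M (y t)"
proof -
  have [measurable]: "y t \<in> borel_measurable M" using t by simp
  obtain C where C: "C > 0" "\<And>x. l \<le> x \<Longrightarrow> x\<^sup>2 \<le> C * (1 + V x)" using V_growth by blast
  have "integrable M (\<lambda>\<omega>. (y t \<omega>)\<^sup>2)"
  proof (rule Bochner_Integration.integrable_bound)
    show "integrable M (\<lambda>\<omega>. C * (1 + V (y t \<omega>)))" using V_integrable[OF t] by simp
    show "AE \<omega> in M. norm ((y t \<omega>)\<^sup>2) \<le> norm (C * (1 + V (y t \<omega>)))"
      using AE_ge[OF t] by eventually_elim (use C in \<open>auto intro: order_trans[OF _ abs_ge_self]\<close>)
  qed measurable
  then show ?thesis by (simp add: square_integrable_def)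
qed

section \<open>Ito's formula for Poisson solutions\<close>

context
  fixes f :: "real \<Rightarrow> real"
  assumes f_cont: "continuous_on UNIV f" and f_bound: "\<And>u. \<bar>f u\<bar> \<le> 1"
begin

lemma f_meas: "f \<in> borel_measurable borel"
  by (rule borel_measurable_continuous_onI[OF f_cont])

lemma K_low: "x \<le> l \<Longrightarrow> K f x = 0"
  by (cases "x = l") (auto simp: K_def)

lemma K_cont: "continuous_on UNIV (K f)"
proof -
  have "continuous_on {l..} (K f)" by (rule DERIV_continuous_on[OF K_deriv[OF f_meas f_bound f_cont]]) auto
  then have "continuous_on UNIV (\<lambda>x. K f (max l x))"
    by (rule continuous_on_compose2) (auto intro!: continuous_intros)
  also have "(\<lambda>x. K f (max l x)) = K f" using K_low by (auto simp: fun_eq_iff max_def)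
  finally show ?thesis .
qed

lemma K_measurable: "K f \<in> borel_measurable borel"
  by (rule borel_measurable_continuous_onI[OF K_cont])

text \<open>The gradient decays like 1 / x, which offsets the linear growth of the drift. These are
  the bounds needed to put the unbounded function \<open>K f\<close> into
  \<open>ito_expectation\<close>.\<close>

lemma dK_const_bound: "\<exists>C\<ge>0. \<forall>x\<ge>l. \<bar>dK f x\<bar> \<le> C \<and> \<bar>b x * dK f x\<bar> \<le> C"
proof -
  obtain C where C: "C > 0" "\<And>x. l \<le> x \<Longrightarrow> Rb x \<le> C * rho x / x" using mills_ratio by blast
  define C1 where "C1 = 8 * C / l"
  define C2 where "C2 = 2 * a * (8 * C) + (real d - 1) / (4 * l) * C1"
  have C1: "0 \<le> C1" using C l_pos by (simp add: C1_def)
  have C2: "0 \<le> C2" using C C1 l_pos a d1_pos by (simp add: C2_def)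
  have b1: "\<bar>dK f x\<bar> \<le> C1" if "l \<le> x" for x
  proof -
    have "\<bar>dK f x\<bar> \<le> 8 * C / x" by (rule dK_bound[OF f_meas f_bound C(2) that])
    also have "\<dots> \<le> C1" unfolding C1_def using that l_pos C(1) by (intro divide_left_mono) auto
    finally show ?thesis .
  qed
  have b2: "\<bar>b x * dK f x\<bar> \<le> C2" if x: "l \<le> x" for x
  proof -
    have x0: "0 < x" using x l_pos by simp
    have "\<bar>x * dK f x\<bar> \<le> 8 * C"
      using dK_bound[OF f_meas f_bound C(2) x] x0 by (simp add: abs_mult field_simps)
    then have e1: "2 * a * \<bar>x * dK f x\<bar> \<le> 2 * a * (8 * C)" using a by (intro mult_left_mono) auto
    have e2: "(real d - 1) / (4 * x) * \<bar>dK f x\<bar> \<le> (real d - 1) / (4 * l) * C1"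
      using b1[OF x] x x0 l_pos d1_pos by (intro mult_mono divide_left_mono) auto
    have "b x * dK f x = - (2 * a * (x * dK f x)) + (real d - 1) / (4 * x) * dK f x"
      by (simp add: b_def algebra_simps)
    also have "\<bar>\<dots>\<bar> \<le> \<bar>2 * a * (x * dK f x)\<bar> + \<bar>(real d - 1) / (4 * x) * dK f x\<bar>" by linarith
    also have "\<dots> = 2 * a * \<bar>x * dK f x\<bar> + (real d - 1) / (4 * x) * \<bar>dK f x\<bar>"
      using a d1_pos x0 by (simp add: abs_mult)
    finally show ?thesis using e1 e2 unfolding C2_def by linarith
  qed
  show ?thesis
    by (rule exI[of _ "max C1 C2"]) (use C1 b1 b2 in \<open>auto simp: le_max_iff_disj\<close>)
qed

lemma K_linear_growth: "\<exists>C\<ge>0. \<forall>x\<ge>l. \<bar>K f x\<bar> \<le> C * x"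
proof -
  obtain C where C: "C \<ge> 0" "\<And>x. l \<le> x \<Longrightarrow> \<bar>dK f x\<bar> \<le> C" using dK_const_bound by blast
  show ?thesis
  proof (intro exI[of _ C] conjI allI impI C(1))
    fix x assume x: "l \<le> x"
    have "norm (K f x - K f l) \<le> C * norm (x - l)"
    proof (rule field_differentiable_bound[of "{l..}" "K f" "dK f"])
      show "(K f has_real_derivative dK f z) (at z within {l..})" if "z \<in> {l..}" for z
        using K_deriv[OF f_meas f_bound f_cont] that by simp
    qed (use C x in auto)
    also have "\<dots> \<le> C * x" using x l_pos C by (intro mult_left_mono) auto
    finally show "\<bar>K f x\<bar> \<le> C * x" by (simp add: K_low)
  qed
qed

lemma K_square_integrable: assumes t: "0 \<le> t" shows "square_integrable M (\<lambda>\<omega>. K f (y t \<omega>))"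
proof -
  have [measurable]: "y t \<in> borel_measurable M" using t by simp
  obtain C where C: "C \<ge> 0" "\<And>x. l \<le> x \<Longrightarrow> \<bar>K f x\<bar> \<le> C * x" using K_linear_growth by blast
  note [measurable] = K_measurable
  show ?thesis
  proof (rule square_integrable_bound[OF square_integrable_cmult[OF y_square_integrable[OF t], of C]])
    show "AE \<omega> in M. \<bar>K f (y t \<omega>)\<bar> \<le> C * y t \<omega>" using AE_ge[OF t] by eventually_elim (rule C(2))
  qed measurable
qed

text \<open>The generator sends \<open>K f\<close> to \<nu>(f) - f, and \<open>dK_l\<close> provides
  the Neumann condition.\<close>

lemma fokker_planck_from_0:
  assumes t: "0 \<le> t"
  shows "expectation (\<lambda>\<omega>. K f (y t \<omega>)) = K f y0 + integral {0..t} (\<lambda>s. nuf f - expectation (\<lambda>\<omega>. f (max l (y s \<omega>))))"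
proof (cases "t = 0")
  case True
  note [measurable] = K_measurable
  have [measurable]: "y 0 \<in> borel_measurable M" by simp
  have "expectation (\<lambda>\<omega>. K f (y 0 \<omega>)) = expectation (\<lambda>_. K f y0)"
    by (rule integral_cong_AE) (use AE_y_0 in \<open>auto elim: eventually_mono\<close>)
  then show ?thesis using True by (simp add: prob_space)
next
  case False
  then have t0: "0 < t" using t by simp
  note Kd = K_deriv[OF f_meas f_bound f_cont] and dKd = dK_deriv[OF f_meas f_bound f_cont]
  obtain C where C: "C \<ge> 0" "\<And>x. l \<le> x \<Longrightarrow> \<bar>dK f x\<bar> \<le> C" "\<And>x. l \<le> x \<Longrightarrow> \<bar>b x * dK f x\<bar> \<le> C" using dK_const_bound by blast
  have bc: "continuous_on {l..} b" unfolding b_def using l_pos by (intro continuous_intros) auto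
  define g'' where "g'' x = 4 * (nuf f - f x) - 4 * b x * dK f x" for x
  have g''c: "continuous_on {l..} g''"
    unfolding g''_def by (intro continuous_intros bc dK_cont[OF f_meas f_bound f_cont] continuous_on_subset[OF f_cont]) auto
  have g''b: "\<bar>g'' x\<bar> \<le> 8 + 4 * C" if "l \<le> x" for x
  proof -
    have "g'' x = 4 * nuf f - 4 * f x - 4 * (b x * dK f x)" by (simp add: g''_def algebra_simps)
    then show ?thesis using nuf_bound[OF f_meas f_bound] f_bound[of x] C(3)[OF that] by linarith
  qed
  have CG: "\<bar>dK f x\<bar> \<le> 8 + 4 * C" "\<bar>b x * dK f x\<bar> \<le> 8 + 4 * C" if "l \<le> x" for x
    using C(1) C(2,3)[OF that] by linarith+
  have "expectation (\<lambda>\<omega>. K f (y t \<omega>)) = K f y0 + integral {0..t} (\<lambda>s. expectation (\<lambda>\<omega>. b (max l (y s \<omega>)) * dK f (max l (y s \<omega>)) + g'' (max l (y s \<omega>)) / 4))"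
    by (rule ito_expectation[of "K f" "dK f" g'' "8 + 4 * C"])
       (use Kd dKd g''c g''b CG dK_l[OF f_meas f_bound] t0 K_square_integrable[OF t] in \<open>auto simp: g''_def\<close>)
  also have "integral {0..t} (\<lambda>s. expectation (\<lambda>\<omega>. b (max l (y s \<omega>)) * dK f (max l (y s \<omega>)) + g'' (max l (y s \<omega>)) / 4))
    = integral {0..t} (\<lambda>s. nuf f - expectation (\<lambda>\<omega>. f (max l (y s \<omega>))))"
  proof (rule integral_cong)
    fix s assume "s \<in> {0..t}"
    then have [measurable]: "y s \<in> borel_measurable M" by simp
    note [measurable] = f_meas
    have i: "integrable M (\<lambda>\<omega>. f (max l (y s \<omega>)))"
      by (rule integrable_const_bound[where B = 1]) (use f_bound in auto)
    have "expectation (\<lambda>\<omega>. b (max l (y s \<omega>)) * dK f (max l (y s \<omega>)) + g'' (max l (y s \<omega>)) / 4) = expectation (\<lambda>\<omega>. nuf f - f (max l (y s \<omega>)))"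
      by (rule Bochner_Integration.integral_cong) (auto simp: g''_def field_simps)
    also have "\<dots> = nuf f - expectation (\<lambda>\<omega>. f (max l (y s \<omega>)))" using i by (simp add: prob_space)
    finally show "expectation (\<lambda>\<omega>. b (max l (y s \<omega>)) * dK f (max l (y s \<omega>)) + g'' (max l (y s \<omega>)) / 4) = nuf f - expectation (\<lambda>\<omega>. f (max l (y s \<omega>)))" .
  qed
  finally show ?thesis .
qed

lemma expectation_max: assumes s: "0 \<le> s" shows "expectation (\<lambda>\<omega>. f (max l (y s \<omega>))) = expectation (\<lambda>\<omega>. f (y s \<omega>))"
proof -
  have [measurable]: "y s \<in> borel_measurable M" using s by simp
  note [measurable] = f_meas
  show ?thesis
    by (rule integral_cong_AE) (use AE_ge[OF s] in \<open>auto elim!: eventually_mono simp: max_def\<close>)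
qed

lemma fokker_planck:
  assumes st: "0 \<le> s" "s \<le> t"
  shows "expectation (\<lambda>\<omega>. K f (y t \<omega>)) - expectation (\<lambda>\<omega>. K f (y s \<omega>)) = integral {s..t} (\<lambda>u. nuf f - expectation (\<lambda>\<omega>. f (y u \<omega>)))"
proof -
  let ?m = "\<lambda>u. nuf f - expectation (\<lambda>\<omega>. f (y u \<omega>))"
  have e: "expectation (\<lambda>\<omega>. K f (y u \<omega>)) = K f y0 + integral {0..u} ?m" if u: "0 \<le> u" for u
  proof -
    have "integral {0..u} (\<lambda>s. nuf f - expectation (\<lambda>\<omega>. f (max l (y s \<omega>)))) = integral {0..u} ?m"
      by (rule integral_cong) (use expectation_max in auto)
    then show ?thesis using fokker_planck_from_0[OF u] by simp
  qed
  have "continuous_on {0..} ?m" by (intro continuous_intros expectation_continuous[OF f_cont f_bound])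
  then have "?m integrable_on {0..t}" by (intro integrable_continuous_real) (rule continuous_on_subset, auto)
  then have "integral {0..s} ?m + integral {s..t} ?m = integral {0..t} ?m"
    by (intro Henstock_Kurzweil_Integration.integral_combine) (use st in auto)
  then show ?thesis using e[of s] e[of t] st by simp
qed

end
end


section \<open>Tail differences of the law\<close>

context reflected_sde
begin

definition P :: "real \<Rightarrow> real \<Rightarrow> real" where "P t x = prob {\<omega> \<in> space M. x < y t \<omega>}"
definition F :: "real \<Rightarrow> real \<Rightarrow> real" where "F t x = P t x - Rb x / Z"
text \<open>Three sources: the trivial bound 1 near the barrier, where \<open>V\<close> may vanish;
  Markov's inequality for \<open>V\<close> further out, with the mean bounded up to time \<tau>; and
  the equilibrium tail.\<close>

definition H :: "real \<Rightarrow> real \<Rightarrow> real" where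
  "H \<tau> x = ((if x \<le> l + 1 then 1 else 0) + (V y0 + \<tau>) * (if x \<le> l + 1 then 0 else 1 / V x)) + 1 / Z * Rb x"

lemma P_sets [measurable]: "0 \<le> t \<Longrightarrow> {\<omega> \<in> space M. x < y t \<omega>} \<in> events"
  by measurable

lemma P_measurable [measurable]: assumes t: "0 \<le> t" shows "P t \<in> borel_measurable borel"
proof -
  have "mono (\<lambda>x. - P t x)"
    unfolding P_def by (intro monoI) (auto intro!: finite_measure_mono P_sets t)
  then have "(\<lambda>x. - (- P t x)) \<in> borel_measurable borel"
    by (intro borel_measurable_uminus borel_measurable_mono)
  then show ?thesis by simp
qed

lemma P_le_1: "P t x \<le> 1" by (simp add: P_def)
lemma P_nonneg: "0 \<le> P t x" by (simp add: P_def)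

lemma P_expectation: "0 \<le> t \<Longrightarrow> P t x = expectation (\<lambda>\<omega>. indicator {x<..} (y t \<omega>))"
proof -
  assume t: "0 \<le> t"
  have "expectation (\<lambda>\<omega>. indicator {x<..} (y t \<omega>)) = expectation (indicator {\<omega> \<in> space M. x < y t \<omega>})"
    by (rule Bochner_Integration.integral_cong) (auto simp: indicator_def)
  also have "\<dots> = prob {\<omega> \<in> space M. x < y t \<omega>}" using P_sets[OF t, of x] by simp
  finally show ?thesis by (simp add: P_def)
qed

lemma P_tail: assumes t: "0 \<le> t" and x: "l < x" shows "P t x \<le> (V y0 + t) / V x"
proof -
  have [measurable]: "y t \<in> borel_measurable M" using t by simp
  have "P t x * V x = expectation (\<lambda>\<omega>. indicator {x<..} (y t \<omega>) * V x)"
    using P_expectation[OF t, of x] by simp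
  also have "\<dots> \<le> expectation (\<lambda>\<omega>. V (y t \<omega>))"
  proof (rule integral_mono[OF _ V_integrable(1)[OF t]])
    show "integrable M (\<lambda>\<omega>. indicator {x<..} (y t \<omega>) * V x)"
      by (rule integrable_const_bound[where B = "V x"]) (use V_nonneg in \<open>auto simp: indicator_def\<close>)
    show "indicator {x<..} (y t \<omega>) * V x \<le> V (y t \<omega>)" for \<omega>
      using monoD[OF V_mono, of x "y t \<omega>"] V_nonneg[of "y t \<omega>"] by (auto simp: indicator_def)
  qed
  also have "\<dots> \<le> V y0 + t" by (rule V_integrable(2)[OF t])
  finally show ?thesis using V_pos[OF x] by (simp add: field_simps)
qed

lemma F_le_H:
  assumes t: "0 \<le> t" "t \<le> \<tau>" and x: "l < x"
  shows "\<bar>F t x\<bar> \<le> H \<tau> x"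
proof -
  have Rb0: "0 \<le> Rb x / Z" using Rb_nonneg Z_pos by simp
  have "P t x \<le> (if x \<le> l + 1 then 1 else 0) + (V y0 + \<tau>) * (if x \<le> l + 1 then 0 else 1 / V x)"
  proof (cases "x \<le> l + 1")
    case False
    have "P t x \<le> (V y0 + t) / V x" by (rule P_tail[OF t(1) x])
    also have "\<dots> \<le> (V y0 + \<tau>) / V x" using V_pos[OF x] t by (intro divide_right_mono) auto
    finally show ?thesis using False by simp
  qed (use P_le_1 in simp)
  then show ?thesis using Rb0 P_nonneg[of t x] by (simp add: F_def H_def)
qed

lemma H_square_integrable: "square_integrable N (H \<tau>)"
  unfolding H_def
  by (intro square_integrable_add square_integrable_cmult square_integrable_N_near square_integrable_N_far square_integrable_N_Rb)

text \<open>Pointwise \<open>H \<tau>\<close> is at most 1 + \<tau> times \<open>H 1\<close>, so the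
  constant is the squared norm of \<open>H 1\<close>.\<close>

lemma H_growth: "\<exists>A. \<forall>\<tau>\<ge>0. kernel.ip (H \<tau>) (H \<tau>) \<le> A * (1 + \<tau>)\<^sup>2"
proof (intro exI allI impI)
  fix \<tau> :: real assume t: "0 \<le> \<tau>"
  have c: "0 \<le> V y0" by (rule V_nonneg)
  have "kernel.ip (H \<tau>) (H \<tau>) \<le> (\<integral>x. (1 + \<tau>)\<^sup>2 * (H 1 x * H 1 x) \<partial>N)"
    unfolding kernel.ip_def
  proof (rule integral_mono_AE)
    show "integrable N (\<lambda>x. H \<tau> x * H \<tau> x)" by (intro square_integrable_mult H_square_integrable)
    show "integrable N (\<lambda>x. (1 + \<tau>)\<^sup>2 * (H 1 x * H 1 x))" by (intro integrable_mult_right square_integrable_mult H_square_integrable)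
    show "AE x in N. H \<tau> x * H \<tau> x \<le> (1 + \<tau>)\<^sup>2 * (H 1 x * H 1 x)"
    proof (rule AE_I2)
      fix x
      define n where "n = (if x \<le> l + 1 then 1 else 0 :: real)"
      define f where "f = (if x \<le> l + 1 then 0 else 1 / V x)"
      define q where "q = 1 / Z * Rb x"
      have p: "0 \<le> n" "0 \<le> f" "0 \<le> q" using V_nonneg[of x] Z_pos Rb_nonneg[of x] by (auto simp: n_def f_def q_def)
      have H\<tau>: "H \<tau> x = n + (V y0 + \<tau>) * f + q" "H 1 x = n + (V y0 + 1) * f + q" by (simp_all add: H_def n_def f_def q_def)
      have h0: "0 \<le> H \<tau> x" unfolding H\<tau> using p c t by simp
      have "H \<tau> x \<le> (1 + \<tau>) * H 1 x"
      proof -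
        have "0 \<le> \<tau> * n + \<tau> * (V y0 * f) + \<tau> * q + f" using p c t by simp
        then show ?thesis unfolding H\<tau> by (simp add: algebra_simps)
      qed
      then have "H \<tau> x * H \<tau> x \<le> ((1 + \<tau>) * H 1 x) * ((1 + \<tau>) * H 1 x)" using h0 by (intro mult_mono) auto
      then show "H \<tau> x * H \<tau> x \<le> (1 + \<tau>)\<^sup>2 * (H 1 x * H 1 x)" by (simp add: power2_eq_square mult_ac)
    qed
  qed
  then show "kernel.ip (H \<tau>) (H \<tau>) \<le> kernel.ip (H 1) (H 1) * (1 + \<tau>)\<^sup>2"
    by (simp add: kernel.ip_def mult.commute)
qed

lemma F_measurable [measurable]: "0 \<le> t \<Longrightarrow> F t \<in> borel_measurable borel"
  unfolding F_def by measurable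

lemma F_square_integrable: assumes t: "0 \<le> t" shows "square_integrable N (F t)"
proof (rule square_integrable_bound[OF H_square_integrable[of t]])
  show "AE x in N. \<bar>F t x\<bar> \<le> H t x" unfolding AE_N using F_le_H[OF t order.refl] by auto
qed (use t in measurable)

text \<open>Path continuity gives continuity in time at every x that is not an atom of the law of
  \<open>y t\<close>, and atoms are countable. The exceptional set depends on t, which shapes the
  corresponding assumption of \<open>evolution\<close>.\<close>

lemma F_continuous: assumes t: "0 \<le> t" shows "AE x in lborel. continuous (at t within {0..}) (\<lambda>s. F s x)"
proof -
  have [measurable]: "y t \<in> borel_measurable M" using t by simp
  interpret D: prob_space "distr M borel (y t)" by (rule prob_space_distr) simp
  have "countable {x. measure (distr M borel (y t)) {x} \<noteq> 0}" by (rule D.countable_support)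
  then have "{x. measure (distr M borel (y t)) {x} \<noteq> 0} \<in> null_sets lborel" by (rule countable_imp_null_set_lborel)
  then have "AE x in lborel. x \<notin> {x. measure (distr M borel (y t)) {x} \<noteq> 0}" by (rule AE_not_in)
  then show ?thesis
  proof eventually_elim
    case (elim x)
    have "prob (y t -` {x} \<inter> space M) = 0" using elim by (simp add: measure_distr)
    then have "y t -` {x} \<inter> space M \<in> null_sets M" by (simp add: null_sets_def emeasure_eq_measure measurable_sets[of "y t" M borel])
    then have ne: "AE \<omega> in M. y t \<omega> \<noteq> x" by (rule AE_I') auto
    show "continuous (at t within {0..}) (\<lambda>s. F s x)"
      unfolding continuous_within_sequentially o_def
    proof (intro allI impI, elim conjE)
      fix s assume s: "\<forall>n. s n \<in> {0..}" and lim: "s \<longlonglongrightarrow> t"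
      have [measurable]: "y (s n) \<in> borel_measurable M" for n using s by simp
      have "(\<lambda>n. expectation (\<lambda>\<omega>. indicator {x<..} (y (s n) \<omega>))) \<longlonglongrightarrow> expectation (\<lambda>\<omega>. indicator {x<..} (y t \<omega>) :: real)"
      proof (rule integral_dominated_convergence[where w = "\<lambda>_. 1"])
        show "AE \<omega> in M. (\<lambda>n. indicator {x<..} (y (s n) \<omega>) :: real) \<longlonglongrightarrow> indicator {x<..} (y t \<omega>)"
          using AE_continuous ne
        proof eventually_elim
          case (elim \<omega>)
          have yl: "(\<lambda>n. y (s n) \<omega>) \<longlonglongrightarrow> y t \<omega>"
            using elim(1) s t lim by (auto simp: continuous_on_sequentially o_def)
          consider "x < y t \<omega>" | "y t \<omega> < x" using elim(2) by linarith
          then show ?case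
          proof cases
            case 1
            have "\<forall>\<^sub>F n in sequentially. (indicator {x<..} (y (s n) \<omega>) :: real) = indicator {x<..} (y t \<omega>)"
              using order_tendstoD(1)[OF yl 1] by eventually_elim (use 1 in \<open>auto simp: indicator_def\<close>)
            then show ?thesis by (rule tendsto_eventually)
          next
            case 2
            have "\<forall>\<^sub>F n in sequentially. (indicator {x<..} (y (s n) \<omega>) :: real) = indicator {x<..} (y t \<omega>)"
              using order_tendstoD(2)[OF yl 2] by eventually_elim (use 2 in \<open>auto simp: indicator_def\<close>)
            then show ?thesis by (rule tendsto_eventually)
          qed
        qed
      qed auto
      then have "(\<lambda>n. P (s n) x) \<longlonglongrightarrow> P t x" using s t by (simp add: P_expectation)
      then show "(\<lambda>n. F (s n) x) \<longlonglongrightarrow> F t x" unfolding F_def by (intro tendsto_intros)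
    qed
  qed
qed

text \<open>A layer-cake formula: K f u is the integral of its gradient against the indicator of x <
  u, and Fubini moves the expectation onto the indicator. Integrability comes from the first moment
  of \<open>y t\<close>, because the gradient is bounded.\<close>

lemma K_tail_formula:
  assumes f: "continuous_on UNIV f" "\<And>u. \<bar>f u\<bar> \<le> 1" and t: "0 \<le> t"
  shows "integrable lborel (\<lambda>x. indicator {l<..} x * dK f x * P t x)"
    "expectation (\<lambda>\<omega>. K f (y t \<omega>)) = (\<integral>x. indicator {l<..} x * dK f x * P t x \<partial>lborel)"
proof -
  interpret Prod: pair_sigma_finite M lborel by standard
  have fm: "f \<in> borel_measurable borel" by (rule borel_measurable_continuous_onI[OF f(1)])
  obtain C where C: "C \<ge> 0" "\<And>x. l \<le> x \<Longrightarrow> \<bar>dK f x\<bar> \<le> C" using dK_const_bound[OF f] by blast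
  have [measurable]: "y t \<in> borel_measurable M" using t by simp
  define g where "g x = indicator {l<..} x * dK f x" for x
  have gm [measurable]: "g \<in> borel_measurable borel"
  proof -
    have "(\<lambda>x. indicator {l<..} x *\<^sub>R dK f x) \<in> borel_measurable borel"
      by (rule borel_measurable_continuous_on_indicator)
         (auto intro: continuous_on_subset[OF dK_cont[OF fm f(2,1)]])
    then show ?thesis by (simp add: g_def[abs_def])
  qed
  have gC: "\<bar>g x\<bar> \<le> C * indicator {l<..} x" for x using C by (auto simp: g_def indicator_def abs_mult)
  define h where "h p = (case p of (\<omega>, x) \<Rightarrow> g x * indicator {x<..} (y t \<omega>))" for p :: "'a \<times> real"
  have hm [measurable]: "h \<in> borel_measurable (M \<Otimes>\<^sub>M lborel)"
  proof -
    have "(\<lambda>p. g (snd p) * (if snd p < y t (fst p) then 1 else 0)) \<in> borel_measurable (M \<Otimes>\<^sub>M lborel)" by measurable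
    also have "(\<lambda>p. g (snd p) * (if snd p < y t (fst p) then 1 else 0)) = h"
      by (auto simp: h_def fun_eq_iff indicator_def)
    finally show ?thesis .
  qed
  have slice: "integrable lborel (\<lambda>x. g x * indicator {x<..} u) \<and> (\<integral>x. g x * indicator {x<..} u \<partial>lborel) = K f u
      \<and> (\<integral>x. \<bar>g x * indicator {x<..} u\<bar> \<partial>lborel) \<le> C * (u - l)" if u: "l \<le> u" for u
  proof -
    have si: "set_integrable lborel {l..u} (dK f)"
      by (rule borel_integrable_atLeastAtMost') (auto intro: continuous_on_subset[OF dK_cont[OF fm f(2,1)]])
    have ae: "AE x in lborel. g x * indicator {x<..} u = indicator {l..u} x *\<^sub>R dK f x"
      using AE_lborel_singleton[of l] AE_lborel_singleton[of u]
      by eventually_elim (auto simp: g_def indicator_def)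
    have m1: "(\<lambda>x. g x * indicator {x<..} u) \<in> borel_measurable lborel"
    proof -
      have "(\<lambda>x. g x * (if x < u then 1 else 0)) \<in> borel_measurable lborel" by measurable
      also have "(\<lambda>x. g x * (if x < u then 1 else 0)) = (\<lambda>x. g x * indicator {x<..} u)" by (auto simp: fun_eq_iff indicator_def)
      finally show ?thesis .
    qed
    have m2: "(\<lambda>x. indicator {l..u} x *\<^sub>R dK f x) \<in> borel_measurable lborel"
      using si by (auto simp: set_integrable_def)
    have i: "integrable lborel (\<lambda>x. g x * indicator {x<..} u)"
      using si integrable_cong_AE[OF m1 m2 ae] by (simp add: set_integrable_def)
    have e: "(\<integral>x. g x * indicator {x<..} u \<partial>lborel) = K f u"
      using integral_cong_AE[OF m1 m2 ae] set_borel_integral_eq_integral(2)[OF si]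
      by (simp add: K_def set_lebesgue_integral_def)
    have "(\<integral>x. \<bar>g x * indicator {x<..} u\<bar> \<partial>lborel) \<le> (\<integral>x. C * indicator {l..u} x \<partial>lborel)"
    proof (rule integral_mono)
      show "integrable lborel (\<lambda>x. C * indicator {l..u} x)" by (intro integrable_mult_right integrable_real_indicator) (simp_all add: emeasure_lborel_Icc_eq)
      show "\<bar>g x * indicator {x<..} u\<bar> \<le> C * indicator {l..u} x" for x
        using gC[of x] C(1) by (cases "l < x") (auto simp: indicator_def abs_mult)
    qed (use i in simp)
    then show ?thesis using i e u by simp
  qed
  have int: "integrable (M \<Otimes>\<^sub>M lborel) h"
  proof (rule Prod.Fubini_integrable[OF hm])
    show "integrable M (\<lambda>\<omega>. \<integral>x. norm (h (\<omega>, x)) \<partial>lborel)"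
    proof (rule Bochner_Integration.integrable_bound)
      show "integrable M (\<lambda>\<omega>. C * (y t \<omega> - l))"
        using square_integrable_imp_integrable[OF y_square_integrable[OF t]] by simp
      show "AE \<omega> in M. norm (\<integral>x. norm (h (\<omega>, x)) \<partial>lborel) \<le> norm (C * (y t \<omega> - l))"
        using AE_ge[OF t]
      proof eventually_elim
        case (elim \<omega>)
        define J where "J = (\<integral>x. norm (h (\<omega>, x)) \<partial>lborel)"
        have "0 \<le> J" "J \<le> C * (y t \<omega> - l)" using slice[OF elim] by (simp_all add: h_def J_def)
        then have "norm J \<le> norm (C * (y t \<omega> - l))" by (simp only: real_norm_def)
        then show ?case unfolding J_def .
      qed
    qed measurable
    show "AE \<omega> in M. integrable lborel (\<lambda>x. h (\<omega>, x))"
      using AE_ge[OF t] by eventually_elim (use slice in \<open>simp add: h_def\<close>)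
  qed
  have inner: "(\<integral>\<omega>. h (\<omega>, x) \<partial>M) = indicator {l<..} x * dK f x * P t x" for x
    using P_expectation[OF t, of x] by (simp add: h_def g_def)
  show "integrable lborel (\<lambda>x. indicator {l<..} x * dK f x * P t x)"
    using Prod.integrable_snd[of "\<lambda>\<omega> x. h (\<omega>, x)"] int unfolding inner by simp
  have "expectation (\<lambda>\<omega>. K f (y t \<omega>)) = (\<integral>\<omega>. (\<integral>x. h (\<omega>, x) \<partial>lborel) \<partial>M)"
  proof (rule integral_cong_AE)
    show "(\<lambda>\<omega>. K f (y t \<omega>)) \<in> borel_measurable M"
      using K_square_integrable[OF f t] by (simp add: square_integrable_def)
    show "AE \<omega> in M. K f (y t \<omega>) = (\<integral>x. h (\<omega>, x) \<partial>lborel)"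
      using AE_ge[OF t] by eventually_elim (use slice in \<open>simp add: h_def\<close>)
  qed measurable
  also have "\<dots> = (\<integral>x. (\<integral>\<omega>. h (\<omega>, x) \<partial>M) \<partial>lborel)"
    using Prod.Fubini_integral[of "\<lambda>\<omega> x. h (\<omega>, x)"] int by simp
  finally show "expectation (\<lambda>\<omega>. K f (y t \<omega>)) = (\<integral>x. indicator {l<..} x * dK f x * P t x \<partial>lborel)"
    unfolding inner .
qed

text \<open>In an increment the equilibrium tail cancels, so the tails of the law may be replaced by
  \<open>F\<close>; the factor \<open>rho\<close> converts Lebesgue measure into
  \<open>N\<close>.\<close>

lemma K_increment:
  assumes f: "continuous_on UNIV f" "\<And>u. \<bar>f u\<bar> \<le> 1" and st: "0 \<le> s" "s \<le> t"
  shows "(\<integral>x. (indicator {l<..} x * dK f x * rho x) * (F t x - F s x) \<partial>N) = integral {s..t} (\<lambda>u. nuf f - expectation (\<lambda>\<omega>. f (y u \<omega>)))"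
    "(\<lambda>x. indicator {l<..} x * dK f x * rho x) \<in> borel_measurable borel"
proof -
  have t: "0 \<le> t" using st by simp
  have fm: "f \<in> borel_measurable borel" by (rule borel_measurable_continuous_onI[OF f(1)])
  have gm [measurable]: "(\<lambda>x. indicator {l<..} x * dK f x) \<in> borel_measurable borel"
  proof -
    have "(\<lambda>x. indicator {l<..} x *\<^sub>R dK f x) \<in> borel_measurable borel"
      by (rule borel_measurable_continuous_on_indicator)
         (auto intro: continuous_on_subset[OF dK_cont[OF fm f(2,1)]])
    then show ?thesis by simp
  qed
  show "(\<lambda>x. indicator {l<..} x * dK f x * rho x) \<in> borel_measurable borel" by measurable
  have [measurable]: "F t \<in> borel_measurable borel" "F s \<in> borel_measurable borel" using st t by auto
  have "(\<integral>x. (indicator {l<..} x * dK f x * rho x) * (F t x - F s x) \<partial>N)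
      = (\<integral>x. indicator {l<..} x / rho x * ((indicator {l<..} x * dK f x * rho x) * (F t x - F s x)) \<partial>lborel)"
    by (rule integrable_N(2)) measurable
  also have "\<dots> = (\<integral>x. indicator {l<..} x * dK f x * P t x - indicator {l<..} x * dK f x * P s x \<partial>lborel)"
  proof (rule Bochner_Integration.integral_cong[OF refl])
    fix x
    show "indicator {l<..} x / rho x * ((indicator {l<..} x * dK f x * rho x) * (F t x - F s x)) = indicator {l<..} x * dK f x * P t x - indicator {l<..} x * dK f x * P s x"
      using rho_pos_l[of x] by (cases "l < x") (auto simp: F_def algebra_simps)
  qed
  also have "\<dots> = expectation (\<lambda>\<omega>. K f (y t \<omega>)) - expectation (\<lambda>\<omega>. K f (y s \<omega>))"
    using K_tail_formula[OF f t] K_tail_formula[OF f st(1)] by simp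
  also have "\<dots> = integral {s..t} (\<lambda>u. nuf f - expectation (\<lambda>\<omega>. f (y u \<omega>)))" by (rule fokker_planck[OF f st])
  finally show "(\<integral>x. (indicator {l<..} x * dK f x * rho x) * (F t x - F s x) \<partial>N) = integral {s..t} (\<lambda>u. nuf f - expectation (\<lambda>\<omega>. f (y u \<omega>)))" .
qed

lemma rho_square_integrable: "square_integrable N (\<lambda>x. indicator {l<..} x * rho x)"
proof -
  have "integrable lborel (\<lambda>x. indicator {l<..} x / rho x * (indicator {l<..} x * rho x)\<^sup>2)"
  proof (rule Bochner_Integration.integrable_bound[OF rho_integrable])
    show "AE x in lborel. norm (indicator {l<..} x / rho x * (indicator {l<..} x * rho x)\<^sup>2) \<le> norm (rho x)"
      using rho_pos_l by (intro AE_I2) (auto simp: indicator_def power2_eq_square)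
  qed measurable
  then show ?thesis by (simp add: square_integrable_def integrable_N)
qed

text \<open>Testing the Fokker-Planck equation with the potential of \<open>1\<^bsub>(z,\<infinity>)\<^esub>\<close>, approximated by ramps.\<close>
lemma T_F_increment:
  assumes z: "l < z" and st: "0 \<le> s" "s \<le> t"
  shows "(\<lambda>u. F u z) integrable_on {s..t}" "kernel.T (F t) z - kernel.T (F s) z = - integral {s..t} (\<lambda>u. F u z)"
proof -
  have t: "0 \<le> t" using st by simp
  \<comment> \<open>These ramps vanish up to z, so their pointwise limit is the indicator of the
    open half line even at z.\<close>
  define f where "f n u = max 0 (min 1 (real n * (u - z)))" for n :: nat and u :: real
  have fc: "continuous_on UNIV (f n)" for n unfolding f_def by (intro continuous_intros)
  have fb: "\<bar>f n u\<bar> \<le> 1" for n u by (auto simp: f_def)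
  have fm [measurable]: "f n \<in> borel_measurable borel" for n by (rule borel_measurable_continuous_onI[OF fc])
  have flim: "(\<lambda>n. f n u) \<longlonglongrightarrow> indicator {z<..} u" for u
  proof (cases "z < u")
    case True
    have "\<forall>\<^sub>F n in sequentially. f n u = 1"
      using eventually_ge_at_top[of "nat \<lceil>1 / (u - z)\<rceil>"]
    proof eventually_elim
      case (elim n)
      then have "1 / (u - z) \<le> real n" by linarith
      then have "1 \<le> real n * (u - z)" using True by (simp add: field_simps)
      then show ?case by (simp add: f_def)
    qed
    then show ?thesis using True by (simp add: tendsto_eventually)
  next
    case False
    then have "real n * (u - z) \<le> 0" for n by (intro mult_nonneg_nonpos) auto
    moreover have "max 0 (min 1 v) = 0" if "v \<le> 0" for v :: real using that by auto
    ultimately have "f n u = 0" for n unfolding f_def by blast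
    then show ?thesis using False by simp
  qed
  have lz: "l \<le> z" using z by simp
  obtain C where C: "C > 0" "\<And>x. l \<le> x \<Longrightarrow> Rb x \<le> C * rho x / x" using mills_ratio by blast
  have conv: "(\<lambda>n. nuf (f n)) \<longlonglongrightarrow> Rb z / Z" "\<And>x. l \<le> x \<Longrightarrow> (\<lambda>n. dK (f n) x) \<longlonglongrightarrow> k x z / rho x"
    using bounded_convergence[OF fm fb flim] nuf_indicator[OF lz] dK_indicator[OF lz] by auto
  let ?L = "\<lambda>n x. (indicator {l<..} x * dK (f n) x * rho x) * (F t x - F s x)"
  have Fst: "square_integrable N (\<lambda>x. F t x - F s x)" by (intro square_integrable_diff F_square_integrable st t)
  have dom: "integrable N (\<lambda>x. 8 * C / l * ((indicator {l<..} x * rho x) * \<bar>F t x - F s x\<bar>))"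
    by (intro integrable_mult_right square_integrable_mult[OF rho_square_integrable])
       (use Fst in \<open>auto simp: square_integrable_def\<close>)
  have [measurable]: "F t \<in> borel_measurable borel" "F s \<in> borel_measurable borel" using st t by auto
  have left: "(\<lambda>n. \<integral>x. ?L n x \<partial>N) \<longlonglongrightarrow> (\<integral>x. k x z * F t x - k x z * F s x \<partial>N)"
  proof (rule integral_dominated_convergence[OF _ _ dom])
    show "(\<lambda>x. k x z * F t x - k x z * F s x) \<in> borel_measurable N" unfolding k_def by measurable
    show "?L n \<in> borel_measurable N" for n using K_increment(2)[OF fc fb st, of n] by measurable
    show "AE x in N. (\<lambda>n. ?L n x) \<longlonglongrightarrow> k x z * F t x - k x z * F s x"
      unfolding AE_N
    proof (intro AE_I2 impI)
      fix x assume x: "l < x"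
      have "(\<lambda>n. (1 * dK (f n) x * rho x) * (F t x - F s x)) \<longlonglongrightarrow> (1 * (k x z / rho x) * rho x) * (F t x - F s x)"
        using x by (intro tendsto_intros conv) auto
      then show "(\<lambda>n. ?L n x) \<longlonglongrightarrow> k x z * F t x - k x z * F s x"
        using x rho_pos_l[of x] by (simp add: right_diff_distrib)
    qed
    show "AE x in N. norm (?L n x) \<le> 8 * C / l * ((indicator {l<..} x * rho x) * \<bar>F t x - F s x\<bar>)" for n
      unfolding AE_N
    proof (intro AE_I2 impI)
      fix x assume x: "l < x"
      have "\<bar>dK (f n) x\<bar> \<le> 8 * C / x" by (rule dK_bound[OF fm fb C(2)]) (use x in auto)
      also have "\<dots> \<le> 8 * C / l" using x l_pos C(1) by (intro divide_left_mono) auto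
      finally have "\<bar>dK (f n) x\<bar> * (rho x * \<bar>F t x - F s x\<bar>) \<le> 8 * C / l * (rho x * \<bar>F t x - F s x\<bar>)"
        using rho_pos_l[of x] x by (intro mult_right_mono) auto
      then show "norm (?L n x) \<le> 8 * C / l * ((indicator {l<..} x * rho x) * \<bar>F t x - F s x\<bar>)"
        using x rho_pos_l[of x] by (simp add: abs_mult mult.assoc)
    qed
  qed
  let ?m = "\<lambda>n u. nuf (f n) - expectation (\<lambda>\<omega>. f n (y u \<omega>))"
  have mc: "?m n integrable_on {s..t}" for n
    by (intro integrable_continuous_real continuous_intros continuous_on_subset[OF expectation_continuous[OF fc fb]]) (use st in auto)
  have mb: "norm (?m n u) \<le> 2" if u: "u \<in> {s..t}" for n u
  proof -
    have [measurable]: "y u \<in> borel_measurable M" using u st by simp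
    have "\<bar>expectation (\<lambda>\<omega>. f n (y u \<omega>))\<bar> \<le> expectation (\<lambda>\<omega>. \<bar>f n (y u \<omega>)\<bar>)" by (rule integral_abs_bound)
    also have "\<dots> \<le> expectation (\<lambda>_. 1)"
      by (rule integral_mono) (use fb in \<open>auto intro!: integrable_const_bound[where B = 1]\<close>)
    finally have "\<bar>expectation (\<lambda>\<omega>. f n (y u \<omega>))\<bar> \<le> 1" by (simp add: prob_space)
    then show ?thesis using nuf_bound[OF fm fb, of n] by simp
  qed
  have ml: "(\<lambda>n. ?m n u) \<longlonglongrightarrow> - F u z" if u: "u \<in> {s..t}" for u
  proof -
    have u0: "0 \<le> u" using u st by simp
    have [measurable]: "y u \<in> borel_measurable M" using u0 by simp
    have "(\<lambda>n. expectation (\<lambda>\<omega>. f n (y u \<omega>))) \<longlonglongrightarrow> expectation (\<lambda>\<omega>. indicator {z<..} (y u \<omega>))"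
      by (rule integral_dominated_convergence[where w = "\<lambda>_. 1"]) (use flim fb in auto)
    then have "(\<lambda>n. ?m n u) \<longlonglongrightarrow> Rb z / Z - P u z"
      unfolding P_expectation[OF u0] by (intro tendsto_intros conv)
    then show ?thesis by (simp add: F_def)
  qed
  have dc: "(\<lambda>u. - F u z) integrable_on {s..t}" "(\<lambda>n. integral {s..t} (?m n)) \<longlonglongrightarrow> integral {s..t} (\<lambda>u. - F u z)"
    using dominated_convergence[where h = "\<lambda>_. 2", OF mc _ mb ml] by (auto simp: integrable_const_ivl)
  show "(\<lambda>u. F u z) integrable_on {s..t}" using integrable_neg[OF dc(1)] by simp
  have "(\<lambda>n. integral {s..t} (?m n)) \<longlonglongrightarrow> (\<integral>x. k x z * F t x - k x z * F s x \<partial>N)"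
    using left K_increment(1)[OF fc fb st] by simp
  then have "(\<integral>x. k x z * F t x - k x z * F s x \<partial>N) = - integral {s..t} (\<lambda>u. F u z)"
    using LIMSEQ_unique[OF _ dc(2)] by simp
  moreover have "integrable N (\<lambda>x. k x z * F u x)" if "0 \<le> u" for u
  proof -
    \<comment> \<open>The kernel is dominated by a multiple of \<open>Rb\<close>: directly beyond z,
      and before z through R x * Rb z \<le> Z * Rb x.\<close>
    have "square_integrable N (\<lambda>x. k x z)"
    proof (rule square_integrable_bound[OF square_integrable_cmult[OF square_integrable_N_Rb, of "4 * R z / Z + 4"]])
      show "AE x in N. \<bar>k x z\<bar> \<le> (4 * R z / Z + 4) * Rb x"
      proof (rule AE_I2)
        fix x
        have k0: "0 \<le> k x z" using R_nonneg Rb_nonneg Z_pos by (simp add: k_def)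
        show "\<bar>k x z\<bar> \<le> (4 * R z / Z + 4) * Rb x"
        proof (cases "x \<le> z")
          case True
          have "R x * Rb z \<le> Z * Rb x"
            using R_le_Z[of x] monoD[OF R_mono True] R_nonneg Rb_nonneg Z_pos by (intro mult_mono) (auto simp: Rb_def)
          then have "k x z \<le> 4 * Rb x" using Z_pos True by (simp add: k_def min_def max_def field_simps)
          also have "\<dots> \<le> (4 * R z / Z + 4) * Rb x" using R_nonneg[of z] Rb_nonneg[of x] Z_pos by (intro mult_right_mono) auto
          finally show ?thesis using k0 by simp
        next
          case False
          then have "k x z = 4 * R z / Z * Rb x" by (simp add: k_def)
          also have "\<dots> \<le> (4 * R z / Z + 4) * Rb x" using Rb_nonneg[of x] by (intro mult_right_mono) auto
          finally show ?thesis using k0 by simp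
        qed
      qed
    qed (simp add: k_def)
    then show ?thesis by (rule square_integrable_mult[OF _ F_square_integrable[OF that]])
  qed
  ultimately show "kernel.T (F t) z - kernel.T (F s) z = - integral {s..t} (\<lambda>u. F u z)"
    using t st by (simp add: kernel.T_def)
qed

end

section \<open>Convergence to equilibrium\<close>


text \<open>The squared norm of the initial tail difference, written in terms of the starting point
  alone. Keeping the solution and its probability space out of it makes the final constant uniform
  over all solutions.\<close>

definition (in hard_ball_params) initial_energy :: "real \<Rightarrow> real" where
  "initial_energy u = (\<integral>x. ((if x < u then 1 else 0) - Rb x / Z)\<^sup>2 \<partial>N)"

context reflected_sde
begin

lemma T_F_lipschitz:
  assumes z: "l < z" and s: "0 \<le> s" "s \<le> \<tau>" and t: "0 \<le> t" "t \<le> \<tau>"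
  shows "\<bar>kernel.T (F t) z - kernel.T (F s) z\<bar> \<le> \<bar>t - s\<bar> * H \<tau> z"
proof -
  have *: "\<bar>kernel.T (F t) z - kernel.T (F s) z\<bar> \<le> (t - s) * H \<tau> z" if st: "0 \<le> s" "s \<le> t" "t \<le> \<tau>" for s t
  proof -
    have "norm (integral {s..t} (\<lambda>u. F u z)) \<le> integral {s..t} (\<lambda>u. H \<tau> z)"
    proof (rule integral_norm_bound_integral[OF T_F_increment(1)[OF z st(1,2)]])
      show "norm (F u z) \<le> H \<tau> z" if "u \<in> {s..t}" for u
        using F_le_H[of u \<tau> z] that st z by simp
    qed (rule integrable_const_ivl)
    then show ?thesis using T_F_increment(2)[OF z st(1,2)] st by simp
  qed
  show ?thesis
    using *[of s t] *[of t s] s t by (cases "s \<le> t") (auto simp: abs_minus_commute)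
qed

lemma T_F_derivative:
  assumes z: "l < z" and t: "0 \<le> t" and c: "continuous (at t within {0..}) (\<lambda>s. F s z)"
  shows "((\<lambda>s. kernel.T (F s) z) has_real_derivative - F t z) (at t within {0..})"
proof -
  have sub: "{0..t + 1} - {} \<subseteq> {0..}" by auto
  have "((\<lambda>u. integral {0..u} (\<lambda>s. F s z)) has_vector_derivative F t z) (at t within ({0..t + 1} - {}))"
    by (rule integral_has_vector_derivative_continuous_at)
       (use T_F_increment(1)[OF z order.refl, of "t + 1"] t continuous_within_subset[OF c sub] in auto)
  then have "((\<lambda>u. integral {0..u} (\<lambda>s. F s z)) has_real_derivative F t z) (at t within {0..t + 1})"
    by (simp add: has_real_derivative_iff_has_vector_derivative)
  also have "at t within {0..t + 1} = at t within {0..}"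
    by (rule at_within_nhd[where S = "{..<t + 1}"]) (use t in auto)
  finally have "((\<lambda>u. integral {0..u} (\<lambda>s. F s z)) has_real_derivative F t z) (at t within {0..})" .
  then have "((\<lambda>u. kernel.T (F 0) z - integral {0..u} (\<lambda>s. F s z)) has_real_derivative 0 - F t z) (at t within {0..})"
    by (intro DERIV_diff DERIV_const)
  then have "((\<lambda>u. kernel.T (F u) z) has_real_derivative 0 - F t z) (at t within {0..})"
  proof (rule has_field_derivative_transform_within[OF _ zero_less_one])
    show "kernel.T (F 0) z - integral {0..u} (\<lambda>s. F s z) = kernel.T (F u) z" if "u \<in> {0..}" for u
      using T_F_increment(2)[OF z order.refl, of u] that by simp
  qed (use t in simp)
  then show ?thesis by simp
qed

lemma F_evolution: "\<exists>A. evolution N k hw (4 * a) F H A"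
proof -
  obtain A where A: "\<And>\<tau>. 0 \<le> \<tau> \<Longrightarrow> kernel.ip (H \<tau>) (H \<tau>) \<le> A * (1 + \<tau>)\<^sup>2" using H_growth by blast
  have "evolution N k hw (4 * a) F H A"
  proof
    show "F t \<in> borel_measurable N" if "0 \<le> t" for t using F_measurable[OF that] by simp
    show "square_integrable N (H \<tau>)" for \<tau> by (rule H_square_integrable)
    show "AE x in N. \<bar>F t x\<bar> \<le> H \<tau> x" if "0 \<le> t" "t \<le> \<tau>" for t \<tau>
      unfolding AE_N using F_le_H[OF that] by auto
    show "AE x in N. continuous (at t within {0..}) (\<lambda>s. F s x)" if "0 \<le> t" for t
      unfolding AE_N using F_continuous[OF that] by eventually_elim simp
    show "AE z in N. \<bar>kernel.T (F t) z - kernel.T (F s) z\<bar> \<le> \<bar>t - s\<bar> * H \<tau> z"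
      if "0 \<le> s" "s \<le> \<tau>" "0 \<le> t" "t \<le> \<tau>" for s t \<tau>
      unfolding AE_N using T_F_lipschitz that by auto
    show "AE z in N. ((\<lambda>s. kernel.T (F s) z) has_real_derivative - F t z) (at t within {0..})" if "0 \<le> t" for t
      unfolding AE_N using F_continuous[OF that] by eventually_elim (use T_F_derivative that in blast)
    show "kernel.ip (H \<tau>) (H \<tau>) \<le> A * (1 + \<tau>)\<^sup>2" if "0 \<le> \<tau>" for \<tau> by (rule A[OF that])
  qed
  then show ?thesis ..
qed

lemma F_initial: "kernel.ip (F 0) (F 0) = initial_energy y0"
proof -
  have "P 0 x = (if x < y0 then 1 else 0)" for x
  proof -
    have [measurable]: "y 0 \<in> borel_measurable M" by simp
    have "P 0 x = expectation (\<lambda>\<omega>. indicator {x<..} (y 0 \<omega>))" by (rule P_expectation) simp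
    also have "\<dots> = expectation (\<lambda>\<omega>. indicator {x<..} y0)"
      by (rule integral_cong_AE) (use AE_y_0 in \<open>auto elim: eventually_mono\<close>)
    finally show ?thesis by (simp add: prob_space indicator_def)
  qed
  then show ?thesis
    by (simp add: kernel.ip_def initial_energy_def F_def power2_eq_square)
qed

text \<open>A norm bound for \<rho> (K f)' times the root of the constant in
  \<open>increment_decay\<close>, with the step and the exponential taken out.\<close>

definition rate_constant :: "real \<Rightarrow> real" where
  "rate_constant C = 8 * C / l * sqrt (kernel.ip (\<lambda>x. indicator {l<..} x * rho x) (\<lambda>x. indicator {l<..} x * rho x))
     * sqrt (4 * (initial_energy y0 / (4 * a)))"

text \<open>The integral of \<nu>(f) - E f(y u) over a short interval is the inner product of \<rho>
  (K f)' with an increment of \<open>F\<close>. Cauchy-Schwarz and \<open>increment_decay\<close>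
  bound it by a multiple of the step, so dividing by the step and letting it tend to zero recovers
  the value at t.\<close>

lemma continuous_test_decay:
  assumes C: "0 < C" "\<And>x. l \<le> x \<Longrightarrow> Rb x \<le> C * rho x / x"
    and f: "continuous_on UNIV f" "\<And>u. \<bar>f u\<bar> \<le> 1" and t: "1 \<le> t"
  shows "\<bar>expectation (\<lambda>\<omega>. f (y t \<omega>)) - nuf f\<bar> \<le> rate_constant C * exp (- 4 * a * (t - 1))"
proof -
  obtain A where "evolution N k hw (4 * a) F H A" using F_evolution by blast
  then interpret E: evolution N k hw "4 * a" F H A .
  have fm: "f \<in> borel_measurable borel" by (rule borel_measurable_continuous_onI[OF f(1)])
  define q where "q = (\<lambda>x. indicator {l<..} x * rho x)"
  define g where "g = (\<lambda>x. indicator {l<..} x * dK f x * rho x)"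
  have q: "square_integrable N q" unfolding q_def by (rule rho_square_integrable)
  have gb: "\<bar>g x\<bar> \<le> 8 * C / l * q x" for x
  proof (cases "l < x")
    case True
    have "\<bar>dK f x\<bar> \<le> 8 * C / x" by (rule dK_bound[OF fm f(2) C(2)]) (use True in auto)
    also have "\<dots> \<le> 8 * C / l" using True l_pos C(1) by (intro divide_left_mono) auto
    finally have "\<bar>dK f x\<bar> * rho x \<le> 8 * C / l * rho x" using True rho_pos_l[of x] by (intro mult_right_mono) auto
    then show ?thesis using True rho_pos_l[of x] by (simp add: g_def q_def abs_mult)
  qed (simp add: g_def q_def)
  have gm: "g \<in> borel_measurable N" using K_increment(2)[OF f, of 0 0] by (simp add: g_def)
  have gsq: "square_integrable N g"
    by (rule square_integrable_bound[OF square_integrable_cmult[OF q, of "8 * C / l"] gm]) (rule AE_I2, rule gb)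
  have gip: "kernel.ip g g \<le> (8 * C / l)\<^sup>2 * kernel.ip q q"
  proof -
    have "kernel.ip g g \<le> (\<integral>x. (8 * C / l)\<^sup>2 * (q x * q x) \<partial>N)"
      unfolding kernel.ip_def
    proof (rule integral_mono)
      show "integrable N (\<lambda>x. g x * g x)" by (rule square_integrable_mult[OF gsq gsq])
      show "integrable N (\<lambda>x. (8 * C / l)\<^sup>2 * (q x * q x))" by (intro integrable_mult_right square_integrable_mult q)
      fix x
      have "\<bar>g x\<bar> * \<bar>g x\<bar> \<le> (8 * C / l * q x) * (8 * C / l * q x)" by (intro mult_mono gb) (use gb[of x] in auto)
      then show "g x * g x \<le> (8 * C / l)\<^sup>2 * (q x * q x)" by (simp add: power2_eq_square mult_ac)
    qed
    then show ?thesis by (simp add: kernel.ip_def)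
  qed
  define m where "m u = nuf f - expectation (\<lambda>\<omega>. f (y u \<omega>))" for u
  \<comment> \<open>Steps of this form are the ones for which \<open>increment_decay\<close> is
    stated.\<close>
  define \<delta> where "\<delta> n = 1 / (2 * real (Suc n))" for n
  have \<delta>: "0 < \<delta> n" for n by (simp add: \<delta>_def)
  have avg: "\<bar>integral {t..t + \<delta> n} m / \<delta> n\<bar> \<le> rate_constant C * exp (- 4 * a * (t - 1))" for n
  proof -
    define D where "D = (\<lambda>x. F (t + \<delta> n) x - F t x)"
    have t0: "0 \<le> t" "0 \<le> t + \<delta> n" "t \<le> t + \<delta> n" using t \<delta>[of n] by auto
    have Dsq: "square_integrable N D" unfolding D_def by (intro square_integrable_diff F_square_integrable t0)
    have I: "kernel.ip g D = integral {t..t + \<delta> n} m"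
      using K_increment(1)[OF f t0(1,3)] by (simp add: kernel.ip_def g_def D_def m_def[abs_def])
    have Dip: "kernel.ip D D \<le> 4 * (\<delta> n)\<^sup>2 * (initial_energy y0 / (4 * a)) * exp (- 2 * (4 * a) * (t - 1))"
      using E.increment_decay[OF t, of "Suc n"] unfolding D_def \<delta>_def F_initial by simp
    have "(integral {t..t + \<delta> n} m)\<^sup>2 \<le> kernel.ip g g * kernel.ip D D"
      using kernel.ip_cauchy_schwarz[OF gsq Dsq] by (simp add: I)
    also have "\<dots> \<le> ((8 * C / l)\<^sup>2 * kernel.ip q q) * (4 * (\<delta> n)\<^sup>2 * (initial_energy y0 / (4 * a)) * exp (- 2 * (4 * a) * (t - 1)))"
      by (intro mult_mono gip Dip mult_nonneg_nonneg kernel.ip_nonneg) auto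
    also have "exp (- 2 * (4 * a) * (t - 1)) = (exp (- 4 * a * (t - 1)))\<^sup>2"
      by (simp add: exp_double[symmetric] algebra_simps)
    finally have "sqrt ((integral {t..t + \<delta> n} m)\<^sup>2) \<le> sqrt (((8 * C / l)\<^sup>2 * kernel.ip q q) * (4 * (\<delta> n)\<^sup>2 * (initial_energy y0 / (4 * a)) * (exp (- 4 * a * (t - 1)))\<^sup>2))"
      by (rule real_sqrt_le_mono)
    also have "\<dots> = rate_constant C * exp (- 4 * a * (t - 1)) * \<delta> n"
      using C(1) l_pos \<delta>[of n] by (simp add: rate_constant_def q_def real_sqrt_mult real_sqrt_divide mult_ac)
    finally have "\<bar>integral {t..t + \<delta> n} m\<bar> \<le> rate_constant C * exp (- 4 * a * (t - 1)) * \<delta> n" by simp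
    then show ?thesis using \<delta>[of n] by (simp add: abs_divide pos_divide_le_eq)
  qed
  have mc: "continuous_on {t..} m"
    unfolding m_def by (intro continuous_intros continuous_on_subset[OF expectation_continuous[OF f]]) (use t in auto)
  have "((\<lambda>u. integral {t..u} m) has_real_derivative m t) (at t within {t..})"
    by (rule FTC_atLeast[OF mc order.refl])
  then have q: "((\<lambda>u. (integral {t..u} m - integral {t..t} m) / (u - t)) \<longlongrightarrow> m t) (at t within {t..})"
    by (simp add: has_field_derivative_iff)
  have \<delta>lim: "(\<lambda>n. t + \<delta> n) \<longlonglongrightarrow> t" unfolding \<delta>_def by real_asymp
  have mem: "t + \<delta> n \<in> {t..} - {t}" for n using \<delta>[of n] by auto
  have "((\<lambda>u. (integral {t..u} m - integral {t..t} m) / (u - t)) \<circ> (\<lambda>n. t + \<delta> n)) \<longlonglongrightarrow> m t"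
    by (rule q[unfolded tendsto_at_iff_sequentially, rule_format, OF mem \<delta>lim])
  then have "(\<lambda>n. \<bar>integral {t..t + \<delta> n} m / \<delta> n\<bar>) \<longlonglongrightarrow> \<bar>m t\<bar>" by (intro tendsto_rabs) (simp add: o_def)
  then have "\<bar>m t\<bar> \<le> rate_constant C * exp (- 4 * a * (t - 1))"
    by (rule LIMSEQ_le_const2) (use avg in auto)
  then show ?thesis by (simp add: m_def abs_minus_commute)
qed

end

section \<open>From continuous test functions to total variation\<close>

lemma compact_open_approx:
  fixes M :: "real measure"
  assumes M: "prob_space M" and S: "sets M = sets borel" and A: "A \<in> sets borel" and \<epsilon>: "0 < \<epsilon>"
  shows "\<exists>K U. compact K \<and> open U \<and> K \<subseteq> A \<and> A \<subseteq> U \<and> measure M (U - K) < \<epsilon>"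
proof -
  interpret prob_space M by (rule M)
  have fin: "emeasure M (space M) \<noteq> \<infinity>" by simp
  have e2: "0 < \<epsilon> / 2" using \<epsilon> by simp
  have "\<exists>K. compact K \<and> K \<subseteq> A \<and> prob A - \<epsilon> / 2 < prob K"
  proof (rule ccontr)
    assume no: "\<not> ?thesis"
    have "emeasure M A = (SUP K\<in>{K. K \<subseteq> A \<and> compact K}. emeasure M K)"
      by (rule inner_regular[OF S fin A])
    also have "\<dots> \<le> ennreal (max 0 (prob A - \<epsilon> / 2))"
    proof (rule SUP_least)
      fix K assume "K \<in> {K. K \<subseteq> A \<and> compact K}"
      then have "\<not> prob A - \<epsilon> / 2 < prob K" using no by blast
      then have "prob K \<le> max 0 (prob A - \<epsilon> / 2)" by (simp add: not_less le_max_iff_disj)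
      then show "emeasure M K \<le> ennreal (max 0 (prob A - \<epsilon> / 2))"
        unfolding emeasure_eq_measure by (rule ennreal_leI)
    qed
    finally have "ennreal (prob A) \<le> ennreal (max 0 (prob A - \<epsilon> / 2))" by (simp only: emeasure_eq_measure)
    then have "prob A \<le> max 0 (prob A - \<epsilon> / 2)" by (rule ennreal_le_iff[THEN iffD1, rotated]) simp
    then have "prob A \<le> 0 \<or> prob A \<le> prob A - \<epsilon> / 2" by (simp only: le_max_iff_disj)
    then have "prob A \<le> 0" using e2 by linarith
    then have "prob A = 0" by (rule order.antisym[OF _ measure_nonneg])
    then have "compact {} \<and> {} \<subseteq> A \<and> prob A - \<epsilon> / 2 < prob {}" using e2 by simp
    then have "\<exists>K. compact K \<and> K \<subseteq> A \<and> prob A - \<epsilon> / 2 < prob K" by (rule exI)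
    with no show False by (rule notE)
  qed
  then obtain K where K: "compact K" "K \<subseteq> A" "prob A - \<epsilon> / 2 < prob K" by blast
  have "\<exists>U. open U \<and> A \<subseteq> U \<and> prob U < prob A + \<epsilon> / 2"
  proof (rule ccontr)
    assume no: "\<not> ?thesis"
    have "emeasure M A = (INF U\<in>{U. A \<subseteq> U \<and> open U}. emeasure M U)"
      by (rule outer_regular[OF S fin A])
    moreover have "ennreal (prob A + \<epsilon> / 2) \<le> (INF U\<in>{U. A \<subseteq> U \<and> open U}. emeasure M U)"
    proof (rule INF_greatest)
      fix U assume "U \<in> {U. A \<subseteq> U \<and> open U}"
      then have "\<not> prob U < prob A + \<epsilon> / 2" using no by blast
      then have "prob A + \<epsilon> / 2 \<le> prob U" by (simp add: not_less)
      then show "ennreal (prob A + \<epsilon> / 2) \<le> emeasure M U"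
        unfolding emeasure_eq_measure by (rule ennreal_leI)
    qed
    ultimately have "ennreal (prob A + \<epsilon> / 2) \<le> emeasure M A" by (simp only:)
    then have "prob A + \<epsilon> / 2 \<le> prob A"
      unfolding emeasure_eq_measure by (rule ennreal_le_iff[THEN iffD1, rotated]) simp
    then show False using e2 by simp
  qed
  then obtain U where U: "open U" "A \<subseteq> U" "prob U < prob A + \<epsilon> / 2" by blast
  have "K \<in> sets M" "U \<in> sets M" using K U S by (auto simp: borel_compact)
  then have "prob (U - K) = prob U - prob K" using K U by (intro finite_measure_Diff) auto
  then show ?thesis using K U by (intro exI[of _ K] exI[of _ U]) auto
qed

text \<open>The function and the indicator of \<open>A\<close> agree on \<open>K\<close> and off
  \<open>U\<close>, and elsewhere they differ by at most 1.\<close>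

lemma separating_function_integral:
  fixes f :: "real \<Rightarrow> real"
  assumes M: "prob_space M" and S: "sets M = sets borel" and A: "A \<in> sets borel" and KU: "compact K" "open U" "K \<subseteq> A" "A \<subseteq> U"
    and f: "continuous_on UNIV f" "\<And>x. 0 \<le> f x" "\<And>x. f x \<le> 1" "\<And>x. x \<in> K \<Longrightarrow> f x = 1" "\<And>x. x \<notin> U \<Longrightarrow> f x = 0"
  shows "\<bar>(\<integral>x. f x \<partial>M) - measure M A\<bar> \<le> measure M (U - K)"
proof -
  interpret prob_space M by (rule M)
  have fm [measurable]: "f \<in> borel_measurable M"
    using borel_measurable_continuous_onI[OF f(1)] S by (simp cong: measurable_cong_sets)
  have sets: "A \<in> sets M" "U - K \<in> sets M" using A KU S by (auto simp: borel_compact)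
  have fi: "integrable M f" by (rule integrable_const_bound[where B = 1]) (use f in auto)
  have "integrable M (indicator A :: real \<Rightarrow> real)" using sets(1) by (simp add: emeasure_eq_measure)
  then have "(\<integral>x. f x \<partial>M) - prob A = expectation (\<lambda>x. f x - indicator A x)"
    using fi sets(1) by (subst Bochner_Integration.integral_diff) auto
  also have "\<bar>\<dots>\<bar> \<le> expectation (\<lambda>x. \<bar>f x - indicator A x\<bar>)" by (rule integral_abs_bound)
  also have "\<dots> \<le> expectation (\<lambda>x. indicator (U - K) x)"
  proof (rule integral_mono)
    show "\<bar>f x - indicator A x\<bar> \<le> indicator (U - K) x" for x
      using f(2,3)[of x] f(4,5)[of x] KU by (auto simp: indicator_def)
  qed (use fi sets in \<open>auto intro!: integrable_real_indicator simp: emeasure_eq_measure\<close>)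
  also have "\<dots> = prob (U - K)" using sets by simp
  finally show ?thesis .
qed

text \<open>One continuous function must approximate the indicator of \<open>A\<close> under both
  measures at once. The union of the two compact sets and the intersection of the two open sets
  achieve this, and Urysohn's lemma supplies the function.\<close>

lemma tv_dist_le:
  assumes P: "prob_space P" "sets P = sets borel" and Q: "prob_space Q" "sets Q = sets borel"
    and c: "\<And>f. \<lbrakk>continuous_on UNIV f; \<And>x. 0 \<le> f x; \<And>x. f x \<le> 1\<rbrakk> \<Longrightarrow> \<bar>(\<integral>x. f x \<partial>P) - (\<integral>x. f x \<partial>Q)\<bar> \<le> c"
  shows "tv_dist P Q \<le> c"
  unfolding tv_dist_def
proof (rule cSUP_least)
  fix A :: "real set" assume A: "A \<in> sets borel"
  show "\<bar>measure P A - measure Q A\<bar> \<le> c"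
  proof (rule field_le_epsilon)
    fix \<epsilon> :: real assume e: "0 < \<epsilon>"
    interpret P: prob_space P by (rule P)
    interpret Q: prob_space Q by (rule Q)
    have e2: "0 < \<epsilon> / 2" using e by simp
    obtain K1 U1 where 1: "compact K1" "open U1" "K1 \<subseteq> A" "A \<subseteq> U1" "P.prob (U1 - K1) < \<epsilon> / 2"
      using compact_open_approx[OF P A e2] by blast
    obtain K2 U2 where 2: "compact K2" "open U2" "K2 \<subseteq> A" "A \<subseteq> U2" "Q.prob (U2 - K2) < \<epsilon> / 2"
      using compact_open_approx[OF Q A e2] by blast
    define K where "K = K1 \<union> K2"
    define U where "U = U1 \<inter> U2"
    have KU: "compact K" "open U" "K \<subseteq> A" "A \<subseteq> U" using 1 2 by (auto simp: K_def U_def)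
    have bset: "U1 - K1 \<in> sets borel" "U2 - K2 \<in> sets borel" using 1 2 by (auto simp: borel_compact)
    have small: "P.prob (U - K) < \<epsilon> / 2" "Q.prob (U - K) < \<epsilon> / 2"
    proof -
      have sub: "U - K \<subseteq> U1 - K1" "U - K \<subseteq> U2 - K2" by (auto simp: K_def U_def)
      show "P.prob (U - K) < \<epsilon> / 2"
        by (rule le_less_trans[OF P.finite_measure_mono[OF sub(1)] 1(5)]) (use bset P(2) in simp)
      show "Q.prob (U - K) < \<epsilon> / 2"
        by (rule le_less_trans[OF Q.finite_measure_mono[OF sub(2)] 2(5)]) (use bset Q(2) in simp)
    qed
    have "closed (- U)" "closed K" "K \<inter> - U = {}" using KU by (auto intro: compact_imp_closed)
    then obtain f :: "real \<Rightarrow> real" where f: "continuous_on UNIV f" "\<And>x. f x \<in> closed_segment 1 0" "\<And>x. x \<in> K \<Longrightarrow> f x = 1" "\<And>x. x \<in> - U \<Longrightarrow> f x = 0"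
      using Urysohn[of K "- U" 1 0] by blast
    have f01: "0 \<le> f x" "f x \<le> 1" for x using f(2)[of x] by (auto simp: closed_segment_eq_real_ivl)
    have "\<bar>(\<integral>x. f x \<partial>P) - P.prob A\<bar> \<le> P.prob (U - K)"
      by (rule separating_function_integral[OF P A KU]) (use f f01 in auto)
    moreover have "\<bar>(\<integral>x. f x \<partial>Q) - Q.prob A\<bar> \<le> Q.prob (U - K)"
      by (rule separating_function_integral[OF Q A KU]) (use f f01 in auto)
    moreover have "\<bar>(\<integral>x. f x \<partial>P) - (\<integral>x. f x \<partial>Q)\<bar> \<le> c" by (rule c) (use f f01 in auto)
    ultimately show "\<bar>measure P A - measure Q A\<bar> \<le> c + \<epsilon>" using small by linarith
  qed
qed auto

text \<open>The constant is chosen before the probability space and the solution, so it depends on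
  the parameters and the starting point only.\<close>

theorem theorem2p2:
  fixes d :: nat and r a y0 :: real
  assumes "d \<ge> 2" and "r > 0" and "a > 0" and "y0 > r / 2"
  shows "\<exists>C::real. \<forall>(M :: 'a measure) W y L. refl_solution d r a y0 M W y L \<longrightarrow>
           (\<forall>t\<ge>0. tv_dist (distr M borel (y t)) (nu_a d r a) \<le> C * exp (- 4 * a * t))"
proof -
  interpret hard_ball_params d r a by standard (use assms in auto)
  obtain c where c: "0 < c" "\<And>x. l \<le> x \<Longrightarrow> Rb x \<le> c * rho x / x" using mills_ratio by blast
  define C0 where "C0 = 8 * c / l * sqrt (kernel.ip (\<lambda>x. indicator {l<..} x * rho x) (\<lambda>x. indicator {l<..} x * rho x))
     * sqrt (4 * (initial_energy y0 / (4 * a)))"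
  have C0: "0 \<le> C0"
    unfolding C0_def using c l_pos assms kernel.ip_nonneg
    by (intro mult_nonneg_nonneg real_sqrt_ge_zero) (auto simp: initial_energy_def)
  \<comment> \<open>The factor exp (4 a) undoes the shift from t to t - 1. The added 1 covers t < 1,
    where the right-hand side is then at least 1 and so bounds any difference of two means of a
    function with values between 0 and 1.\<close>
  define C where "C = (C0 + 1) * exp (4 * a)"
  show ?thesis
  proof (intro exI[of _ C] allI impI)
    fix M :: "'a measure" and W y L t
    assume sol: "refl_solution d r a y0 M W y L" and t: "0 \<le> (t::real)"
    interpret reflected_sde d r a y0 M W y L by standard (use assms sol in auto)
    have [measurable]: "y t \<in> borel_measurable M" using t by simp
    have PD: "prob_space (distr M borel (y t))" by (rule prob_space_distr) simp
    have Ce: "C * exp (- 4 * a * t) = (C0 + 1) * exp (- 4 * a * (t - 1))"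
      by (simp add: C_def exp_add[symmetric] algebra_simps)
    show "tv_dist (distr M borel (y t)) (nu_a d r a) \<le> C * exp (- 4 * a * t)"
    proof (rule tv_dist_le[OF PD _ nu_prob])
      fix f :: "real \<Rightarrow> real" assume f: "continuous_on UNIV f" "\<And>x. 0 \<le> f x" "\<And>x. f x \<le> 1"
      have f1: "\<bar>f u\<bar> \<le> 1" for u using f(2,3)[of u] by simp
      have fm [measurable]: "f \<in> borel_measurable borel" by (rule borel_measurable_continuous_onI[OF f(1)])
      have dist: "(\<integral>x. f x \<partial>distr M borel (y t)) = expectation (\<lambda>\<omega>. f (y t \<omega>))"
        by (rule integral_distr) measurable
      have nu: "(\<integral>x. f x \<partial>nu_a d r a) = nuf f" by (rule nu_integral(1)[OF fm])
      show "\<bar>(\<integral>x. f x \<partial>distr M borel (y t)) - (\<integral>x. f x \<partial>nu_a d r a)\<bar> \<le> C * exp (- 4 * a * t)"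
      proof (cases "1 \<le> t")
        case True
        have "\<bar>expectation (\<lambda>\<omega>. f (y t \<omega>)) - nuf f\<bar> \<le> C0 * exp (- 4 * a * (t - 1))"
          using continuous_test_decay[OF c f(1) f1 True] by (simp add: rate_constant_def C0_def)
        also have "\<dots> \<le> (C0 + 1) * exp (- 4 * a * (t - 1))" by (intro mult_right_mono) auto
        finally show ?thesis unfolding dist nu Ce .
      next
        case False
        interpret D: prob_space "distr M borel (y t)" by (rule PD)
        interpret nu: prob_space "nu_a d r a" by (rule nu_prob)
        have "integrable (distr M borel (y t)) f"
          by (rule D.integrable_const_bound[where B = 1]) (use f1 in auto)
        then have fD: "0 \<le> (\<integral>x. f x \<partial>distr M borel (y t))" "(\<integral>x. f x \<partial>distr M borel (y t)) \<le> 1"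
          by (auto intro!: D.integral_ge_const D.integral_le_const AE_I2 f)
        have "integrable (nu_a d r a) f"
          by (rule nu.integrable_const_bound[where B = 1]) (use f1 in auto)
        then have fn: "0 \<le> (\<integral>x. f x \<partial>nu_a d r a)" "(\<integral>x. f x \<partial>nu_a d r a) \<le> 1"
          by (auto intro!: nu.integral_ge_const nu.integral_le_const AE_I2 f)
        have "0 \<le> a * (1 - t)" using False assms by simp
        then have "1 \<le> exp (- 4 * a * (t - 1))" by (simp add: algebra_simps)
        then have "(1::real) * 1 \<le> (C0 + 1) * exp (- 4 * a * (t - 1))"
          using C0 by (intro mult_mono) auto
        then show ?thesis using fD fn unfolding Ce by (simp add: abs_le_iff)
      qed
    qed auto
  qed
qed

end
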